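(* Let $n$ be a non-negative integer, let $p,q\in\mathbb{C}$ with $q\notin\{-1,-2,-3,\dots\}$, and let $\delta,\delta',\mu,\mu',\epsilon,\tau\in\mathbb{C}$ be such that $\Re(\epsilon)>0$ and $$\Re(\tau)>\max\{0,\ \Re(\delta+\delta'+\mu-\epsilon),\ \Re(\delta'-\mu')\}.$$ Assume that none of $\tau+\mu'$, $\tau+\epsilon-\delta-\delta'$, $\tau+\epsilon-\delta'-\mu$ is a non-positive integer. Then for every $x>0$, $$\left(I_{0+}^{\delta,\delta',\mu,\mu',\epsilon}\,t^{\tau-1}M_n^{(p,q)}(t)\right)(x)=x^{\tau-\delta-\delta'+\epsilon-1}\,\frac{(-1)^n\,\Gamma(q+n+1)\,\Gamma(\tau)\,\Gamma(\tau+\epsilon-\delta-\delta'-\mu)\,\Gamma(\tau+\mu'-\delta')}{\Gamma(q+1)\,\Gamma(\tau+\mu')\,\Gamma(\tau+\epsilon-\delta-\delta')\,\Gamma(\tau+\epsilon-\delta'-\mu)}$$ $$\times\ {}_5F_4\left[\begin{array}{c}1+n-p,\ -n,\ \tau,\ \tau+\epsilon-\delta-\delta'-\mu,\ \tau+\mu'-\delta'\\ 1+q,\ \tau+\mu',\ \tau+\epsilon-\delta-\delta',\ \tau+\epsilon-\delta'-\mu\end{array}\Big|\,-x\right].$$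
   Context: Pochhammer symbol: $(a)_0=1$, $(a)_k=a(a+1)\cdots(a+k-1)$. The generalized hypergeometric function is $${}_rF_s\left[\begin{array}{c}a_1,\dots,a_r\\ c_1,\dots,c_s\end{array}\Big|\,z\right]=\sum_{k=0}^\infty\frac{(a_1)_k\cdots(a_r)_k}{(c_1)_k\cdots(c_s)_k}\frac{z^k}{k!};$$ when one upper parameter is $-n$ with $n$ a non-negative integer (as here), the series is the finite sum over $0\le k\le n$ and is taken for all $z$. The Jacobi type orthogonal polynomial is $$M_n^{(p,q)}(x)=(-1)^n\,n!\sum_{k=0}^n\binom{p-n-1}{k}\binom{q+n}{n-k}(-x)^k,$$ where $\binom{a}{k}=a(a-1)\cdots(a-k+1)/k!$ for $a\in\mathbb{C}$. Appell's function is $F_3(a,a',b,b';c;X,Y)=\sum_{m,l\ge0}\frac{(a)_m(a')_l(b)_m(b')_l}{(c)_{m+l}\,m!\,l!}X^mY^l$ for $|X|,|Y|<1$, extended by analytic continuation to $(\mathbb{C}\setminus[1,\infty))^2$. The (left-sided) Marichev-Saigo-Maeda fractional integral, for $\Re(\epsilon)>0$ and $x>0$, is $$\left(I_{0+}^{\delta,\delta',\mu,\mu',\epsilon}f\right)(x)=\frac{x^{-\delta}}{\Gamma(\epsilon)}\int_0^x(x-t)^{\epsilon-1}t^{-\delta'}F_3\left(\delta,\delta',\mu,\mu';\epsilon;1-\frac tx,1-\frac xt\right)f(t)\,dt.$$ Here $(I f(t))(x)$ means the operator applied to the function $t\mapsto f(t)$, evaluated at $x$. *)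

theory Defs
  imports "HOL-Analysis.Analysis"
begin

definition hypergeom :: "complex list \<Rightarrow> complex list \<Rightarrow> complex \<Rightarrow> complex" where
  "hypergeom as cs z = eval_fps (fps_hypergeo as cs 1) z"

definition jacobi_M :: "nat \<Rightarrow> complex \<Rightarrow> complex \<Rightarrow> complex \<Rightarrow> complex" where
  "jacobi_M n p q x =
     (-1) ^ n * fact n *
     (\<Sum>k\<le>n. ((p - of_nat n - 1) gchoose k) * ((q + of_nat n) gchoose (n - k)) * (- x) ^ k)"

(* Holomorphy in two variables on an open set: the real Frechet derivative exists
   everywhere and is complex linear. *)
definition holomorphic2_on :: "(complex \<times> complex \<Rightarrow> complex) \<Rightarrow> (complex \<times> complex) set \<Rightarrow> bool" where
  "holomorphic2_on F D \<longleftrightarrow>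
     (\<forall>w\<in>D. \<exists>A B. (F has_derivative (\<lambda>(h, k). A * h + B * k)) (at w))"

definition slit_plane :: "complex set" where
  "slit_plane = - (complex_of_real ` {1..})"

definition appell_F3_series ::
  "complex \<Rightarrow> complex \<Rightarrow> complex \<Rightarrow> complex \<Rightarrow> complex \<Rightarrow> complex \<Rightarrow> complex \<Rightarrow> complex" where
  "appell_F3_series a a' b b' c X Y =
     (\<Sum>\<^sub>\<infinity>(m, l). pochhammer a m * pochhammer a' l * pochhammer b m * pochhammer b' l /
        (pochhammer c (m + l) * fact m * fact l) * X ^ m * Y ^ l)"

(* For c not a non-positive integer the double series has a holomorphic extension to
   slit_plane \<times> slit_plane. This set is open and connected, so the extension is unique
   there; the values outside it are unspecified. *)
definition appell_F3 ::
  "complex \<Rightarrow> complex \<Rightarrow> complex \<Rightarrow> complex \<Rightarrow> complex \<Rightarrow> complex \<Rightarrow> complex \<Rightarrow> complex" where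
  "appell_F3 a a' b b' c X Y =
     (SOME F. holomorphic2_on F (slit_plane \<times> slit_plane) \<and>
        (\<forall>U V. norm U < 1 \<longrightarrow> norm V < 1 \<longrightarrow> F (U, V) = appell_F3_series a a' b b' c U V)) (X, Y)"

definition MSM_integrand ::
  "complex \<Rightarrow> complex \<Rightarrow> complex \<Rightarrow> complex \<Rightarrow> complex \<Rightarrow> (real \<Rightarrow> complex) \<Rightarrow> real \<Rightarrow> real \<Rightarrow> complex" where
  "MSM_integrand \<delta> \<delta>' \<mu> \<mu>' \<epsilon> f x t =
     of_real (x - t) powr (\<epsilon> - 1) * of_real t powr (- \<delta>') *
     appell_F3 \<delta> \<delta>' \<mu> \<mu>' \<epsilon> (1 - of_real (t / x)) (1 - of_real (x / t)) * f t"

definition MSM_integral ::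
  "complex \<Rightarrow> complex \<Rightarrow> complex \<Rightarrow> complex \<Rightarrow> complex \<Rightarrow> (real \<Rightarrow> complex) \<Rightarrow> real \<Rightarrow> complex" where
  "MSM_integral \<delta> \<delta>' \<mu> \<mu>' \<epsilon> f x =
     of_real x powr (- \<delta>) / Gamma \<epsilon> *
     (LINT t:{0<..<x}|lborel. MSM_integrand \<delta> \<delta>' \<mu> \<mu>' \<epsilon> f x t)"

end

theory Submission
  imports Defs "HOL-Complex_Analysis.Complex_Analysis" "HOL-Real_Asymp.Real_Asymp"
begin

text \<open>With \<open>t = x * u\<close> the operator applied to \<open>t powr (\<tau> - 1)\<close> becomes a power of \<open>x\<close> times a moment of the kernel
\<open>I = \<integral> u powr (s - 1) * (1 - u) powr (c - 1) * F3(a, a', b, b'; c; 1 - u, 1 - 1/u) du\<close>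
over the unit interval, where \<open>s = \<tau> - \<delta>'\<close>, \<open>c = \<epsilon>\<close> and \<open>(a, a', b, b') = (\<delta>, \<delta>', \<mu>, \<mu>')\<close>. Everything rests on the evaluation of \<open>I\<close> as
\<open>\<Gamma>(c) \<Gamma>(s + a') \<Gamma>(s + b') \<Gamma>(s + c - a - b)\<close> divided by \<open>\<Gamma>(s + a' + b') \<Gamma>(s + c - a) \<Gamma>(s + c - b)\<close>,
lemma \<open>MSM_kernel_integral\<close>. The polynomial contributes one such moment for each of its powers, with \<open>\<tau> + k\<close> in the
place of \<open>\<tau>\<close>, and the functional equation of \<open>\<Gamma>\<close> turns their sum into the terminating 5F4.

On the path of integration the first argument \<open>1 - u\<close> of F3 stays in the unit disc, while the second, \<open>Y = 1 - 1/u\<close>, runs to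
minus infinity. Pfaff's transformation in the second variable replaces \<open>Y\<close> by \<open>Y / (Y - 1) = 1 - u\<close> (lemma \<open>F3_pfaff\<close>), so that the
integrand becomes \<open>u powr (s + a' - 1) * (1 - u) powr (c - 1)\<close> times a double power series in \<open>1 - u\<close>. Each term integrates to a Beta function, and the resulting double
series is summed by two applications of Gauss's theorem (\<open>gauss_sum\<close>), first over the index that belongs to \<open>Y\<close>. The Beta integral
and the two Gauss sums converge for \<open>Re (s + a') > 0\<close>, \<open>Re (s + b') > 0\<close> and \<open>Re (s + c - a - b) > 0\<close>, and these are the
three lower bounds on \<open>Re \<tau>\<close> in the theorem.

Integrating term by term requires the double series of absolute values to converge, which follows from power bounds for Pochhammer symbols if
\<open>Re a' > 0\<close>. The general case is reduced to this one by the contiguous relation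
\<open>F3(a') = F3(a' + 1) - (b' / c) * Y * F3(a' + 1, b' + 1; c + 1)\<close>: since \<open>Y = - (1 - u) / u\<close>, the last term leads to the same moment with
\<open>s - 1\<close>, \<open>a' + 1\<close>, \<open>b' + 1\<close>, \<open>c + 1\<close>, for which the three quantities above are unchanged.

Finally, Appell's function is specified as some holomorphic extension of its series, so that nothing can be said about it before such an extension
has been constructed (\<open>F3_extendable\<close>). If \<open>a\<close>, \<open>a'\<close> and \<open>c - a - a'\<close> have real parts above 1, it is produced by two Euler
integrals with continuous weights, which only scale the arguments by factors between 0 and 1 and so do not leave the star-shaped slit plane; contiguous relations between the series
extend this to all parameters with \<open>Re c > 0\<close>. The extension is unique by the identity theorem, applied in one variable at a time.\<close>

section \<open>The Beta integral with complex exponents\<close>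

lemma Re_pos_not_nonpos_Int: "Re z > 0 \<Longrightarrow> z \<notin> \<int>\<^sub>\<le>\<^sub>0"
  by (auto elim!: nonpos_Ints_cases)

lemma Gamma_nonzero_Re_pos: "Re z > 0 \<Longrightarrow> Gamma z \<noteq> 0"
  using Re_pos_not_nonpos_Int[of z] by (simp add: Gamma_eq_zero_iff)

lemma set_integrable_Beta_complex:
  fixes a b :: complex
  assumes "Re a > 0" "Re b > 0"
  shows "set_integrable lborel {0<..<1}
           (\<lambda>u. complex_of_real u powr (a - 1) * complex_of_real (1 - u) powr (b - 1))"
proof -
  have "set_integrable lborel {0<..<1} (\<lambda>u. u powr (Re a - 1) * (1 - u) powr (Re b - 1))"
    by (rule set_integrable_subset[OF integrable_Beta]) (use assms in auto)
  thus ?thesis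
    unfolding set_integrable_def
  proof (rule Bochner_Integration.integrable_bound)
    show "(\<lambda>x. indicat_real {0<..<1} x *\<^sub>R (complex_of_real x powr (a - 1) * complex_of_real (1 - x) powr (b - 1)))
            \<in> borel_measurable lborel"
      by measurable
    show "AE x in lborel. norm (indicat_real {0<..<1} x *\<^sub>R (complex_of_real x powr (a - 1) * complex_of_real (1 - x) powr (b - 1)))
      \<le> norm (indicat_real {0<..<1} x *\<^sub>R (x powr (Re a - 1) * (1 - x) powr (Re b - 1)))"
      by (intro AE_I2) (auto simp: indicator_def norm_mult norm_powr_real_powr abs_mult simp del: of_real_diff)
  qed
qed

definition Gamma_integrand :: "complex \<Rightarrow> real \<Rightarrow> complex" where
  "Gamma_integrand z t = indicat_real {0<..} t *\<^sub>R (complex_of_real t powr (z - 1) / of_real (exp t))"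

lemma Gamma_integrand_measurable [measurable]: "Gamma_integrand z \<in> borel_measurable borel"
  unfolding Gamma_integrand_def by measurable

lemma Gamma_integrand_integrable:
  assumes "Re z > 0"
  shows "integrable lborel (Gamma_integrand z)" "(LINT t|lborel. Gamma_integrand z t) = Gamma z"
proof -
  have I: "set_integrable lborel {0<..} (\<lambda>t. complex_of_real t powr (z - 1) / of_real (exp t))"
  proof -
    have "(\<lambda>t. complex_of_real t powr (z - 1) / of_real (exp t)) absolutely_integrable_on {0<..}"
      using absolutely_integrable_Gamma_integral'[OF assms] .
    thus ?thesis unfolding set_integrable_def
      by (subst (asm) integrable_completion) auto
  qed
  thus "integrable lborel (Gamma_integrand z)" unfolding set_integrable_def Gamma_integrand_def .
  have "(LINT t:{0<..}|lborel. complex_of_real t powr (z - 1) / of_real (exp t)) = 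
        integral {0<..} (\<lambda>t. complex_of_real t powr (z - 1) / of_real (exp t))"
    by (rule set_borel_integral_eq_integral(2)[OF I])
  also have "\<dots> = Gamma z"
    using Gamma_integral_complex'[OF assms] by (rule integral_unique)
  finally show "(LINT t|lborel. Gamma_integrand z t) = Gamma z"
    unfolding set_lebesgue_integral_def Gamma_integrand_def .
qed

text \<open>Written as a double integral and with \<open>y\<close> replaced by \<open>y - x\<close>, the product \<open>Gamma a * Gamma b\<close> is the integral over \<open>y\<close> of a
convolution; scaling \<open>x\<close> by \<open>y\<close> splits the convolution into the Beta integral and the integrand of \<open>Gamma (a + b)\<close>.\<close>

lemma set_integral_Beta_complex:
  fixes a b :: complex
  assumes a: "Re a > 0" and b: "Re b > 0"
  shows "(LINT u:{0<..<1}|lborel. complex_of_real u powr (a - 1) * complex_of_real (1 - u) powr (b - 1))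
           = Beta a b" (is "?B = _")
proof -
  define h where "h = (\<lambda>x y. Gamma_integrand a x * Gamma_integrand b (y - x))"
  have h_meas [measurable]: "(\<lambda>(x, y). h x y) \<in> borel_measurable (lborel \<Otimes>\<^sub>M lborel)"
    unfolding h_def by measurable
  have shift: "integrable lborel (\<lambda>y. Gamma_integrand b (y - x))" "(LINT y|lborel. Gamma_integrand b (y - x)) = Gamma b"
     "(LINT y|lborel. norm (Gamma_integrand b (y - x))) = (LINT y|lborel. norm (Gamma_integrand b y))" for x
  proof -
    show "integrable lborel (\<lambda>y. Gamma_integrand b (y - x))"
      using lborel_integrable_real_affine[OF Gamma_integrand_integrable(1)[OF b], of 1 "-x"] by simp
    show "(LINT y|lborel. Gamma_integrand b (y - x)) = Gamma b"
      using lborel_integral_real_affine[of 1 "Gamma_integrand b" "-x"] Gamma_integrand_integrable(2)[OF b] by simp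
    show "(LINT y|lborel. norm (Gamma_integrand b (y - x))) = (LINT y|lborel. norm (Gamma_integrand b y))"
      using lborel_integral_real_affine[of 1 "\<lambda>y. norm (Gamma_integrand b y)" "-x"] by simp
  qed
  have int: "integrable (lborel \<Otimes>\<^sub>M lborel) (\<lambda>(x, y). h x y)"
  proof (rule lborel_pair.Fubini_integrable[OF h_meas])
    show "integrable lborel (\<lambda>x. LINT y|lborel. norm (case (x, y) of (x, y) \<Rightarrow> h x y))"
      using Gamma_integrand_integrable(1)[OF a] by (simp add: h_def norm_mult shift)
    show "AE x in lborel. integrable lborel (\<lambda>y. case (x, y) of (x, y) \<Rightarrow> h x y)"
      using shift(1) by (simp add: h_def)
  qed
  have inner: "(LINT x|lborel. h x y) = ?B * Gamma_integrand (a + b) y" for y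
  proof (cases "y > 0")
    case False
    hence "h x y = 0" for x by (auto simp: h_def Gamma_integrand_def indicator_def)
    thus ?thesis using False by (simp add: Gamma_integrand_def)
  next
    case True
    have "(LINT x|lborel. h x y) = y *\<^sub>R (LINT x|lborel. h (y * x) y)"
      using lborel_integral_real_affine[of y "\<lambda>x. h x y" 0] True by simp
    also have "(\<lambda>x. h (y * x) y) = (\<lambda>x. (complex_of_real y powr (a + b - 2) / of_real (exp y)) * 
        (indicat_real {0<..<1} x *\<^sub>R (complex_of_real x powr (a - 1) * complex_of_real (1 - x) powr (b - 1))))"
    proof
      fix x :: real
      show "h (y * x) y = (complex_of_real y powr (a + b - 2) / of_real (exp y)) * 
        (indicat_real {0<..<1} x *\<^sub>R (complex_of_real x powr (a - 1) * complex_of_real (1 - x) powr (b - 1)))"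
      proof (cases "x \<in> {0<..<1}")
        case False
        hence "\<not> (y * x > 0 \<and> y - y * x > 0)" using True
          by (auto simp: zero_less_mult_iff)
        thus ?thesis using False by (auto simp: h_def Gamma_integrand_def)
      next
        case x: True
        have eq: "y - y * x = y * (1 - x)" by (simp add: algebra_simps)
        have pos: "y * (1 - x) > 0" "y * x > 0" using x True by auto
        have e: "exp y = exp (y * x) * exp (y * (1 - x))"
          by (simp add: algebra_simps flip: exp_add)
        have p1: "complex_of_real (y * x) powr (a - 1) = complex_of_real y powr (a - 1) * complex_of_real x powr (a - 1)"
          using True x unfolding of_real_mult by (intro powr_times_real) auto
        have p2: "complex_of_real (y * (1 - x)) powr (b - 1) = complex_of_real y powr (b - 1) * complex_of_real (1 - x) powr (b - 1)"
          using True x unfolding of_real_mult by (intro powr_times_real) auto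
        have p3: "complex_of_real y powr (a + b - 2) = complex_of_real y powr (a - 1) * complex_of_real y powr (b - 1)"
          by (simp flip: powr_add)
        have "h (y * x) y = (complex_of_real (y * x) powr (a - 1) / of_real (exp (y * x))) *
                (complex_of_real (y * (1 - x)) powr (b - 1) / of_real (exp (y * (1 - x))))"
          unfolding h_def Gamma_integrand_def eq using pos by (simp add: indicator_def del: of_real_mult)
        thus ?thesis unfolding p1 p2 p3 e using x by simp
      qed
    qed
    also have "(LINT x|lborel. \<dots> x) = (complex_of_real y powr (a + b - 2) / of_real (exp y)) * ?B"
      unfolding set_lebesgue_integral_def by (rule integral_mult_right_zero)
    also have "y *\<^sub>R \<dots> = ?B * Gamma_integrand (a + b) y"
    proof -
      have "complex_of_real y powr (a + b - 1) = complex_of_real y powr (a + b - 2) * complex_of_real y powr 1"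
        unfolding powr_add[symmetric] by simp
      thus ?thesis using True by (simp add: Gamma_integrand_def scaleR_conv_of_real)
    qed
    finally show ?thesis .
  qed
  have ab: "Re (a + b) > 0" using a b by simp
  have "Gamma a * Gamma b = (LINT x|lborel. LINT y|lborel. h x y)"
    using Gamma_integrand_integrable[OF a] by (simp add: h_def shift)
  also have "\<dots> = (LINT y|lborel. LINT x|lborel. h x y)"
    using lborel_pair.Fubini_integral[OF int] by simp
  also have "\<dots> = ?B * Gamma (a + b)"
    using Gamma_integrand_integrable[OF ab] by (simp add: inner)
  finally have "Gamma a * Gamma b = ?B * Gamma (a + b)" .
  moreover have "Gamma (a + b) \<noteq> 0"
    using ab by (rule Gamma_nonzero_Re_pos)
  ultimately show ?thesis by (simp add: Beta_def field_simps)
qed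

text \<open>Up to a constant this is the modulus of \<open>pochhammer z n\<close> for large \<open>n\<close>, if \<open>x = Re z\<close>. The bounds below only use \<open>x\<close> strictly above or
below \<open>Re z\<close>; the small loss is harmless since every convergence condition is a strict inequality.\<close>

section \<open>Growth of Pochhammer symbols\<close>

definition poch_size :: "real \<Rightarrow> nat \<Rightarrow> real" where
  "poch_size x n = fact n * (real n + 1) powr (x - 1)"

lemma poch_size_pos [simp]: "poch_size x n > 0"
  by (simp add: poch_size_def)

lemma poch_size_Suc:
  "poch_size x (Suc n) / poch_size x n = (real n + 1) * ((real n + 2) / (real n + 1)) powr (x - 1)"
  by (simp add: poch_size_def powr_divide field_simps)

text \<open>The quotient on the right is \<open>k + x + O(1/k)\<close>, and the left-hand side is \<open>k + Re z + O(1/k)\<close>.\<close>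

lemma eventually_norm_add_nat_le:
  assumes "Re z < x"
  shows "eventually (\<lambda>k. norm (z + of_nat k) \<le> poch_size x (Suc k) / poch_size x k) sequentially"
proof -
  define a b where "a = Re z" and "b = Im z"
  have "((\<lambda>k::nat. (real k + 1) * ((real k + 2) / (real k + 1)) powr (x - 1) - sqrt ((a + real k)^2 + b^2)) \<longlongrightarrow> x - a) sequentially"
    by real_asymp
  hence "eventually (\<lambda>k::nat. (real k + 1) * ((real k + 2) / (real k + 1)) powr (x - 1) - sqrt ((a + real k)^2 + b^2) > 0) sequentially"
    using assms by (intro order_tendstoD(1)) (auto simp: a_def)
  thus ?thesis unfolding poch_size_Suc
    by eventually_elim (simp add: cmod_def a_def b_def)
qed

lemma eventually_norm_add_nat_ge:
  assumes "Re z > x"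
  shows "eventually (\<lambda>k. norm (z + of_nat k) \<ge> poch_size x (Suc k) / poch_size x k) sequentially"
proof -
  define a b where "a = Re z" and "b = Im z"
  have "((\<lambda>k::nat. (real k + 1) * ((real k + 2) / (real k + 1)) powr (x - 1) - sqrt ((a + real k)^2 + b^2)) \<longlongrightarrow> x - a) sequentially"
    by real_asymp
  hence "eventually (\<lambda>k::nat. (real k + 1) * ((real k + 2) / (real k + 1)) powr (x - 1) - sqrt ((a + real k)^2 + b^2) < 0) sequentially"
    using assms by (intro order_tendstoD(2)) (auto simp: a_def)
  thus ?thesis unfolding poch_size_Suc
    by eventually_elim (simp add: cmod_def a_def b_def)
qed

lemma norm_le_of_eventually_ratio:
  fixes a :: "nat \<Rightarrow> 'a :: real_normed_vector" and h :: "nat \<Rightarrow> real"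
  assumes h: "\<And>k. h k > 0"
  assumes ev: "eventually (\<lambda>k. norm (a (Suc k)) * h k \<le> norm (a k) * h (Suc k)) sequentially"
  obtains C where "C > 0" "\<And>k. norm (a k) \<le> C * h k"
proof -
  from ev obtain K where K: "\<And>k. k \<ge> K \<Longrightarrow> norm (a (Suc k)) * h k \<le> norm (a k) * h (Suc k)"
    by (auto simp: eventually_sequentially)
  define C where "C = 1 + (\<Sum>k\<le>K. norm (a k) / h k)"
  have C0: "C > 0" unfolding C_def using h
    by (intro add_pos_nonneg sum_nonneg divide_nonneg_pos) auto
  have le: "norm (a k) / h k \<le> C" if "k \<le> K" for k
  proof -
    have "norm (a k) / h k \<le> (\<Sum>k\<le>K. norm (a k) / h k)"
      using that h by (intro member_le_sum) (auto intro!: divide_nonneg_pos)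
    thus ?thesis by (simp add: C_def)
  qed
  have "norm (a k) \<le> C * h k" for k
  proof (cases "k \<le> K")
    case True
    thus ?thesis using le[OF True] h[of k] by (simp add: field_simps)
  next
    case False
    hence "K \<le> k" by simp
    thus ?thesis
    proof (induction k rule: dec_induct)
      case base
      thus ?case using le[of K] h[of K] by (simp add: field_simps)
    next
      case (step k)
      have "norm (a (Suc k)) * h k \<le> norm (a k) * h (Suc k)" using K step by auto
      also have "\<dots> \<le> (C * h k) * h (Suc k)" using step h by (intro mult_right_mono) (auto intro: less_imp_le)
      finally show ?case using h[of k] by (simp add: algebra_simps)
    qed
  qed
  with C0 show ?thesis by (intro that)
qed

text \<open>The point is that \<open>C\<close> does not depend on the starting index \<open>m\<close>: only finitely many factors \<open>z + k\<close> exceed the corresponding quotient of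
\<open>poch_size\<close>, and their total excess is bounded wherever the product begins.\<close>

lemma pochhammer_shift_bound:
  fixes z :: complex
  assumes x: "Re z < x"
  obtains C where "C > 0" "\<And>m l. norm (pochhammer (z + of_nat m) l) \<le> C * poch_size x (m + l) / poch_size x m"
proof -
  define r where "r k = poch_size x (Suc k) / poch_size x k" for k
  have r0: "r k > 0" for k by (simp add: r_def)
  from eventually_norm_add_nat_le[OF x] obtain K where K: "\<And>k. k \<ge> K \<Longrightarrow> norm (z + of_nat k) \<le> r k"
    by (auto simp: eventually_sequentially r_def)
  \<comment> \<open>the excess of each factor over its target quotient, accumulated in \<open>P\<close>\<close>
  define c where "c k = (if k < K then max 1 (norm (z + of_nat k) / r k) else 1)" for k
  define P where "P N = (\<Prod>k<N. c k)" for N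
  have c1: "c k \<ge> 1" for k by (auto simp: c_def)
  have c2: "norm (z + of_nat k) \<le> c k * r k" for k
    using K[of k] r0[of k] by (auto simp: c_def max_def field_simps)
  have P1: "P N \<ge> 1" for N unfolding P_def using c1 by (intro prod_ge_1) auto
  have PK: "P N \<le> P K" for N
  proof (cases "N \<le> K")
    case True
    thus ?thesis unfolding P_def using c1
      by (intro prod_mono2) (auto intro: order_trans[OF zero_le_one])
  next
    case False
    hence "P N = P K" unfolding P_def by (intro prod.mono_neutral_right) (auto simp: c_def)
    thus ?thesis by simp
  qed
  have *: "norm (pochhammer (z + of_nat m) l) * poch_size x m * P m \<le> poch_size x (m + l) * P (m + l)" for m l
  proof (induction l)
    case (Suc l)
    have "norm (pochhammer (z + of_nat m) (Suc l)) * poch_size x m * P m =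
        (norm (pochhammer (z + of_nat m) l) * poch_size x m * P m) * norm (z + of_nat (m + l))"
      by (simp add: pochhammer_Suc norm_mult add_ac)
    also have "\<dots> \<le> (poch_size x (m + l) * P (m + l)) * (c (m + l) * r (m + l))"
      using P1[of "m + l"] by (intro mult_mono Suc c2) (auto intro!: mult_nonneg_nonneg less_imp_le[OF poch_size_pos])
    also have "\<dots> = poch_size x (m + Suc l) * P (m + Suc l)"
      using poch_size_pos[of x "m+l"] by (simp add: P_def r_def del: poch_size_pos)
    finally show ?case .
  qed simp
  show ?thesis
  proof (rule that[of "P K"])
    show "P K > 0" using P1[of K] by simp
    fix m l
    have "norm (pochhammer (z + of_nat m) l) * poch_size x m * 1 \<le> norm (pochhammer (z + of_nat m) l) * poch_size x m * P m"
      using P1[of m] by (intro mult_left_mono) (auto intro!: mult_nonneg_nonneg less_imp_le[OF poch_size_pos])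
    also have "\<dots> \<le> poch_size x (m + l) * P (m + l)" by (rule *)
    also have "\<dots> \<le> poch_size x (m + l) * P K" using PK by (intro mult_left_mono) (auto intro!: less_imp_le[OF poch_size_pos])
    finally show "norm (pochhammer (z + of_nat m) l) \<le> P K * poch_size x (m + l) / poch_size x m"
      by (simp add: field_simps)
  qed
qed

lemma pochhammer_bound:
  fixes z :: complex
  assumes x: "Re z < x"
  obtains C where "C > 0" "\<And>l. norm (pochhammer z l) \<le> C * poch_size x l"
proof -
  from pochhammer_shift_bound[OF x] obtain C where C: "C > 0" 
    "\<And>m l. norm (pochhammer (z + of_nat m) l) \<le> C * poch_size x (m + l) / poch_size x m" by metis
  show ?thesis using C(2)[of 0] C(1) by (intro that[of C]) (auto simp: poch_size_def)
qed

lemma rGamma_shift_bound: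
  fixes z :: complex
  assumes x: "x < Re z"
  obtains C where "C > 0" "\<And>k. norm (rGamma (z + of_nat k)) \<le> C / poch_size x k"
proof -
  have ev: "eventually (\<lambda>k. norm (rGamma (z + of_nat (Suc k))) * inverse (poch_size x k)
                 \<le> norm (rGamma (z + of_nat k)) * inverse (poch_size x (Suc k))) sequentially"
    using eventually_norm_add_nat_ge[OF x]
  proof eventually_elim
    case (elim k)
    have *: "rGamma (z + of_nat k) = (z + of_nat k) * rGamma (z + of_nat (Suc k))"
      using rGamma_plus1[of "z + of_nat k"] by (simp add: add_ac)
    have "norm (rGamma (z + of_nat (Suc k))) * (poch_size x (Suc k) / poch_size x k) \<le> norm (rGamma (z + of_nat (Suc k))) * norm (z + of_nat k)"
      by (intro mult_left_mono elim) auto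
    thus ?case unfolding * norm_mult by (simp add: field_simps)
  qed
  obtain C where "C > 0" "\<And>k. norm (rGamma (z + of_nat k)) \<le> C * inverse (poch_size x k)"
    by (rule norm_le_of_eventually_ratio[where a = "\<lambda>k. rGamma (z + of_nat k)" and h = "\<lambda>k. inverse (poch_size x k)", OF _ ev])
       auto
  thus ?thesis by (intro that[of C]) (auto simp: field_simps)
qed

lemma summable_on_nat_powr:
  assumes "x < -1"
  shows "(\<lambda>k::nat. (real k + 1) powr x) summable_on UNIV"
proof -
  have "summable (\<lambda>k. real k powr x)" using assms by (simp add: summable_real_powr_iff)
  hence "summable (\<lambda>k. real (Suc k) powr x)" by (subst summable_Suc_iff)
  thus ?thesis by (intro norm_summable_imp_summable_on) (simp add: add_ac)
qed

text \<open>The terms of \<open>2F1(a, b; c; 1) / \<Gamma>(c)\<close>. The reciprocal Gamma factor keeps them meaningful if \<open>c\<close> is a non-positive integer, a case that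
does occur in the outer of the two sums to which Gauss's theorem is applied.\<close>

section \<open>Gauss's summation theorem\<close>

definition gauss_term :: "complex \<Rightarrow> complex \<Rightarrow> complex \<Rightarrow> nat \<Rightarrow> complex" where
  "gauss_term a b c k = pochhammer a k * pochhammer b k / fact k * rGamma (c + of_nat k)"

text \<open>Each of the three factors costs a third of the gap between \<open>Re (a + b - c)\<close> and \<open>x\<close>.\<close>

lemma gauss_term_bound:
  assumes "Re (a + b - c) < x"
  obtains C where "C > 0" "\<And>k. norm (gauss_term a b c k) \<le> C * (real k + 1) powr (x - 1)"
proof -
  define e where "e = (x - Re (a + b - c)) / 3"
  have e: "e > 0" using assms by (simp add: e_def)
  obtain A where A: "A > 0" "\<And>k. norm (pochhammer a k) \<le> A * poch_size (Re a + e) k"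
    using pochhammer_bound[of a "Re a + e"] e by auto
  obtain B where B: "B > 0" "\<And>k. norm (pochhammer b k) \<le> B * poch_size (Re b + e) k"
    using pochhammer_bound[of b "Re b + e"] e by auto
  obtain D where D: "D > 0" "\<And>k. norm (rGamma (c + of_nat k)) \<le> D / poch_size (Re c - e) k"
    using rGamma_shift_bound[of "Re c - e" c] e by auto
  have "norm (gauss_term a b c k) \<le> A * B * D * (real k + 1) powr (x - 1)" for k
  proof -
    have "norm (gauss_term a b c k) = norm (pochhammer a k) * norm (pochhammer b k) / fact k * norm (rGamma (c + of_nat k))"
      by (simp add: gauss_term_def norm_mult norm_divide)
    also have "\<dots> \<le> (A * poch_size (Re a + e) k) * (B * poch_size (Re b + e) k) / fact k * (D / poch_size (Re c - e) k)"
      using A B D by (intro mult_mono divide_right_mono)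
         (auto intro!: mult_nonneg_nonneg divide_nonneg_nonneg less_imp_le[OF poch_size_pos] less_imp_le[OF A(1)] less_imp_le[OF B(1)])
    also have "\<dots> = A * B * D * ((real k + 1) powr (Re a + e - 1) * (real k + 1) powr (Re b + e - 1) / (real k + 1) powr (Re c - e - 1))"
      by (simp add: poch_size_def field_simps)
    also have "(real k + 1) powr (Re a + e - 1) * (real k + 1) powr (Re b + e - 1) / (real k + 1) powr (Re c - e - 1) = (real k + 1) powr (x - 1)"
    proof -
      have "Re a + e - 1 + (Re b + e - 1) - (Re c - e - 1) = x - 1" by (simp add: e_def field_simps)
      thus ?thesis by (simp only: powr_add[symmetric] powr_diff[symmetric])
    qed
    finally show ?thesis .
  qed
  thus ?thesis using A(1) B(1) D(1) by (intro that[of "A * B * D"]) auto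
qed

lemma gauss_term_summable:
  assumes "Re (c - a - b) > 0"
  shows "summable (\<lambda>k. norm (gauss_term a b c k))"
proof -
  define x where "x = - Re (c - a - b) / 2"
  have x: "x < 0" "Re (a + b - c) < x" using assms by (auto simp: x_def)
  obtain C where C: "C > 0" "\<And>k. norm (gauss_term a b c k) \<le> C * (real k + 1) powr (x - 1)"
    using gauss_term_bound[OF x(2)] by metis
  have "summable (\<lambda>k. C * (real k + 1) powr (x - 1))"
    using summable_on_nat_powr[of "x - 1"] x(1)
    by (intro summable_mult summable_on_imp_summable) auto
  thus ?thesis by (rule summable_comparison_test'[where N = 0]) (use C in auto)
qed

text \<open>The difference of the two sides telescopes, with \<open>k\<close> times the \<open>k\<close>-th term as the telescoping quantity; it tends to 0 by
the growth bound and \<open>Re (c - a - b) > 0\<close>.\<close>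

lemma gauss_contiguous:
  assumes c: "Re (c - a - b) > 0"
  shows "(c - a - b) * (\<Sum>k. gauss_term a b c k) = (c - a) * (c - b) * (\<Sum>k. gauss_term a b (c + 1) k)"
proof -
  define x where "x = - Re (c - a - b) / 2"
  have x: "x < 0" "Re (a + b - c) < x" using assms by (auto simp: x_def)
  \<comment> \<open>the telescoping quantity\<close>
  define G where "G k = of_nat k * gauss_term a b c k" for k
  have rec: "rGamma (c + of_nat k) = (c + of_nat k) * rGamma (c + 1 + of_nat k)" for k
    using rGamma_plus1[of "c + of_nat k"] by (simp add: add_ac)
  have tele: "(c - a - b) * gauss_term a b c k - (c - a) * (c - b) * gauss_term a b (c + 1) k = G k - G (Suc k)" for k
  proof -
    define v where "v = gauss_term a b (c + 1) k"
    have u: "gauss_term a b c k = (c + of_nat k) * v"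
      by (simp add: v_def gauss_term_def rec)
    have G': "G (Suc k) = (a + of_nat k) * (b + of_nat k) * v"
      by (simp add: v_def gauss_term_def G_def pochhammer_Suc add_ac divide_simps) (simp add: algebra_simps flip: of_nat_Suc)?
    show ?thesis unfolding G' v_def[symmetric] unfolding G_def u by (simp add: algebra_simps)
  qed
  have s1: "summable (gauss_term a b c)" "summable (gauss_term a b (c + 1))"
    by (rule summable_norm_cancel, rule gauss_term_summable, use assms in simp)+
  have "G \<longlonglongrightarrow> 0"
  proof -
    obtain C where C: "C > 0" "\<And>k. norm (gauss_term a b c k) \<le> C * (real k + 1) powr (x - 1)"
      using gauss_term_bound[OF x(2)] by metis
    have "norm (G k) \<le> C * (real k + 1) powr x" for k
    proof -
      have "norm (G k) \<le> (real k + 1) * (C * (real k + 1) powr (x - 1))"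
        unfolding G_def norm_mult norm_of_nat using C by (intro mult_mono) auto
      also have "\<dots> = C * (real k + 1) powr x" by (simp add: powr_diff)
      finally show ?thesis .
    qed
    moreover have "(\<lambda>k. C * (real k + 1) powr x) \<longlonglongrightarrow> 0" using x(1) by real_asymp
    ultimately show ?thesis by (intro Lim_null_comparison[of G "\<lambda>k. C * (real k + 1) powr x"]) auto
  qed
  hence "(\<lambda>k. G k - G (Suc k)) sums (G 0 - 0)" by (rule telescope_sums')
  moreover have "(\<lambda>k. G k - G (Suc k)) sums ((c - a - b) * (\<Sum>k. gauss_term a b c k) - (c - a) * (c - b) * (\<Sum>k. gauss_term a b (c + 1) k))"
    unfolding tele[symmetric] using s1 by (intro sums_diff sums_mult summable_sums)
  ultimately have "G 0 - 0 = (c - a - b) * (\<Sum>k. gauss_term a b c k) - (c - a) * (c - b) * (\<Sum>k. gauss_term a b (c + 1) k)"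
    using sums_unique2 by blast
  thus ?thesis by (simp add: G_def)
qed

lemma gauss_contiguous_iter:
  assumes c: "Re (c - a - b) > 0"
  shows "pochhammer (c - a - b) n * (\<Sum>k. gauss_term a b c k) =
           pochhammer (c - a) n * pochhammer (c - b) n * (\<Sum>k. gauss_term a b (c + of_nat n) k)"
proof (induction n)
  case (Suc n)
  have "Re (c + of_nat n - a - b) > 0" using assms by simp
  from gauss_contiguous[OF this]
  have *: "(c - a - b + of_nat n) * (\<Sum>k. gauss_term a b (c + of_nat n) k) =
          (c - a + of_nat n) * (c - b + of_nat n) * (\<Sum>k. gauss_term a b (c + of_nat (Suc n)) k)"
    by (simp add: algebra_simps)
  have "pochhammer (c - a - b) (Suc n) * (\<Sum>k. gauss_term a b c k) = 
         (c - a - b + of_nat n) * (pochhammer (c - a - b) n * (\<Sum>k. gauss_term a b c k))"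
    by (simp add: pochhammer_Suc)
  also have "\<dots> = pochhammer (c - a) n * pochhammer (c - b) n * ((c - a - b + of_nat n) * (\<Sum>k. gauss_term a b (c + of_nat n) k))"
    by (simp only: Suc.IH) (simp add: mult_ac)
  finally show ?case by (simp only: *) (simp add: pochhammer_Suc mult_ac)
qed simp

lemma norm_pochhammer_ge:
  assumes "Re z > 0"
  shows "norm (pochhammer z n) \<ge> pochhammer (Re z) n"
proof (induction n)
  case (Suc n)
  have "Re z + real n \<le> norm (z + of_nat n)" using complex_Re_le_cmod[of "z + of_nat n"] by simp
  moreover have "pochhammer (Re z) n \<ge> 0" using pochhammer_pos[OF assms] less_imp_le by blast
  ultimately show ?case using Suc assms by (simp add: pochhammer_Suc norm_mult mult_mono)
qed simp

text \<open>For large parameters only the term with \<open>k = 0\<close> survives: raising \<open>c\<close> by \<open>n\<close> shrinks all other terms by a factor of at least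
\<open>g / (g + n)\<close>, where \<open>g = Re c\<close>.\<close>

lemma gauss_sum_tendsto:
  assumes c: "Re c > 0" "Re (c - a - b) > 0"
  shows "(\<lambda>n. Gamma (c + of_nat n) * (\<Sum>k. gauss_term a b (c + of_nat n) k)) \<longlonglongrightarrow> 1"
proof -
  define g where "g = Re c"
  have g: "g > 0" using c by (simp add: g_def)
  define w where "w k = pochhammer a k * pochhammer b k / fact k" for k
  define M where "M = (\<Sum>k. norm (gauss_term a b (of_real g) k)) * Gamma g"
  have nz: "Gamma (c + of_nat n) \<noteq> 0" for n
    using c by (intro Gamma_nonzero_Re_pos) simp
  have sg: "summable (\<lambda>k. norm (gauss_term a b (of_real g) k))"
    by (rule gauss_term_summable) (use c in \<open>simp add: g_def\<close>)
  have wg: "norm (w k) / pochhammer g k = norm (gauss_term a b (of_real g) k) * Gamma g" for k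
  proof -
    have "complex_of_real g + of_nat k = of_real (g + of_nat k)" by simp
    hence "rGamma (complex_of_real g + of_nat k) = of_real (rGamma (g + of_nat k))"
      by (simp only: rGamma_complex_of_real)
    moreover have "pochhammer g k = Gamma (g + of_nat k) / Gamma g"
      using g by (intro pochhammer_Gamma) (auto elim!: nonpos_Ints_cases)
    moreover have "Gamma (g + real k) > 0" "Gamma g > 0" "pochhammer g k > 0" using g by (auto intro!: pochhammer_pos)
    ultimately show ?thesis
      by (simp add: gauss_term_def w_def norm_mult norm_divide rGamma_inverse_Gamma field_simps)
  qed
  have bound: "norm (Gamma (c + of_nat n) * (\<Sum>k. gauss_term a b (c + of_nat n) k) - 1) \<le> g / (g + n) * M" for n
  proof -
    have t: "Gamma (c + of_nat n) * gauss_term a b (c + of_nat n) k = w k / pochhammer (c + of_nat n) k" for k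
    proof -
      have "c + of_nat n \<notin> \<int>\<^sub>\<le>\<^sub>0" using c by (intro Re_pos_not_nonpos_Int) simp
      hence "pochhammer (c + of_nat n) k = Gamma (c + of_nat n + of_nat k) / Gamma (c + of_nat n)"
        by (rule pochhammer_Gamma)
      hence G: "Gamma (c + of_nat n + of_nat k) = pochhammer (c + of_nat n) k * Gamma (c + of_nat n)"
        using nz[of n] by simp
      show ?thesis using nz[of n]
        by (simp add: gauss_term_def w_def rGamma_inverse_Gamma G divide_inverse)
    qed
    have s: "summable (\<lambda>k. norm (gauss_term a b (c + of_nat n) k))"
      by (rule gauss_term_summable) (use c in simp)
    have s': "summable (\<lambda>k. norm (Gamma (c + of_nat n) * gauss_term a b (c + of_nat n) k))"
      unfolding norm_mult by (intro summable_mult s)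
    have "Gamma (c + of_nat n) * (\<Sum>k. gauss_term a b (c + of_nat n) k) = (\<Sum>k. w k / pochhammer (c + of_nat n) k)"
      unfolding t[symmetric] by (rule suminf_mult[symmetric]) (rule summable_norm_cancel[OF s])
    also have "\<dots> = (\<Sum>k. w (Suc k) / pochhammer (c + of_nat n) (Suc k)) + 1"
      using suminf_split_head[of "\<lambda>k. w k / pochhammer (c + of_nat n) k"] summable_norm_cancel[OF s']
      by (simp add: t w_def)
    finally have "norm (Gamma (c + of_nat n) * (\<Sum>k. gauss_term a b (c + of_nat n) k) - 1) = 
                  norm (\<Sum>k. w (Suc k) / pochhammer (c + of_nat n) (Suc k))" by simp
    also have "\<dots> \<le> (\<Sum>k. g / (g + n) * (norm (gauss_term a b (of_real g) (Suc k)) * Gamma g))"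
    proof (rule norm_suminf_le)
      show "norm (w (Suc k) / pochhammer (c + of_nat n) (Suc k)) \<le> g / (g + n) * (norm (gauss_term a b (of_real g) (Suc k)) * Gamma g)" for k
      proof -
        have "pochhammer g (Suc k) * ((g + n) / g) \<le> pochhammer (g + n) (Suc k)"
        proof -
          have "pochhammer (g + 1) k \<le> pochhammer (g + n + 1) k"
          proof (induction k)
            case (Suc k)
            have "pochhammer (g + 1) k \<ge> 0" "pochhammer (g + n + 1) k \<ge> 0"
              using g by (auto intro!: less_imp_le[OF pochhammer_pos])
            thus ?case using Suc g by (simp add: pochhammer_Suc mult_mono)
          qed simp
          hence "(g + n) * pochhammer (g + 1) k \<le> (g + n) * pochhammer (g + n + 1) k"
            using g by (intro mult_left_mono) auto
          thus ?thesis using g by (simp add: pochhammer_rec)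
        qed
        also have "\<dots> \<le> norm (pochhammer (c + of_nat n) (Suc k))"
          using norm_pochhammer_ge[of "c + of_nat n" "Suc k"] c by (simp add: g_def)
        finally have *: "pochhammer g (Suc k) * ((g + n) / g) \<le> norm (pochhammer (c + of_nat n) (Suc k))" .
        have pp: "pochhammer g (Suc k) > 0" using g by (rule pochhammer_pos)
        have "norm (w (Suc k) / pochhammer (c + of_nat n) (Suc k)) \<le> norm (w (Suc k)) / (pochhammer g (Suc k) * ((g + n) / g))"
          unfolding norm_divide
        proof (rule divide_left_mono)
          have A: "0 < pochhammer g (Suc k) * ((g + n) / g)"
            by (rule mult_pos_pos[OF pp]) (use g in \<open>auto intro: divide_pos_pos\<close>)
          have "0 < norm (pochhammer (c + of_nat n) (Suc k))" using A * by (rule less_le_trans)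
          thus "0 < norm (pochhammer (c + of_nat n) (Suc k)) * (pochhammer g (Suc k) * ((g + n) / g))"
            using A by (rule mult_pos_pos)
        qed (use * in auto)
        also have "\<dots> = g / (g + n) * (norm (w (Suc k)) / pochhammer g (Suc k))" by (simp add: mult_ac)
        finally show ?thesis unfolding wg .
      qed
      show "summable (\<lambda>k. g / (g + n) * (norm (gauss_term a b (of_real g) (Suc k)) * Gamma g))"
        by (intro summable_mult summable_mult2) (use sg in \<open>subst summable_Suc_iff\<close>)
    qed
    also have "\<dots> = g / (g + n) * ((\<Sum>k. norm (gauss_term a b (of_real g) (Suc k))) * Gamma g)"
    proof -
      have s1: "summable (\<lambda>k. norm (gauss_term a b (of_real g) (Suc k)))" using sg by (subst summable_Suc_iff)
      show ?thesis by (simp only: suminf_mult[OF summable_mult2[OF s1]] suminf_mult2[OF s1])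
    qed
    also have "\<dots> \<le> g / (g + n) * M"
    proof -
      have "(\<Sum>k. norm (gauss_term a b (of_real g) (Suc k))) \<le> (\<Sum>k. norm (gauss_term a b (of_real g) k))"
        using suminf_split_head[OF sg] by simp
      thus ?thesis unfolding M_def using g by (intro mult_left_mono mult_right_mono) (auto intro: less_imp_le[OF Gamma_real_pos])
    qed
    finally show ?thesis .
  qed
  have "(\<lambda>n::nat. g / (g + n) * M) \<longlonglongrightarrow> 0" by real_asymp
  hence "(\<lambda>n. Gamma (c + of_nat n) * (\<Sum>k. gauss_term a b (c + of_nat n) k) - 1) \<longlonglongrightarrow> 0"
    by (rule Lim_null_comparison[rotated]) (use bound in auto)
  thus ?thesis by (subst (asm) LIM_zero_iff)
qed

text \<open>Iterating the contiguous relation moves \<open>c\<close> to infinity, where the normalised sum tends to 1. The accumulated quotient of Pochhammer symbols is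
a quotient of Euler products \<open>rGamma_series\<close>, whose limit is the right-hand side.\<close>

lemma gauss_sum_Re_pos:
  assumes c: "Re c > 0" "Re (c - a - b) > 0"
  shows "(\<Sum>k. gauss_term a b c k) = Gamma (c - a - b) * rGamma (c - a) * rGamma (c - b)"
proof -
  let ?S = "\<lambda>c. \<Sum>k. gauss_term a b c k"
  define d where "d = c - a - b"
  have nd: "d \<notin> \<int>\<^sub>\<le>\<^sub>0" "c \<notin> \<int>\<^sub>\<le>\<^sub>0" using c by (auto simp: d_def intro!: Re_pos_not_nonpos_Int)
  have nz: "pochhammer d n \<noteq> 0" "pochhammer c n \<noteq> 0" for n 
    using nd by (auto simp: pochhammer_eq_0_iff)
  \<comment> \<open>the powers of \<open>n\<close> hidden in the four Euler products cancel, since \<open>(c - a) + (c - b) = d + c\<close>\<close>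
  define Q where "Q n = rGamma_series (c - a) n * rGamma_series (c - b) n / (rGamma_series d n * rGamma_series c n) * rGamma c" for n
  have Q: "Q \<longlonglongrightarrow> rGamma (c - a) * rGamma (c - b) / (rGamma d * rGamma c) * rGamma c"
    unfolding Q_def using nd by (intro tendsto_intros) (auto simp: rGamma_eq_zero_iff)
  have eq: "?S c = Q n * (Gamma (c + of_nat (Suc n)) * ?S (c + of_nat (Suc n)))" if "n > 0" for n
  proof -
    have "Q n = pochhammer (c - a) (Suc n) * pochhammer (c - b) (Suc n) / (pochhammer d (Suc n) * pochhammer c (Suc n)) * rGamma c"
    proof -
      have "exp ((c - a) * of_real (ln (of_nat n))) * exp ((c - b) * of_real (ln (of_nat n))) = 
            exp (d * of_real (ln (of_nat n))) * exp (c * complex_of_real (ln (of_nat n)))"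
        unfolding exp_add[symmetric] d_def by (simp add: algebra_simps)
      thus ?thesis unfolding Q_def rGamma_series_def by (simp add: field_simps)
    qed
    moreover have "Gamma (c + of_nat (Suc n)) = pochhammer c (Suc n) * Gamma c"
      using pochhammer_Gamma[OF nd(2), of "Suc n"] nd by (simp add: Gamma_eq_zero_iff)
    moreover have "Gamma c * rGamma c = 1" using nd by (simp add: rGamma_inverse_Gamma Gamma_eq_zero_iff)
    ultimately have "Q n * Gamma (c + of_nat (Suc n)) = pochhammer (c - a) (Suc n) * pochhammer (c - b) (Suc n) / pochhammer d (Suc n)"
      using nz[of "Suc n"] by (simp add: field_simps)
    moreover have "pochhammer d (Suc n) * ?S c = pochhammer (c - a) (Suc n) * pochhammer (c - b) (Suc n) * ?S (c + of_nat (Suc n))"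
      using gauss_contiguous_iter[OF c(2), of "Suc n"] by (simp only: d_def)
    ultimately have "pochhammer d (Suc n) * ?S c = pochhammer d (Suc n) * (Q n * Gamma (c + of_nat (Suc n)) * ?S (c + of_nat (Suc n)))"
      using nz(1)[of "Suc n"] by simp
    thus ?thesis using nz(1)[of "Suc n"] by (simp only: mult_cancel_left mult.assoc) simp
  qed
  have "(\<lambda>n. Q n * (Gamma (c + of_nat (Suc n)) * ?S (c + of_nat (Suc n)))) \<longlonglongrightarrow>
           (rGamma (c - a) * rGamma (c - b) / (rGamma d * rGamma c) * rGamma c) * 1"
    by (intro tendsto_mult Q LIMSEQ_Suc[OF gauss_sum_tendsto[OF c]])
  moreover have "eventually (\<lambda>n. Q n * (Gamma (c + of_nat (Suc n)) * ?S (c + of_nat (Suc n))) = ?S c) sequentially"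
    using eventually_gt_at_top[of 0] by eventually_elim (use eq in simp)
  ultimately have "(\<lambda>n::nat. ?S c) \<longlonglongrightarrow> (rGamma (c - a) * rGamma (c - b) / (rGamma d * rGamma c) * rGamma c) * 1"
    by (rule Lim_transform_eventually)
  hence "?S c = (rGamma (c - a) * rGamma (c - b) / (rGamma d * rGamma c) * rGamma c) * 1"
    by (simp add: LIMSEQ_const_iff)
  thus ?thesis using nd by (simp add: d_def[symmetric] rGamma_inverse_Gamma Gamma_eq_zero_iff divide_inverse)
qed

text \<open>If \<open>Re c\<close> is not positive, finitely many contiguous steps lead back to the previous case.\<close>

theorem gauss_sum:
  assumes c: "Re (c - a - b) > 0"
  shows "(gauss_term a b c has_sum Gamma (c - a - b) * rGamma (c - a) * rGamma (c - b)) UNIV"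
proof -
  obtain n :: nat where n: "real n > - Re c" using reals_Archimedean2 by blast
  have "c - a - b \<notin> \<int>\<^sub>\<le>\<^sub>0" using c by (rule Re_pos_not_nonpos_Int)
  hence nz: "pochhammer (c - a - b) n \<noteq> 0" and G: "pochhammer (c - a - b) n = Gamma (c - a - b + of_nat n) / Gamma (c - a - b)"
    and gz: "Gamma (c - a - b) \<noteq> 0"
    by (auto simp: pochhammer_eq_0_iff pochhammer_Gamma[symmetric] Gamma_eq_zero_iff)
  have "pochhammer (c - a - b) n * (\<Sum>k. gauss_term a b c k) = 
        pochhammer (c - a) n * pochhammer (c - b) n * (Gamma (c + of_nat n - a - b) * rGamma (c + of_nat n - a) * rGamma (c + of_nat n - b))"
    using gauss_contiguous_iter[OF c, of n] gauss_sum_Re_pos[of "c + of_nat n" a b] c n by simp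
  also have "\<dots> = Gamma (c - a - b + of_nat n) * (pochhammer (c - a) n * rGamma (c - a + of_nat n)) * (pochhammer (c - b) n * rGamma (c - b + of_nat n))"
    by (simp add: algebra_simps)
  also have "\<dots> = pochhammer (c - a - b) n * (Gamma (c - a - b) * rGamma (c - a) * rGamma (c - b))"
    using gz by (simp add: pochhammer_rGamma G flip: pochhammer_rGamma)
  finally have "(\<Sum>k. gauss_term a b c k) = Gamma (c - a - b) * rGamma (c - a) * rGamma (c - b)"
    using nz by simp
  moreover have "(gauss_term a b c has_sum (\<Sum>k. gauss_term a b c k)) UNIV"
    using gauss_term_summable[OF c] by (intro norm_summable_imp_has_sum) (auto intro: summable_sums summable_norm_cancel)
  ultimately show ?thesis by simp
qed

section \<open>Holomorphic functions on the product of two slit planes\<close>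

lemma open_slit_plane: "open slit_plane"
proof -
  have "closed (complex_of_real ` {1..})"
    by (intro closed_injective_linear_image) (auto simp: inj_on_def bounded_linear.linear[OF bounded_linear_of_real])
  thus ?thesis by (simp add: slit_plane_def open_Compl)
qed

text \<open>The slit plane is star-shaped about the origin; this is what lets the Euler integrals below extend holomorphic functions.\<close>

lemma slit_plane_scale:
  assumes "z \<in> slit_plane" "0 \<le> t" "t \<le> 1"
  shows "of_real t * z \<in> slit_plane"
proof (rule ccontr)
  assume "of_real t * z \<notin> slit_plane"
  then obtain r where r: "r \<ge> 1" "of_real t * z = complex_of_real r" by (auto simp: slit_plane_def)
  hence t: "t > 0" using assms by (cases "t = 0") auto
  hence "z = complex_of_real (r / t)" using r by (simp add: field_simps)
  hence "z \<in> complex_of_real ` {1..}" by (rule image_eqI) (use r t assms in simp)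
  thus False using assms(1) by (simp add: slit_plane_def)
qed

lemma starlike_slit_plane: "starlike slit_plane"
  unfolding starlike_def
proof (rule bexI[of _ 0], safe)
  fix x y assume x: "x \<in> slit_plane" and "y \<in> closed_segment 0 x"
  then obtain t where "0 \<le> t" "t \<le> 1" "y = of_real t * x"
    by (auto simp: in_segment scaleR_conv_of_real)
  thus "y \<in> slit_plane" using slit_plane_scale[OF x] by simp
qed (auto simp: slit_plane_def)

lemma connected_slit_plane: "connected slit_plane"
  using starlike_slit_plane by (rule starlike_imp_connected)

lemma norm_less_1_slit_plane: "norm z < 1 \<Longrightarrow> z \<in> slit_plane"
  by (auto simp: slit_plane_def)

lemma has_sum_product_nat:
  fixes f g :: "nat \<Rightarrow> complex"
  assumes "summable (\<lambda>n. norm (f n))" "summable (\<lambda>n. norm (g n))" "f sums A" "g sums B"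
  shows "((\<lambda>(m, l). f m * g l) has_sum A * B) UNIV"
proof -
  have f: "(f has_sum A) UNIV" and g: "(g has_sum B) UNIV"
    using assms norm_summable_imp_has_sum by blast+
  have nf: "((\<lambda>m. norm (f m)) has_sum (\<Sum>m. norm (f m))) UNIV" 
    and ng: "((\<lambda>m. norm (g m)) has_sum (\<Sum>m. norm (g m))) UNIV"
    using assms(1,2) by (auto intro!: norm_summable_imp_has_sum summable_sums)
  have nn: "(\<lambda>(m, l). norm (f m) * norm (g l)) summable_on Sigma UNIV (\<lambda>_. UNIV)"
  proof (rule summable_on_SigmaI)
    show "((\<lambda>l. case (m, l) of (m, l) \<Rightarrow> norm (f m) * norm (g l)) has_sum norm (f m) * (\<Sum>l. norm (g l))) UNIV" for m
      using has_sum_cmult_right[OF ng] by simp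
    show "(\<lambda>m. norm (f m) * (\<Sum>l. norm (g l))) summable_on UNIV"
      by (intro summable_on_cmult_left has_sum_imp_summable[OF nf])
  qed auto
  have "(\<lambda>(m, l). f m * g l) summable_on Sigma UNIV (\<lambda>_. UNIV)"
    by (rule abs_summable_summable) (use nn in \<open>simp add: case_prod_unfold norm_mult\<close>)
  hence "((\<lambda>(m, l). f m * g l) has_sum A * B) (Sigma UNIV (\<lambda>_. UNIV))"
  proof (intro has_sum_SigmaI)
    show "((\<lambda>l. case (m, l) of (m, l) \<Rightarrow> f m * g l) has_sum f m * B) UNIV" for m
      using has_sum_cmult_right[OF g] by simp
    show "((\<lambda>m. f m * B) has_sum A * B) UNIV" using has_sum_cmult_left[OF f] .
  qed auto
  thus ?thesis by simp
qed

text \<open>Continuity of the two partial derivatives is part of the notion because differentiation under the integral sign needs it, and because it is inherited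
by the integrals.\<close>

definition C1_holomorphic :: "(complex \<times> complex \<Rightarrow> complex) \<Rightarrow> bool" where
  "C1_holomorphic F \<longleftrightarrow> (\<exists>A B. continuous_on (slit_plane \<times> slit_plane) A \<and> continuous_on (slit_plane \<times> slit_plane) B \<and>
     (\<forall>w\<in>slit_plane \<times> slit_plane. (F has_derivative (\<lambda>(h, k). A w * h + B w * k)) (at w)))"

lemma C1_holomorphic_imp_holomorphic2: "C1_holomorphic F \<Longrightarrow> holomorphic2_on F (slit_plane \<times> slit_plane)"
  unfolding C1_holomorphic_def holomorphic2_on_def by blast

lemma C1_holomorphic_imp_continuous: "C1_holomorphic F \<Longrightarrow> continuous_on (slit_plane \<times> slit_plane) F"
  unfolding C1_holomorphic_def
  by (metis continuous_at_imp_continuous_on has_derivative_continuous)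

lemma C1_holomorphic_const: "C1_holomorphic (\<lambda>_. c)"
  unfolding C1_holomorphic_def
  by (rule exI[of _ "\<lambda>_. 0"], rule exI[of _ "\<lambda>_. 0"]) (auto intro!: derivative_eq_intros continuous_intros)

lemma C1_holomorphic_add:
  assumes "C1_holomorphic F" "C1_holomorphic G"
  shows "C1_holomorphic (\<lambda>w. F w + G w)"
proof -
  from assms obtain A B A' B' where
    c: "continuous_on (slit_plane \<times> slit_plane) A" "continuous_on (slit_plane \<times> slit_plane) B"
    "continuous_on (slit_plane \<times> slit_plane) A'" "continuous_on (slit_plane \<times> slit_plane) B'" and
    d: "\<And>w. w \<in> slit_plane \<times> slit_plane \<Longrightarrow> (F has_derivative (\<lambda>(h, k). A w * h + B w * k)) (at w)"
    "\<And>w. w \<in> slit_plane \<times> slit_plane \<Longrightarrow> (G has_derivative (\<lambda>(h, k). A' w * h + B' w * k)) (at w)"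
    unfolding C1_holomorphic_def by metis
  show ?thesis
    unfolding C1_holomorphic_def
  proof (rule exI[of _ "\<lambda>w. A w + A' w"], rule exI[of _ "\<lambda>w. B w + B' w"], intro conjI ballI)
    fix w assume w: "w \<in> slit_plane \<times> slit_plane"
    show "((\<lambda>w. F w + G w) has_derivative (\<lambda>(h, k). (A w + A' w) * h + (B w + B' w) * k)) (at w)"
      by (rule has_derivative_eq_rhs[OF has_derivative_add[OF d(1)[OF w] d(2)[OF w]]])
         (auto simp: fun_eq_iff algebra_simps)
  qed (auto intro!: continuous_intros c)
qed

lemma C1_holomorphic_mult:
  assumes "C1_holomorphic F" "C1_holomorphic G"
  shows "C1_holomorphic (\<lambda>w. F w * G w)"
proof -
  from assms obtain A B A' B' where
    c: "continuous_on (slit_plane \<times> slit_plane) A" "continuous_on (slit_plane \<times> slit_plane) B"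
    "continuous_on (slit_plane \<times> slit_plane) A'" "continuous_on (slit_plane \<times> slit_plane) B'" and
    d: "\<And>w. w \<in> slit_plane \<times> slit_plane \<Longrightarrow> (F has_derivative (\<lambda>(h, k). A w * h + B w * k)) (at w)"
    "\<And>w. w \<in> slit_plane \<times> slit_plane \<Longrightarrow> (G has_derivative (\<lambda>(h, k). A' w * h + B' w * k)) (at w)"
    unfolding C1_holomorphic_def by metis
  show ?thesis
    unfolding C1_holomorphic_def
  proof (rule exI[of _ "\<lambda>w. F w * A' w + A w * G w"], rule exI[of _ "\<lambda>w. F w * B' w + B w * G w"], intro conjI ballI)
    fix w assume w: "w \<in> slit_plane \<times> slit_plane"
    show "((\<lambda>w. F w * G w) has_derivative (\<lambda>(h, k). (F w * A' w + A w * G w) * h + (F w * B' w + B w * G w) * k)) (at w)"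
      by (rule has_derivative_eq_rhs[OF has_derivative_mult[OF d(1)[OF w] d(2)[OF w]]])
         (auto simp: fun_eq_iff algebra_simps)
  qed (use c C1_holomorphic_imp_continuous[OF assms(1)] C1_holomorphic_imp_continuous[OF assms(2)] in
       \<open>auto intro!: continuous_on_add continuous_on_mult\<close>)
qed

lemma C1_holomorphic_fst:
  assumes "f holomorphic_on slit_plane"
  shows "C1_holomorphic (\<lambda>w. f (fst w))"
  unfolding C1_holomorphic_def
proof (rule exI[of _ "\<lambda>w. deriv f (fst w)"], rule exI[of _ "\<lambda>_. 0"], intro conjI ballI)
  have "continuous_on slit_plane (deriv f)"
    using holomorphic_deriv[OF assms open_slit_plane] by (rule holomorphic_on_imp_continuous_on)
  thus "continuous_on (slit_plane \<times> slit_plane) (\<lambda>w. deriv f (fst w))"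
    by (rule continuous_on_compose2) (auto intro!: continuous_intros)
  fix w assume "w \<in> slit_plane \<times> slit_plane"
  hence "fst w \<in> slit_plane" by auto
  hence "(f has_derivative (\<lambda>h. deriv f (fst w) * h)) (at (fst w))"
    using holomorphic_derivI[OF assms open_slit_plane] by (simp add: has_field_derivative_def)
  hence "((\<lambda>w. f (fst w)) has_derivative (\<lambda>h. deriv f (fst w) * fst h)) (at w)"
    using has_derivative_compose[OF has_derivative_fst[OF has_derivative_ident]] by blast
  thus "((\<lambda>w. f (fst w)) has_derivative (\<lambda>(h, k). deriv f (fst w) * h + 0 * k)) (at w)"
    by (simp add: case_prod_unfold)
qed auto

lemma C1_holomorphic_swap:
  assumes "C1_holomorphic F"
  shows "C1_holomorphic (\<lambda>w. F (snd w, fst w))"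
proof -
  from assms obtain A B where
    c: "continuous_on (slit_plane \<times> slit_plane) A" "continuous_on (slit_plane \<times> slit_plane) B" and
    d: "\<And>w. w \<in> slit_plane \<times> slit_plane \<Longrightarrow> (F has_derivative (\<lambda>(h, k). A w * h + B w * k)) (at w)"
    unfolding C1_holomorphic_def by metis
  show ?thesis
    unfolding C1_holomorphic_def
  proof (rule exI[of _ "\<lambda>w. B (snd w, fst w)"], rule exI[of _ "\<lambda>w. A (snd w, fst w)"], intro conjI ballI)
    fix w :: "complex \<times> complex" assume w: "w \<in> slit_plane \<times> slit_plane"
    hence w': "(snd w, fst w) \<in> slit_plane \<times> slit_plane" by auto
    have "((\<lambda>w. (snd w, fst w)) has_derivative (\<lambda>w. (snd w, fst w))) (at w)"
      by (auto intro!: derivative_eq_intros)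
    from has_derivative_compose[OF this d[OF w']]
    show "((\<lambda>w. F (snd w, fst w)) has_derivative (\<lambda>(h, k). B (snd w, fst w) * h + A (snd w, fst w) * k)) (at w)"
      by (simp add: case_prod_unfold add_ac)
  qed (auto intro!: continuous_on_compose2[OF c(1)] continuous_on_compose2[OF c(2)] continuous_intros)
qed

lemma C1_holomorphic_snd:
  assumes "f holomorphic_on slit_plane"
  shows "C1_holomorphic (\<lambda>w. f (snd w))"
  using C1_holomorphic_swap[OF C1_holomorphic_fst[OF assms]] by simp

text \<open>The differential as a bounded linear operator, which is the form in which Leibniz's rule expects derivatives.\<close>

definition pair_lin :: "complex \<Rightarrow> complex \<Rightarrow> ((complex \<times> complex) \<Rightarrow>\<^sub>L complex)" where
  "pair_lin a b = (blinfun_mult_right a o\<^sub>L Blinfun fst) + (blinfun_mult_right b o\<^sub>L Blinfun snd)"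

lemma pair_lin_apply [simp]: "blinfun_apply (pair_lin a b) w = a * fst w + b * snd w"
  by (simp add: pair_lin_def plus_blinfun.rep_eq bounded_linear_Blinfun_apply bounded_linear_fst bounded_linear_snd)

lemma continuous_on_pair_lin [continuous_intros]:
  "continuous_on S f \<Longrightarrow> continuous_on S g \<Longrightarrow> continuous_on S (\<lambda>x. pair_lin (f x) (g x))"
  unfolding pair_lin_def
  by (intro continuous_intros bounded_linear.continuous_on[OF bounded_linear_blinfun_mult_right])

text \<open>Differentiation under the integral sign over a compact interval: the arguments \<open>\<alpha> t * fst z\<close> and \<open>\<beta> t * snd z\<close> stay in the slit plane since
\<open>\<alpha> t\<close> and \<open>\<beta> t\<close> lie in the unit interval.\<close>

lemma C1_holomorphic_integral:
  fixes w :: "real \<Rightarrow> complex" and \<alpha> \<beta> :: "real \<Rightarrow> real"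
  assumes F: "C1_holomorphic F"
  assumes w: "continuous_on {0..1} w" and \<alpha>: "continuous_on {0..1} \<alpha>" and \<beta>: "continuous_on {0..1} \<beta>"
  assumes \<alpha>': "\<And>t. t \<in> {0..1} \<Longrightarrow> \<alpha> t \<in> {0..1}" and \<beta>': "\<And>t. t \<in> {0..1} \<Longrightarrow> \<beta> t \<in> {0..1}"
  shows "C1_holomorphic (\<lambda>z. integral (cbox 0 1) (\<lambda>t. w t * F (of_real (\<alpha> t) * fst z, of_real (\<beta> t) * snd z)))"
proof -
  let ?D = "slit_plane \<times> slit_plane"
  from F obtain A B where
    c: "continuous_on ?D A" "continuous_on ?D B" and
    d: "\<And>w. w \<in> ?D \<Longrightarrow> (F has_derivative (\<lambda>(h, k). A w * h + B w * k)) (at w)"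
    unfolding C1_holomorphic_def by metis
  have cF: "continuous_on ?D F" using F by (rule C1_holomorphic_imp_continuous)
  have comp: "continuous_on (?D \<times> cbox 0 1) (\<lambda>(z, t). G (of_real (\<alpha> t) * fst z, of_real (\<beta> t) * snd z))" 
    if "continuous_on ?D G" for G :: "complex \<times> complex \<Rightarrow> complex"
    unfolding case_prod_unfold
  proof (rule continuous_on_compose2[OF that])
    show "continuous_on (?D \<times> cbox 0 1) (\<lambda>p. (of_real (\<alpha> (snd p)) * fst (fst p), of_real (\<beta> (snd p)) * snd (fst p)))"
      by (intro continuous_intros continuous_on_compose2[OF \<alpha>] continuous_on_compose2[OF \<beta>]) auto
    show "(\<lambda>p. (complex_of_real (\<alpha> (snd p)) * fst (fst p), complex_of_real (\<beta> (snd p)) * snd (fst p))) ` (?D \<times> cbox 0 1) \<subseteq> ?D"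
    proof safe
      fix z :: "complex \<times> complex" and x y and t :: real
      assume *: "x \<in> slit_plane" "y \<in> slit_plane" "t \<in> cbox 0 1"
      show "complex_of_real (\<alpha> (snd ((x, y), t))) * fst (fst ((x, y), t)) \<in> slit_plane"
        using *(1) \<alpha>'[of t] *(3) by (simp add: slit_plane_scale)
      show "complex_of_real (\<beta> (snd ((x, y), t))) * snd (fst ((x, y), t)) \<in> slit_plane"
        using *(2) \<beta>'[of t] *(3) by (simp add: slit_plane_scale)
    qed
  qed
  have cw: "continuous_on (?D \<times> cbox 0 1) (\<lambda>(z, t). w t)"
    unfolding case_prod_unfold by (auto intro!: continuous_on_compose2[OF w] continuous_intros)
  have c\<alpha>: "continuous_on (?D \<times> cbox 0 1) (\<lambda>(z, t). complex_of_real (\<alpha> t))"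
    unfolding case_prod_unfold by (auto intro!: continuous_on_compose2[OF \<alpha>] continuous_intros)
  have c\<beta>: "continuous_on (?D \<times> cbox 0 1) (\<lambda>(z, t). complex_of_real (\<beta> t))"
    unfolding case_prod_unfold by (auto intro!: continuous_on_compose2[OF \<beta>] continuous_intros)
  define a where "a = (\<lambda>(z :: complex \<times> complex) t. w t * (complex_of_real (\<alpha> t) * A (of_real (\<alpha> t) * fst z, of_real (\<beta> t) * snd z)))"
  define b where "b = (\<lambda>(z :: complex \<times> complex) t. w t * (complex_of_real (\<beta> t) * B (of_real (\<alpha> t) * fst z, of_real (\<beta> t) * snd z)))"
  have ca: "continuous_on (?D \<times> cbox 0 1) (\<lambda>(z, t). a z t)"
    using continuous_on_mult[OF cw continuous_on_mult[OF c\<alpha> comp[OF c(1)]]] by (simp add: a_def case_prod_unfold)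
  have cb: "continuous_on (?D \<times> cbox 0 1) (\<lambda>(z, t). b z t)"
    using continuous_on_mult[OF cw continuous_on_mult[OF c\<beta> comp[OF c(2)]]] by (simp add: b_def case_prod_unfold)
  have cf: "continuous_on (?D \<times> cbox 0 1) (\<lambda>(z, t). w t * F (of_real (\<alpha> t) * fst z, of_real (\<beta> t) * snd z))"
    using continuous_on_mult[OF cw comp[OF cF]] by (simp add: case_prod_unfold)
  have int: "g z integrable_on cbox 0 1" if "continuous_on (?D \<times> cbox 0 1) (\<lambda>(z, t). g z t)" "z \<in> ?D"
    for g :: "complex \<times> complex \<Rightarrow> real \<Rightarrow> complex" and z
    by (intro integrable_continuous continuous_on_compose2[OF that(1), of _ "\<lambda>t. (z, t)", simplified])
       (use that in \<open>auto intro!: continuous_intros\<close>)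
  show ?thesis unfolding C1_holomorphic_def
  proof (rule exI[of _ "\<lambda>z. integral (cbox 0 1) (a z)"], rule exI[of _ "\<lambda>z. integral (cbox 0 1) (b z)"], intro conjI ballI)
    show "continuous_on ?D (\<lambda>z. integral (cbox 0 1) (a z))" "continuous_on ?D (\<lambda>z. integral (cbox 0 1) (b z))"
      by (rule integral_continuous_on_param[OF ca], rule integral_continuous_on_param[OF cb])
    fix z0 assume z0: "z0 \<in> ?D"
    have "open ?D" by (intro open_Times open_slit_plane)
    then obtain r where r: "r > 0" "ball z0 r \<subseteq> ?D" using z0 openE by blast
    let ?U = "ball z0 r"
    have der: "((\<lambda>z. integral (cbox 0 1) (\<lambda>t. w t * F (of_real (\<alpha> t) * fst z, of_real (\<beta> t) * snd z))) has_derivative 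
                blinfun_apply (integral (cbox 0 1) (\<lambda>t. pair_lin (a z0 t) (b z0 t)))) (at z0 within ?U)"
    proof (rule leibniz_rule)
      fix z t assume zt: "z \<in> ?U" "t \<in> cbox (0::real) 1"
      have z: "(of_real (\<alpha> t) * fst z, of_real (\<beta> t) * snd z) \<in> ?D"
        using zt r(2) \<alpha>'[of t] \<beta>'[of t] by (auto intro!: slit_plane_scale)
      have "((\<lambda>z. (of_real (\<alpha> t) * fst z, of_real (\<beta> t) * snd z)) has_derivative (\<lambda>z. (of_real (\<alpha> t) * fst z, of_real (\<beta> t) * snd z))) (at z)"
        by (auto intro!: derivative_eq_intros)
      from has_derivative_mult_right[OF has_derivative_compose[OF this d[OF z]], of "w t"]
      have "((\<lambda>z. w t * F (of_real (\<alpha> t) * fst z, of_real (\<beta> t) * snd z)) has_derivative blinfun_apply (pair_lin (a z t) (b z t))) (at z)"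
        by (rule has_derivative_eq_rhs) (auto simp: fun_eq_iff a_def b_def algebra_simps)
      thus "((\<lambda>z. w t * F (of_real (\<alpha> t) * fst z, of_real (\<beta> t) * snd z)) has_derivative blinfun_apply (pair_lin (a z t) (b z t))) (at z within ?U)"
        by (rule has_derivative_at_withinI)
    next
      show "(\<lambda>t. w t * F (of_real (\<alpha> t) * fst z, of_real (\<beta> t) * snd z)) integrable_on cbox 0 1" if "z \<in> ?U" for z
        using int[OF cf] that r by auto
      have "continuous_on (?D \<times> cbox 0 1) (\<lambda>(z, t). pair_lin (a z t) (b z t))"
        using continuous_on_pair_lin[OF ca cb] by (simp add: case_prod_unfold)
      thus "continuous_on (?U \<times> cbox 0 1) (\<lambda>(z, t). pair_lin (a z t) (b z t))"
        by (rule continuous_on_subset) (use r in auto)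
    qed (use r in auto)
    have pl: "(\<lambda>t. pair_lin (a z0 t) (b z0 t)) integrable_on cbox 0 1"
    proof (intro integrable_continuous continuous_on_pair_lin)
      show "continuous_on (cbox 0 1) (a z0)"
        by (rule continuous_on_compose2[OF ca, of _ "\<lambda>t. (z0, t)", simplified]) (use z0 in \<open>auto intro!: continuous_intros\<close>)
      show "continuous_on (cbox 0 1) (b z0)"
        by (rule continuous_on_compose2[OF cb, of _ "\<lambda>t. (z0, t)", simplified]) (use z0 in \<open>auto intro!: continuous_intros\<close>)
    qed
    have ap: "blinfun_apply (integral (cbox 0 1) (\<lambda>t. pair_lin (a z0 t) (b z0 t))) v = 
            integral (cbox 0 1) (a z0) * fst v + integral (cbox 0 1) (b z0) * snd v" for v
    proof -
      have "integral (cbox 0 1) (\<lambda>t. blinfun_apply (pair_lin (a z0 t) (b z0 t)) v) =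
            blinfun_apply (integral (cbox 0 1) (\<lambda>t. pair_lin (a z0 t) (b z0 t))) v"
        using integral_linear[OF pl bounded_linear_apply_blinfun, of v] by (simp add: o_def)
      moreover have "integral (cbox 0 1) (\<lambda>t. blinfun_apply (pair_lin (a z0 t) (b z0 t)) v) =
          integral (cbox 0 1) (a z0) * fst v + integral (cbox 0 1) (b z0) * snd v"
        using int[OF ca z0] int[OF cb z0]
        by (simp add: Henstock_Kurzweil_Integration.integral_add integrable_on_mult_left)
      ultimately show ?thesis by simp
    qed
    from der have "((\<lambda>z. integral (cbox 0 1) (\<lambda>t. w t * F (of_real (\<alpha> t) * fst z, of_real (\<beta> t) * snd z))) has_derivative 
                blinfun_apply (integral (cbox 0 1) (\<lambda>t. pair_lin (a z0 t) (b z0 t)))) (at z0)"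
      using r by (subst (asm) at_within_open) auto
    thus "((\<lambda>z. integral (cbox 0 1) (\<lambda>t. w t * F (of_real (\<alpha> t) * fst z, of_real (\<beta> t) * snd z))) has_derivative
            (\<lambda>(h, k). integral (cbox 0 1) (a z0) * h + integral (cbox 0 1) (b z0) * k)) (at z0)"
      by (rule has_derivative_eq_rhs) (intro ext, simp only: ap case_prod_unfold)
  qed
qed

section \<open>Double power series with a holomorphic extension\<close>

text \<open>The coefficients and the extension are carried along together: every construction below transforms both at once, so that no extension has to be
identified with its series afterwards.\<close>

definition expands :: "(nat \<Rightarrow> nat \<Rightarrow> complex) \<Rightarrow> (complex \<times> complex \<Rightarrow> complex) \<Rightarrow> bool" where
  "expands c F \<longleftrightarrow> C1_holomorphic F \<and>
     (\<forall>U V. norm U < 1 \<longrightarrow> norm V < 1 \<longrightarrow> ((\<lambda>(m, l). c m l * U ^ m * V ^ l) has_sum F (U, V)) UNIV)"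

lemma expands_has_sum:
  assumes "expands c F" "norm U < 1" "norm V < 1"
  shows "((\<lambda>(m, l). c m l * U ^ m * V ^ l) has_sum F (U, V)) UNIV"
  using assms by (simp add: expands_def)

lemma expands_add:
  assumes "expands c F" "expands d G"
  shows "expands (\<lambda>m l. c m l + d m l) (\<lambda>w. F w + G w)"
  unfolding expands_def
proof (intro conjI allI impI)
  fix U V :: complex assume UV: "norm U < 1" "norm V < 1"
  have "((\<lambda>(m, l). c m l * U ^ m * V ^ l) has_sum F (U, V)) UNIV" "((\<lambda>(m, l). d m l * U ^ m * V ^ l) has_sum G (U, V)) UNIV"
    using assms UV by (auto simp: expands_def)
  from has_sum_add[OF this] 
  show "((\<lambda>(m, l). (c m l + d m l) * U ^ m * V ^ l) has_sum F (U, V) + G (U, V)) UNIV"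
    by (simp add: case_prod_unfold algebra_simps)
qed (use assms in \<open>auto simp: expands_def C1_holomorphic_add\<close>)

lemma expands_cmult:
  assumes "expands c F"
  shows "expands (\<lambda>m l. k * c m l) (\<lambda>w. k * F w)"
  unfolding expands_def
proof (intro conjI allI impI)
  fix U V :: complex assume UV: "norm U < 1" "norm V < 1"
  have "((\<lambda>(m, l). c m l * U ^ m * V ^ l) has_sum F (U, V)) UNIV"
    using assms UV by (auto simp: expands_def)
  from has_sum_cmult_right[OF this, of k]
  show "((\<lambda>(m, l). k * c m l * U ^ m * V ^ l) has_sum k * F (U, V)) UNIV"
    by (simp add: case_prod_unfold mult_ac)
qed (use assms in \<open>auto simp: expands_def intro!: C1_holomorphic_mult C1_holomorphic_const\<close>)

lemma expands_swap:
  assumes "expands c F"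
  shows "expands (\<lambda>m l. c l m) (\<lambda>w. F (snd w, fst w))"
  unfolding expands_def
proof (intro conjI allI impI)
  fix U V :: complex assume UV: "norm U < 1" "norm V < 1"
  hence "((\<lambda>(m, l). c m l * V ^ m * U ^ l) has_sum F (V, U)) UNIV"
    using assms by (simp add: expands_def)
  moreover have "((\<lambda>(m, l). c m l * V ^ m * U ^ l) has_sum F (V, U)) UNIV = 
      ((\<lambda>(m, l). c l m * U ^ m * V ^ l) has_sum F (snd (U, V), fst (U, V))) UNIV"
    by (rule has_sum_reindex_bij_witness[where i = prod.swap and j = prod.swap]) (auto simp: mult_ac)
  ultimately show "((\<lambda>(m, l). c l m * U ^ m * V ^ l) has_sum F (snd (U, V), fst (U, V))) UNIV" by simp
qed (use assms in \<open>auto simp: expands_def C1_holomorphic_swap\<close>)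

lemma expands_mult_fst:
  assumes "expands c F"
  shows "expands (\<lambda>m l. case m of 0 \<Rightarrow> 0 | Suc m \<Rightarrow> c m l) (\<lambda>w. fst w * F w)"
  unfolding expands_def
proof (intro conjI allI impI)
  fix U V :: complex assume UV: "norm U < 1" "norm V < 1"
  define g where "g = (\<lambda>(m, l). (case m of 0 \<Rightarrow> 0 | Suc m \<Rightarrow> c m l) * U ^ m * V ^ l)"
  have "((\<lambda>(m, l). c m l * U ^ m * V ^ l) has_sum F (U, V)) UNIV"
    using assms UV by (simp add: expands_def)
  from has_sum_cmult_right[OF this, of U]
  have "((g \<circ> (\<lambda>(m, l). (Suc m, l))) has_sum U * F (U, V)) UNIV"
    by (simp add: g_def o_def case_prod_unfold mult_ac)
  hence "(g has_sum U * F (U, V)) (range (\<lambda>(m, l). (Suc m, l)))"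
    by (subst has_sum_reindex) (auto simp: inj_on_def)
  also have "?this \<longleftrightarrow> (g has_sum U * F (U, V)) UNIV"
  proof (rule has_sum_cong_neutral)
    fix x :: "nat \<times> nat" assume "x \<in> UNIV - range (\<lambda>(m, l). (Suc m, l))"
    hence "fst x = 0" by (cases x; cases "fst x") (auto simp: image_iff)
    thus "g x = 0" by (simp add: g_def case_prod_unfold)
  qed auto
  finally show "((\<lambda>(m, l). (case m of 0 \<Rightarrow> 0 | Suc m \<Rightarrow> c m l) * U ^ m * V ^ l) has_sum fst (U, V) * F (U, V)) UNIV"
    by (simp add: g_def)
qed (use assms in \<open>auto simp: expands_def intro!: C1_holomorphic_mult C1_holomorphic_fst[of "\<lambda>z. z"]\<close>)

lemma expands_mult_snd:
  assumes "expands c F"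
  shows "expands (\<lambda>m l. case l of 0 \<Rightarrow> 0 | Suc l \<Rightarrow> c m l) (\<lambda>w. snd w * F w)"
  using expands_swap[OF expands_mult_fst[OF expands_swap[OF assms]]] by simp

text \<open>The coefficients are multiplied by the moments of the weight. The series converges uniformly in \<open>t\<close> because \<open>\<alpha> t\<close> and \<open>\<beta> t\<close> are at most
1, which justifies integrating term by term.\<close>

lemma expands_integral:
  fixes w :: "real \<Rightarrow> complex" and \<alpha> \<beta> :: "real \<Rightarrow> real"
  assumes F: "expands c F"
  assumes w: "continuous_on {0..1} w" and \<alpha>: "continuous_on {0..1} \<alpha>" and \<beta>: "continuous_on {0..1} \<beta>"
  assumes \<alpha>': "\<And>t. t \<in> {0..1} \<Longrightarrow> \<alpha> t \<in> {0..1}" and \<beta>': "\<And>t. t \<in> {0..1} \<Longrightarrow> \<beta> t \<in> {0..1}"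
  shows "expands (\<lambda>m l. c m l * integral (cbox 0 1) (\<lambda>t. w t * of_real (\<alpha> t) ^ m * of_real (\<beta> t) ^ l))
           (\<lambda>z. integral (cbox 0 1) (\<lambda>t. w t * F (of_real (\<alpha> t) * fst z, of_real (\<beta> t) * snd z)))"
  unfolding expands_def
proof (intro conjI allI impI)
  show "C1_holomorphic (\<lambda>z. integral (cbox 0 1) (\<lambda>t. w t * F (of_real (\<alpha> t) * fst z, of_real (\<beta> t) * snd z)))"
    using F by (intro C1_holomorphic_integral assms) (auto simp: expands_def)
  fix U V :: complex assume UV: "norm U < 1" "norm V < 1"
  have "compact (w ` {0..1})" by (intro compact_continuous_image w) auto
  hence "bounded (w ` {0..1})" by (rule compact_imp_bounded)
  then obtain M where "\<forall>z\<in>w ` {0..1}. norm z \<le> M" by (auto simp only: bounded_iff)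
  hence M: "norm (w t) \<le> M" if "t \<in> {0..1}" for t using that by simp
  have M0: "M \<ge> 0" using M[of 0] by (auto intro: order_trans[OF norm_ge_zero])
  define f where "f = (\<lambda>(m, l) t. w t * (c m l * (of_real (\<alpha> t) * U) ^ m * (of_real (\<beta> t) * V) ^ l))"
  have le: "norm (of_real (\<alpha> t) * U) \<le> norm U" "norm (of_real (\<beta> t) * V) \<le> norm V" if "t \<in> {0..1}" for t
    using mult_right_mono[of "\<alpha> t" 1 "norm U"] mult_right_mono[of "\<beta> t" 1 "norm V"] \<alpha>'[OF that] \<beta>'[OF that]
    by (simp_all add: norm_mult)
  have "((\<lambda>(m, l). c m l * U ^ m * V ^ l) has_sum F (U, V)) UNIV"
    using F UV by (simp add: expands_def)
  hence "(\<lambda>(m, l). c m l * U ^ m * V ^ l) summable_on UNIV" by (rule has_sum_imp_summable)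
  hence "(\<lambda>(m, l). norm (c m l * U ^ m * V ^ l)) summable_on UNIV"
    unfolding summable_on_iff_abs_summable_on_complex by (simp only: case_prod_unfold)
  hence sm: "(\<lambda>i. M * (case i of (m, l) \<Rightarrow> norm (c m l * U ^ m * V ^ l))) summable_on UNIV"
    by (simp only: case_prod_unfold summable_on_cmult_right)
  have unif: "uniform_limit (cbox 0 1) (\<lambda>X t. \<Sum>i\<in>X. f i t) (\<lambda>t. w t * F (of_real (\<alpha> t) * U, of_real (\<beta> t) * V)) (finite_subsets_at_top UNIV)"
  proof (rule Weierstrass_m_test_general')
    fix i :: "nat \<times> nat" and t :: real assume t: "t \<in> cbox 0 1"
    obtain m l where i: "i = (m, l)" by (cases i)
    have "norm (f i t) = norm (w t) * (norm (c m l) * norm (of_real (\<alpha> t) * U) ^ m * norm (of_real (\<beta> t) * V) ^ l)"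
      by (simp add: f_def i norm_mult norm_power)
    also have "\<dots> \<le> M * (norm (c m l) * norm U ^ m * norm V ^ l)"
      using le[of t] M[of t] M0 t by (intro mult_mono power_mono) auto
    finally show "norm (f i t) \<le> M * (case i of (m, l) \<Rightarrow> norm (c m l * U ^ m * V ^ l))"
      by (simp add: i norm_mult norm_power)
  next
    fix t :: real assume t: "t \<in> cbox 0 1"
    have "norm (of_real (\<alpha> t) * U) < 1" "norm (of_real (\<beta> t) * V) < 1"
      using le[of t] t UV by auto
    hence "((\<lambda>(m, l). c m l * (of_real (\<alpha> t) * U) ^ m * (of_real (\<beta> t) * V) ^ l) has_sum F (of_real (\<alpha> t) * U, of_real (\<beta> t) * V)) UNIV"
      by (rule expands_has_sum[OF F])
    from has_sum_cmult_right[OF this, of "w t"]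
    show "((\<lambda>i. f i t) has_sum w t * F (of_real (\<alpha> t) * U, of_real (\<beta> t) * V)) UNIV"
      by (simp add: f_def case_prod_unfold)
  qed (rule sm)
  have cont: "continuous_on (cbox 0 1) (f i)" for i
    unfolding f_def case_prod_unfold using w \<alpha> \<beta> by (auto intro!: continuous_intros)
  have cs: "continuous_on (cbox 0 1) (\<lambda>t. \<Sum>i\<in>X. f i t)" for X
    by (intro continuous_on_sum cont)
  obtain I J where IJ: "\<And>X. ((\<lambda>t. \<Sum>i\<in>X. f i t) has_integral I X) (cbox 0 1)"
    "((\<lambda>t. w t * F (of_real (\<alpha> t) * U, of_real (\<beta> t) * V)) has_integral J) (cbox 0 1)" "(I \<longlongrightarrow> J) (finite_subsets_at_top UNIV)"
    by (rule uniform_limit_integral_cbox[OF unif cs finite_subsets_at_top_neq_bot]) (rule that)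
  have fi: "integral (cbox 0 1) (f (m, l)) = c m l * integral (cbox 0 1) (\<lambda>t. w t * of_real (\<alpha> t) ^ m * of_real (\<beta> t) ^ l) * U ^ m * V ^ l" for m l
  proof -
    have "f (m, l) = (\<lambda>t. (c m l * U ^ m * V ^ l) * (w t * of_real (\<alpha> t) ^ m * of_real (\<beta> t) ^ l))"
      by (simp add: f_def fun_eq_iff power_mult_distrib mult_ac)
    thus ?thesis by simp
  qed
  have "I X = (\<Sum>i\<in>X. integral (cbox 0 1) (f i))" if X: "finite X" for X
    unfolding integral_unique[OF IJ(1)[of X], symmetric]
    by (rule Henstock_Kurzweil_Integration.integral_sum[OF X integrable_continuous[OF cont]])
  hence ev: "eventually (\<lambda>X. I X = (\<Sum>i\<in>X. integral (cbox 0 1) (f i))) (finite_subsets_at_top UNIV)"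
    by (rule eventually_finite_subsets_at_top_weakI)
  have "((\<lambda>i. integral (cbox 0 1) (f i)) has_sum J) UNIV"
    unfolding has_sum_def by (rule Lim_transform_eventually[OF IJ(3) ev])
  also have "J = integral (cbox 0 1) (\<lambda>t. w t * F (of_real (\<alpha> t) * fst (U, V), of_real (\<beta> t) * snd (U, V)))"
    using IJ(2) by (simp add: integral_unique)
  moreover have "(\<lambda>i. integral (cbox 0 1) (f i)) =
      (\<lambda>(m, l). c m l * integral (cbox 0 1) (\<lambda>t. w t * of_real (\<alpha> t) ^ m * of_real (\<beta> t) ^ l) * U ^ m * V ^ l)"
  proof
    fix i :: "nat \<times> nat"
    show "integral (cbox 0 1) (f i) =
      (\<lambda>(m, l). c m l * integral (cbox 0 1) (\<lambda>t. w t * of_real (\<alpha> t) ^ m * of_real (\<beta> t) ^ l) * U ^ m * V ^ l) i"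
      by (cases i) (simp only: fi prod.case)
  qed
  ultimately show "((\<lambda>(m, l). c m l * integral (cbox 0 1) (\<lambda>t. w t * of_real (\<alpha> t) ^ m * of_real (\<beta> t) ^ l) * U ^ m * V ^ l) has_sum
    integral (cbox 0 1) (\<lambda>t. w t * F (of_real (\<alpha> t) * fst (U, V), of_real (\<beta> t) * snd (U, V)))) UNIV"
    by (simp only:)
qed

section \<open>The holomorphic extension of Appell's series\<close>

definition F3_coeff :: "complex \<Rightarrow> complex \<Rightarrow> complex \<Rightarrow> complex \<Rightarrow> complex \<Rightarrow> nat \<Rightarrow> nat \<Rightarrow> complex" where
  "F3_coeff a a' b b' c m l =
     pochhammer a m * pochhammer a' l * pochhammer b m * pochhammer b' l / (pochhammer c (m + l) * fact m * fact l)"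

definition F3_extendable :: "complex \<Rightarrow> complex \<Rightarrow> complex \<Rightarrow> complex \<Rightarrow> complex \<Rightarrow> bool" where
  "F3_extendable a a' b b' c \<longleftrightarrow> (\<exists>F. expands (F3_coeff a a' b b' c) F)"

lemma sums_binomial_neg:
  fixes b z :: complex
  assumes "norm z < 1"
  shows "(\<lambda>n. pochhammer b n / fact n * z ^ n) sums (1 - z) powr (- b)"
    and "summable (\<lambda>n. norm (pochhammer b n / fact n * z ^ n))"
proof -
  have *: "((- b) gchoose n) * (- z) ^ n = pochhammer b n / fact n * z ^ n" for n z
    by (simp add: gbinomial_pochhammer power_minus[of z])
  have sums: "(\<lambda>n. pochhammer b n / fact n * z ^ n) sums (1 - z) powr (- b)" if "norm z < 1" for z
    using gen_binomial_complex[of "- z" "- b"] that by (simp add: *)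
  obtain r where r: "norm z < r" "r < 1" using assms dense by blast
  have "norm (complex_of_real r) < 1" using r norm_ge_zero[of z] by (simp del: norm_ge_zero)
  from sums[OF this] have "summable (\<lambda>n. pochhammer b n / fact n * of_real r ^ n)" by (rule sums_summable)
  from powser_insidea[OF this, of z] r show "summable (\<lambda>n. norm (pochhammer b n / fact n * z ^ n))"
    by simp
  show "(\<lambda>n. pochhammer b n / fact n * z ^ n) sums (1 - z) powr (- b)"
    using assms by (rule sums)
qed

lemma expands_binomial:
  "expands (\<lambda>m l. pochhammer b m / fact m * (pochhammer b' l / fact l))
           (\<lambda>w. (1 - fst w) powr (- b) * (1 - snd w) powr (- b'))"
  unfolding expands_def
proof (intro conjI allI impI)
  have hol: "(\<lambda>z. (1 - z) powr (- b)) holomorphic_on slit_plane" for b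
  proof (intro holomorphic_intros)
    fix z assume z: "z \<in> slit_plane"
    show "1 - z \<notin> \<real>\<^sub>\<le>\<^sub>0"
    proof
      assume "1 - z \<in> \<real>\<^sub>\<le>\<^sub>0"
      then obtain r where r: "1 - z = complex_of_real r" "r \<le> 0" by (auto elim!: nonpos_Reals_cases)
      have "z = complex_of_real (1 - r)" using r(1) by (simp add: algebra_simps)
      hence "z \<in> complex_of_real ` {1..}" by (rule image_eqI) (use r(2) in simp)
      thus False using z by (simp add: slit_plane_def)
    qed
  qed
  show "C1_holomorphic (\<lambda>w. (1 - fst w) powr (- b) * (1 - snd w) powr (- b'))"
    by (intro C1_holomorphic_mult C1_holomorphic_fst[OF hol] C1_holomorphic_snd[OF hol])
  fix U V :: complex assume UV: "norm U < 1" "norm V < 1"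
  have "((\<lambda>(m, l). (pochhammer b m / fact m * U ^ m) * (pochhammer b' l / fact l * V ^ l)) has_sum
           (1 - U) powr (- b) * (1 - V) powr (- b')) UNIV"
    using UV by (intro has_sum_product_nat sums_binomial_neg)
  thus "((\<lambda>(m, l). pochhammer b m / fact m * (pochhammer b' l / fact l) * U ^ m * V ^ l) has_sum
          (1 - fst (U, V)) powr (- b) * (1 - snd (U, V)) powr (- b')) UNIV"
    by (simp add: case_prod_unfold mult_ac)
qed

lemma Beta_moment:
  assumes "Re a > 0" "Re b > 0"
  shows "integral (cbox 0 1) (\<lambda>t. complex_of_real t powr (a - 1) * complex_of_real (1 - t) powr (b - 1) *
           complex_of_real t ^ m * complex_of_real (1 - t) ^ l) = Beta (a + of_nat m) (b + of_nat l)"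
proof -
  have ab: "Re (a + of_nat m) > 0" "Re (b + of_nat l) > 0" using assms by auto
  have eq: "complex_of_real t powr (a - 1) * complex_of_real (1 - t) powr (b - 1) * complex_of_real t ^ m * complex_of_real (1 - t) ^ l
       = complex_of_real t powr (a + of_nat m - 1) * complex_of_real (1 - t) powr (b + of_nat l - 1)" if "t \<in> {0<..<1}" for t
  proof -
    have "complex_of_real t powr (a + of_nat m - 1) = complex_of_real t powr (a - 1) * complex_of_real t ^ m"
      using that by (simp add: powr_add[of _ "a - 1" "of_nat m", simplified add_diff_eq diff_add_eq] powr_nat')
    moreover have "complex_of_real (1 - t) powr (b + of_nat l - 1) = complex_of_real (1 - t) powr (b - 1) * complex_of_real (1 - t) ^ l"
      using that by (simp add: powr_add[of _ "b - 1" "of_nat l", simplified add_diff_eq diff_add_eq] powr_nat' del: of_real_diff)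
    ultimately show ?thesis by (simp only: mult_ac)
  qed
  have "integral (cbox 0 1) (\<lambda>t. complex_of_real t powr (a - 1) * complex_of_real (1 - t) powr (b - 1) *
           complex_of_real t ^ m * complex_of_real (1 - t) ^ l) =
        integral {0<..<1} (\<lambda>t. complex_of_real t powr (a - 1) * complex_of_real (1 - t) powr (b - 1) *
           complex_of_real t ^ m * complex_of_real (1 - t) ^ l)"
    by (simp add: integral_open_interval_real)
  also have "\<dots> = integral {0<..<1} (\<lambda>t. complex_of_real t powr (a + of_nat m - 1) * complex_of_real (1 - t) powr (b + of_nat l - 1))"
    by (intro Henstock_Kurzweil_Integration.integral_cong eq)
  also have "\<dots> = Beta (a + of_nat m) (b + of_nat l)"
    using set_borel_integral_eq_integral(2)[OF set_integrable_Beta_complex[OF ab]] set_integral_Beta_complex[OF ab] by simp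
  finally show ?thesis .
qed

lemma Beta_shift:
  assumes "Re a > 0" "Re b > 0"
  shows "Beta (a + of_nat m) (b + of_nat l) = Beta a b * (pochhammer a m * pochhammer b l / pochhammer (a + b) (m + l))"
proof -
  have G: "Gamma (z + of_nat n) = pochhammer z n * Gamma z" if "Re z > 0" for z :: complex and n
    using pochhammer_Gamma[OF Re_pos_not_nonpos_Int[OF that], of n] Gamma_nonzero_Re_pos[OF that] by simp
  have "Beta (a + of_nat m) (b + of_nat l) = Gamma (a + of_nat m) * Gamma (b + of_nat l) / Gamma ((a + b) + of_nat (m + l))"
    by (simp add: Beta_def algebra_simps)
  also have "\<dots> = (pochhammer a m * Gamma a) * (pochhammer b l * Gamma b) / (pochhammer (a + b) (m + l) * Gamma (a + b))"
    using G[of a m] G[of b l] G[of "a + b" "m + l"] assms by (simp only: plus_complex.sel add_pos_pos)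
  finally show ?thesis by (simp add: Beta_def mult_ac)
qed

lemma Beta_nonzero_Re_pos: "Re a > 0 \<Longrightarrow> Re b > 0 \<Longrightarrow> Beta a b \<noteq> 0"
  using Gamma_nonzero_Re_pos[of a] Gamma_nonzero_Re_pos[of b] Gamma_nonzero_Re_pos[of "a + b"]
  by (simp add: Beta_def)

lemma continuous_on_Beta_weight:
  assumes "Re a > 1" "Re b > 1"
  shows "continuous_on {0..1} (\<lambda>t. complex_of_real t powr (a - 1) * complex_of_real (1 - t) powr (b - 1))"
  using assms by (intro continuous_intros) auto

text \<open>A first Euler integral turns the product of two binomial series into Appell's series with denominator \<open>a + a'\<close>; a second one, which scales both variables
by the same \<open>t\<close>, replaces this denominator by \<open>c\<close>. Real parts above 1 make the weights continuous at the end points.\<close>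

lemma F3_extendable_base:
  assumes a: "Re a > 1" "Re a' > 1" and c: "Re (c - a - a') > 1"
  shows "F3_extendable a a' b b' c"
proof -
  define d where "d = c - a - a'"
  have d: "Re d > 1" using c by (simp add: d_def)
  have aa: "Re (a + a') > 1" using a by simp
  define F0 where "F0 = (\<lambda>w :: complex \<times> complex. (1 - fst w) powr (- b) * (1 - snd w) powr (- b'))"
  define F1 where "F1 = (\<lambda>z :: complex \<times> complex. integral (cbox 0 1) (\<lambda>t. complex_of_real t powr (a - 1) * complex_of_real (1 - t) powr (a' - 1) *
       F0 (of_real t * fst z, of_real (1 - t) * snd z)))"
  define F2 where "F2 = (\<lambda>z :: complex \<times> complex. integral (cbox 0 1) (\<lambda>t. complex_of_real t powr (a + a' - 1) * complex_of_real (1 - t) powr (d - 1) *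
       F1 (of_real t * fst z, of_real t * snd z)))"
  have "expands (\<lambda>m l. pochhammer b m / fact m * (pochhammer b' l / fact l) * integral (cbox 0 1) 
     (\<lambda>t. complex_of_real t powr (a - 1) * complex_of_real (1 - t) powr (a' - 1) * of_real t ^ m * of_real (1 - t) ^ l)) F1"
    unfolding F1_def F0_def
    by (intro expands_integral expands_binomial continuous_on_Beta_weight a) (auto intro!: continuous_intros)
  also have "(\<lambda>m l. pochhammer b m / fact m * (pochhammer b' l / fact l) * integral (cbox 0 1) 
     (\<lambda>t. complex_of_real t powr (a - 1) * complex_of_real (1 - t) powr (a' - 1) * of_real t ^ m * of_real (1 - t) ^ l)) =
     (\<lambda>m l. pochhammer b m / fact m * (pochhammer b' l / fact l) * (Beta a a' * (pochhammer a m * pochhammer a' l / pochhammer (a + a') (m + l))))"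
    using a by (subst Beta_moment; simp add: Beta_shift)
  finally have F1: "expands \<dots> F1" .
  have "expands (\<lambda>m l. pochhammer b m / fact m * (pochhammer b' l / fact l) * (Beta a a' * (pochhammer a m * pochhammer a' l / pochhammer (a + a') (m + l))) *
      integral (cbox 0 1) (\<lambda>t. complex_of_real t powr (a + a' - 1) * complex_of_real (1 - t) powr (d - 1) * of_real t ^ m * of_real t ^ l)) F2"
    unfolding F2_def
    by (intro expands_integral F1 continuous_on_Beta_weight aa d) (auto intro!: continuous_intros)
  also have "(\<lambda>m l. integral (cbox 0 1) (\<lambda>t. complex_of_real t powr (a + a' - 1) * complex_of_real (1 - t) powr (d - 1) * of_real t ^ m * of_real t ^ l))
     = (\<lambda>m l. Beta (a + a') d * (pochhammer (a + a') (m + l) / pochhammer c (m + l)))"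
  proof (intro ext)
    fix m l
    have "integral (cbox 0 1) (\<lambda>t. complex_of_real t powr (a + a' - 1) * complex_of_real (1 - t) powr (d - 1) * of_real t ^ m * of_real t ^ l) =
          integral (cbox 0 1) (\<lambda>t. complex_of_real t powr (a + a' - 1) * complex_of_real (1 - t) powr (d - 1) * of_real t ^ (m + l) * of_real (1 - t) ^ 0)"
      by (simp only: power_add mult.assoc power_0 mult_1_right)
    also have "\<dots> = Beta (a + a' + of_nat (m + l)) (d + of_nat 0)"
      using aa d by (intro Beta_moment) auto
    also have "\<dots> = Beta (a + a') d * (pochhammer (a + a') (m + l) / pochhammer c (m + l))"
      using aa d by (subst Beta_shift) (auto simp: d_def)
    finally show "integral (cbox 0 1) (\<lambda>t. complex_of_real t powr (a + a' - 1) * complex_of_real (1 - t) powr (d - 1) * of_real t ^ m * of_real t ^ l)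
       = Beta (a + a') d * (pochhammer (a + a') (m + l) / pochhammer c (m + l))" .
  qed
  finally have F2: "expands (\<lambda>m l. pochhammer b m / fact m * (pochhammer b' l / fact l) * (Beta a a' * (pochhammer a m * pochhammer a' l / pochhammer (a + a') (m + l))) *
      (Beta (a + a') d * (pochhammer (a + a') (m + l) / pochhammer c (m + l)))) F2" .
  \<comment> \<open>the normalisation of the two Euler integrals\<close>
  define k where "k = 1 / (Beta a a' * Beta (a + a') d)"
  have nz: "Beta a a' \<noteq> 0" "Beta (a + a') d \<noteq> 0" using a aa d Beta_nonzero_Re_pos[of a a'] Beta_nonzero_Re_pos[of "a + a'" d] by auto
  have "pochhammer (a + a') n \<noteq> 0" for n
    using Re_pos_not_nonpos_Int[of "a + a'"] aa by (auto simp: pochhammer_eq_0_iff)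
  hence "(\<lambda>m l. k * (pochhammer b m / fact m * (pochhammer b' l / fact l) * (Beta a a' * (pochhammer a m * pochhammer a' l / pochhammer (a + a') (m + l))) *
      (Beta (a + a') d * (pochhammer (a + a') (m + l) / pochhammer c (m + l))))) = F3_coeff a a' b b' c"
    using nz by (intro ext) (simp add: F3_coeff_def k_def divide_simps)
  with expands_cmult[OF F2, of k] show ?thesis unfolding F3_extendable_def by auto
qed

lemma F3_extendable_swap: "F3_extendable a a' b b' c \<Longrightarrow> F3_extendable a' a b' b c"
proof -
  have "(\<lambda>m l. F3_coeff a a' b b' c l m) = F3_coeff a' a b' b c"
    by (intro ext) (simp add: F3_coeff_def mult_ac add.commute)
  thus "F3_extendable a a' b b' c \<Longrightarrow> F3_extendable a' a b' b c"
    unfolding F3_extendable_def using expands_swap by metis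
qed

text \<open>This is \<open>(a)\<^sub>m = (a + 1)\<^sub>m - m * (a + 1)\<^sub>m\<^sub>-\<^sub>1\<close>, with the factor \<open>m\<close> cancelled against \<open>m!\<close>.\<close>

lemma F3_coeff_raise_fst:
  assumes "c \<noteq> 0"
  shows "F3_coeff a a' b b' c m l = F3_coeff (a + 1) a' b b' c m l +
           (- b / c) * (case m of 0 \<Rightarrow> 0 | Suc m \<Rightarrow> F3_coeff (a + 1) a' (b + 1) b' (c + 1) m l)"
proof (cases m)
  case (Suc k)
  have "pochhammer (a + 1) (Suc k) = pochhammer (a + 1) k * (a + 1 + of_nat k)" by (simp add: pochhammer_Suc)
  moreover have "(1 :: complex) + of_nat k \<noteq> 0" by (metis of_nat_Suc of_nat_neq_0)
  ultimately show ?thesis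
    using assms unfolding F3_coeff_def Suc nat.case fact_Suc
    by (cases "pochhammer (c + 1) (k + l) = 0")
       (simp_all add: pochhammer_rec[of a] pochhammer_rec[of b] pochhammer_rec[of c] divide_simps, simp add: algebra_simps)
qed (simp add: F3_coeff_def)

lemma F3_extendable_raise_fst:
  assumes "c \<noteq> 0" "F3_extendable (a + 1) a' b b' c" "F3_extendable (a + 1) a' (b + 1) b' (c + 1)"
  shows "F3_extendable a a' b b' c"
proof -
  from assms obtain F G where "expands (F3_coeff (a + 1) a' b b' c) F" "expands (F3_coeff (a + 1) a' (b + 1) b' (c + 1)) G"
    unfolding F3_extendable_def by blast
  from expands_add[OF this(1) expands_cmult[OF expands_mult_fst[OF this(2)], of "- b / c"]]
  show ?thesis unfolding F3_extendable_def F3_coeff_raise_fst[OF assms(1), symmetric] by blast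
qed

text \<open>Multiplying numerator and denominator by \<open>c + N\<close>, where \<open>N = m + l\<close>, gives \<open>1 / (c)\<^sub>N = (c + N) / (c * (c + 1)\<^sub>N)\<close>; the three summands of
\<open>c + m + l\<close> give the three terms.\<close>

lemma F3_coeff_raise_denominator:
  assumes "c \<notin> \<int>\<^sub>\<le>\<^sub>0"
  shows "F3_coeff a a' b b' c m l = F3_coeff a a' b b' (c + 1) m l +
           (a * b / (c * (c + 1))) * (case m of 0 \<Rightarrow> 0 | Suc m \<Rightarrow> F3_coeff (a + 1) a' (b + 1) b' (c + 2) m l) +
           (a' * b' / (c * (c + 1))) * (case l of 0 \<Rightarrow> 0 | Suc l \<Rightarrow> F3_coeff a (a' + 1) b (b' + 1) (c + 2) m l)"
proof -
  define N where "N = pochhammer a m * pochhammer a' l * pochhammer b m * pochhammer b' l / (fact m * fact l)"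
  have nz: "pochhammer c n \<noteq> 0" for n using assms by (auto simp: pochhammer_eq_0_iff)
  have P1: "pochhammer c (Suc n) = c * pochhammer (c + 1) n" for n by (rule pochhammer_rec)
  have P2: "pochhammer c (Suc (Suc n)) = c * (c + 1) * pochhammer (c + 2) n" for n
    by (simp add: pochhammer_rec add.assoc)
  have c: "c \<noteq> 0" using nz[of 1] by simp
  have c1: "c + 1 \<noteq> 0" using P2[of 0] nz[of 2] by (auto simp: numeral_2_eq_2)
  have t0: "F3_coeff a a' b b' c m l = N * ((c + of_nat (m + l)) / pochhammer c (Suc (m + l)))"
    using nz[of "m + l"] nz[of "Suc (m + l)"] by (simp add: F3_coeff_def N_def pochhammer_Suc)
  have t1: "F3_coeff a a' b b' (c + 1) m l = N * (c / pochhammer c (Suc (m + l)))"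
    using c by (simp add: F3_coeff_def N_def P1)
  have t2: "(a * b / (c * (c + 1))) * (case m of 0 \<Rightarrow> 0 | Suc m \<Rightarrow> F3_coeff (a + 1) a' (b + 1) b' (c + 2) m l) =
           N * (of_nat m / pochhammer c (Suc (m + l)))"
  proof (cases m)
    case (Suc k)
    have "(of_nat (Suc k) :: complex) \<noteq> 0" by (rule of_nat_neq_0)
    thus ?thesis unfolding Suc nat.case add_Suc P2 F3_coeff_def N_def fact_Suc
      by (simp add: pochhammer_rec[of a] pochhammer_rec[of b] mult_ac del: of_nat_Suc)
  qed simp
  have t3: "(a' * b' / (c * (c + 1))) * (case l of 0 \<Rightarrow> 0 | Suc l \<Rightarrow> F3_coeff a (a' + 1) b (b' + 1) (c + 2) m l) =
           N * (of_nat l / pochhammer c (Suc (m + l)))"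
  proof (cases l)
    case (Suc k)
    have "(of_nat (Suc k) :: complex) \<noteq> 0" by (rule of_nat_neq_0)
    thus ?thesis unfolding Suc nat.case add_Suc_right P2 F3_coeff_def N_def fact_Suc
      by (simp add: pochhammer_rec[of a'] pochhammer_rec[of b'] mult_ac del: of_nat_Suc)
  qed simp
  show ?thesis unfolding t0 t1 t2 t3 distrib_left[symmetric] add_divide_distrib[symmetric] of_nat_add add.assoc ..
qed

lemma F3_extendable_raise_denominator:
  assumes "c \<notin> \<int>\<^sub>\<le>\<^sub>0" "F3_extendable a a' b b' (c + 1)"
    "F3_extendable (a + 1) a' (b + 1) b' (c + 2)" "F3_extendable a (a' + 1) b (b' + 1) (c + 2)"
  shows "F3_extendable a a' b b' c"
proof -
  from assms obtain F G H where "expands (F3_coeff a a' b b' (c + 1)) F"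
     "expands (F3_coeff (a + 1) a' (b + 1) b' (c + 2)) G" "expands (F3_coeff a (a' + 1) b (b' + 1) (c + 2)) H"
    unfolding F3_extendable_def by blast
  from expands_add[OF expands_add[OF this(1) expands_cmult[OF expands_mult_fst[OF this(2)], of "a * b / (c * (c + 1))"]]
           expands_cmult[OF expands_mult_snd[OF this(3)], of "a' * b' / (c * (c + 1))"]]
  show ?thesis unfolding F3_extendable_def F3_coeff_raise_denominator[OF assms(1), symmetric] by blast
qed

text \<open>Induction on \<open>N\<close>: in all three series on the right of the contiguous relation the quantity \<open>c - a - a'\<close> has grown by 1.\<close>

lemma F3_extendable_Re_gt_1:
  assumes "Re a > 1" "Re a' > 1" "Re c > 0" "Re (c - a - a') > 1 - real N"
  shows "F3_extendable a a' b b' c"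
  using assms
proof (induction N arbitrary: a a' b b' c)
  case 0
  thus ?case by (intro F3_extendable_base) auto
next
  case (Suc N)
  show ?case
  proof (rule F3_extendable_raise_denominator)
    show "c \<notin> \<int>\<^sub>\<le>\<^sub>0" using Suc.prems by (intro Re_pos_not_nonpos_Int)
  qed (rule Suc.IH; use Suc.prems in simp)+
qed

lemma F3_extendable_Re_snd_gt_1:
  assumes "Re a > 1 - real N" "Re a' > 1" "Re c > 0"
  shows "F3_extendable a a' b b' c"
  using assms
proof (induction N arbitrary: a b c)
  case 0
  obtain M :: nat where "real M > 1 - Re (c - a - a')" using reals_Archimedean2 by blast
  thus ?case using 0 by (intro F3_extendable_Re_gt_1[of _ _ _ M]) auto
next
  case (Suc N)
  show ?case
  proof (rule F3_extendable_raise_fst)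
    show "c \<noteq> 0" using Suc.prems by auto
  qed (rule Suc.IH; use Suc.prems in simp)+
qed

lemma F3_extendable_Re_gt:
  assumes "Re a' > 1 - real N" "Re c > 0"
  shows "F3_extendable a a' b b' c"
  using assms
proof (induction N arbitrary: a' b' c)
  case 0
  obtain M :: nat where "real M > 1 - Re a" using reals_Archimedean2 by blast
  thus ?case using 0 by (intro F3_extendable_Re_snd_gt_1[of M]) auto
next
  case (Suc N)
  have "F3_extendable a' a b' b c"
  proof (rule F3_extendable_raise_fst)
    show "c \<noteq> 0" using Suc.prems by auto
  qed (rule F3_extendable_swap, rule Suc.IH; use Suc.prems in simp)+
  thus ?case by (rule F3_extendable_swap)
qed

theorem F3_extendable:
  assumes "Re c > 0"
  shows "F3_extendable a a' b b' c"
proof -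
  obtain N :: nat where "real N > 1 - Re a'" using reals_Archimedean2 by blast
  thus ?thesis using assms by (intro F3_extendable_Re_gt[of N]) auto
qed

section \<open>Uniqueness of the extension\<close>

lemma holomorphic2_imp_holomorphic_fst:
  assumes "holomorphic2_on F (slit_plane \<times> slit_plane)" "V \<in> slit_plane"
  shows "(\<lambda>U. F (U, V)) holomorphic_on slit_plane"
proof (rule holomorphic_onI)
  fix U assume "U \<in> slit_plane"
  then obtain A B where "(F has_derivative (\<lambda>(h, k). A * h + B * k)) (at (U, V))"
    using assms unfolding holomorphic2_on_def by blast
  moreover have "((\<lambda>U. (U, V)) has_derivative (\<lambda>h. (h, 0))) (at U)"
    by (auto intro!: derivative_eq_intros)
  ultimately have "((\<lambda>U. F (U, V)) has_derivative (\<lambda>h. A * h)) (at U)"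
    using has_derivative_compose[of "\<lambda>U. (U, V)" "\<lambda>h. (h, 0)" U UNIV F "\<lambda>(h, k). A * h + B * k"] by simp
  thus "(\<lambda>U. F (U, V)) field_differentiable at U within slit_plane"
    by (auto simp: field_differentiable_def has_field_derivative_def intro: has_derivative_at_withinI)
qed

lemma holomorphic2_imp_holomorphic_snd:
  assumes "holomorphic2_on F (slit_plane \<times> slit_plane)" "U \<in> slit_plane"
  shows "(\<lambda>V. F (U, V)) holomorphic_on slit_plane"
proof (rule holomorphic_onI)
  fix V assume "V \<in> slit_plane"
  then obtain A B where "(F has_derivative (\<lambda>(h, k). A * h + B * k)) (at (U, V))"
    using assms unfolding holomorphic2_on_def by blast
  moreover have "((\<lambda>V. (U, V)) has_derivative (\<lambda>k. (0, k))) (at V)"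
    by (auto intro!: derivative_eq_intros)
  ultimately have "((\<lambda>V. F (U, V)) has_derivative (\<lambda>k. B * k)) (at V)"
    using has_derivative_compose[of "\<lambda>V. (U, V)" "\<lambda>k. (0, k)" V UNIV F "\<lambda>(h, k). A * h + B * k"] by simp
  thus "(\<lambda>V. F (U, V)) field_differentiable at V within slit_plane"
    by (auto simp: field_differentiable_def has_field_derivative_def intro: has_derivative_at_withinI)
qed

text \<open>The identity theorem on the slit plane is applied in the first variable for each fixed small value of the second, and then in the second variable.\<close>

lemma holomorphic2_unique:
  assumes F: "holomorphic2_on F (slit_plane \<times> slit_plane)" and G: "holomorphic2_on G (slit_plane \<times> slit_plane)"
  assumes eq: "\<And>U V. norm U < 1 \<Longrightarrow> norm V < 1 \<Longrightarrow> F (U, V) = G (U, V)"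
  assumes X: "X \<in> slit_plane" and Y: "Y \<in> slit_plane"
  shows "F (X, Y) = G (X, Y)"
proof -
  have ball: "ball 0 1 \<subseteq> slit_plane" using norm_less_1_slit_plane by auto
  have 1: "F (X, V) = G (X, V)" if V: "norm V < 1" for V
  proof (rule analytic_continuation_open[where f = "\<lambda>U. F (U, V)" and g = "\<lambda>U. G (U, V)" and s = "ball 0 1" and s' = slit_plane])
    show "F (z, V) = G (z, V)" if "z \<in> ball 0 1" for z using eq V that by simp
  qed (use ball open_slit_plane connected_slit_plane X norm_less_1_slit_plane[OF V] in
        \<open>auto intro!: holomorphic2_imp_holomorphic_fst F G\<close>)
  show ?thesis
  proof (rule analytic_continuation_open[where f = "\<lambda>V. F (X, V)" and g = "\<lambda>V. G (X, V)" and s = "ball 0 1" and s' = slit_plane])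
    show "F (X, z) = G (X, z)" if "z \<in> ball 0 1" for z using 1 that by simp
  qed (use ball open_slit_plane connected_slit_plane X Y in
        \<open>auto intro!: holomorphic2_imp_holomorphic_snd F G\<close>)
qed

lemma expands_F3_series:
  assumes "expands (F3_coeff a a' b b' c) F" "norm U < 1" "norm V < 1"
  shows "F (U, V) = appell_F3_series a a' b b' c U V"
  using infsumI[OF expands_has_sum[OF assms]] by (simp add: appell_F3_series_def F3_coeff_def)

text \<open>Any extension that has been constructed is the one selected by the definition.\<close>

lemma appell_F3_eq:
  assumes F: "expands (F3_coeff a a' b b' c) F" and XY: "X \<in> slit_plane" "Y \<in> slit_plane"
  shows "appell_F3 a a' b b' c X Y = F (X, Y)"
proof -
  define P where "P = (\<lambda>F. holomorphic2_on F (slit_plane \<times> slit_plane) \<and>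
        (\<forall>U V. norm U < 1 \<longrightarrow> norm V < 1 \<longrightarrow> F (U, V) = appell_F3_series a a' b b' c U V))"
  have PF: "P F"
    unfolding P_def using F expands_F3_series[OF F] by (auto simp: expands_def C1_holomorphic_imp_holomorphic2)
  have "P (SOME F. P F)" by (rule someI[of P, OF PF])
  then obtain S where S: "S = (SOME F. P F)" "P S" by blast
  have "S (X, Y) = F (X, Y)"
  proof (rule holomorphic2_unique[OF _ _ _ XY])
    show "S (U, V) = F (U, V)" if "norm U < 1" "norm V < 1" for U V
      using S(2) PF that unfolding P_def by metis
  qed (use S(2) PF in \<open>unfold P_def, blast\<close>)+
  hence "(SOME F. P F) (X, Y) = F (X, Y)" by (simp only: S(1))
  thus ?thesis by (simp add: appell_F3_def P_def)
qed

lemma expands_appell_F3: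
  assumes "Re c > 0"
  obtains F where "expands (F3_coeff a a' b b' c) F"
    "\<And>X Y. X \<in> slit_plane \<Longrightarrow> Y \<in> slit_plane \<Longrightarrow> appell_F3 a a' b b' c X Y = F (X, Y)"
  using F3_extendable[OF assms, of a a' b b'] appell_F3_eq unfolding F3_extendable_def by metis

text \<open>Both sides extend the same series, by the coefficient identity for the first variable with the two variables exchanged.\<close>

lemma appell_F3_contiguous_snd:
  assumes c: "Re c > 0" and XY: "X \<in> slit_plane" "Y \<in> slit_plane"
  shows "appell_F3 a a' b b' c X Y =
           appell_F3 a (a' + 1) b b' c X Y - b' / c * Y * appell_F3 a (a' + 1) b (b' + 1) (c + 1) X Y"
proof -
  obtain F where F: "expands (F3_coeff a (a' + 1) b b' c) F"
    "\<And>X Y. X \<in> slit_plane \<Longrightarrow> Y \<in> slit_plane \<Longrightarrow> appell_F3 a (a' + 1) b b' c X Y = F (X, Y)"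
    using expands_appell_F3[OF c] by metis
  have c': "Re (c + 1) > 0" using c by simp
  obtain G where G: "expands (F3_coeff a (a' + 1) b (b' + 1) (c + 1)) G"
    "\<And>X Y. X \<in> slit_plane \<Longrightarrow> Y \<in> slit_plane \<Longrightarrow> appell_F3 a (a' + 1) b (b' + 1) (c + 1) X Y = G (X, Y)"
    using expands_appell_F3[OF c'] by metis
  have sw: "F3_coeff a a' b b' c m l = F3_coeff a' a b' b c l m" for a a' b b' c m l
    by (simp add: F3_coeff_def mult_ac add.commute)
  have "c \<noteq> 0" using c by auto
  have coeff: "F3_coeff a (a' + 1) b b' c m l + (- b' / c) * (case l of 0 \<Rightarrow> 0 | Suc l \<Rightarrow> F3_coeff a (a' + 1) b (b' + 1) (c + 1) m l)
          = F3_coeff a a' b b' c m l" for m l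
    using F3_coeff_raise_fst[OF \<open>c \<noteq> 0\<close>, of a' a b' b l m]
    by (cases l) (simp_all add: sw[of a' a b' b] sw[of "a' + 1" a b' b] sw[of "a' + 1" a "b' + 1" b])
  from expands_add[OF F(1) expands_cmult[OF expands_mult_snd[OF G(1)], of "- b' / c"]]
  have "expands (F3_coeff a a' b b' c) (\<lambda>w. F w + (- b' / c) * (snd w * G w))" unfolding coeff .
  from appell_F3_eq[OF this XY] show ?thesis by (simp add: F(2) G(2) XY mult_ac)
qed

text \<open>The coefficients of \<open>(1 - Y) powr a' * F3(a, a', b, b'; c; X, Y)\<close> as a series in \<open>X\<close> and \<open>Y / (Y - 1)\<close>.\<close>

section \<open>Absolute convergence of the Pfaff-transformed series\<close>

definition pfaff_coeff :: "complex \<Rightarrow> complex \<Rightarrow> complex \<Rightarrow> complex \<Rightarrow> complex \<Rightarrow> nat \<Rightarrow> nat \<Rightarrow> complex" where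
  "pfaff_coeff a a' b b' c m l =
     pochhammer a m * pochhammer b m / fact m * (pochhammer a' l / fact l) *
     pochhammer (c - b' + of_nat m) l / pochhammer c (m + l)"

lemma inverse_pochhammer_bound:
  fixes z :: complex
  assumes z: "Re z > 0" and x: "x < Re z"
  obtains C where "C > 0" "\<And>n. norm (1 / pochhammer z n) \<le> C / poch_size x n"
proof -
  obtain C where C: "C > 0" "\<And>k. norm (rGamma (z + of_nat k)) \<le> C / poch_size x k"
    using rGamma_shift_bound[OF x] by metis
  have "norm (1 / pochhammer z n) \<le> (C * norm (Gamma z)) / poch_size x n" for n
  proof -
    have nz: "pochhammer z n \<noteq> 0" "Gamma z \<noteq> 0"
      using Re_pos_not_nonpos_Int[OF z] Gamma_nonzero_Re_pos[OF z] by (auto simp: pochhammer_eq_0_iff)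
    have "1 / pochhammer z n = Gamma z * rGamma (z + of_nat n)"
      using pochhammer_rGamma[of z n] nz by (simp add: rGamma_inverse_Gamma field_simps)
    hence "norm (1 / pochhammer z n) = norm (Gamma z) * norm (rGamma (z + of_nat n))" by (simp add: norm_mult)
    also have "\<dots> \<le> norm (Gamma z) * (C / poch_size x n)" by (intro mult_left_mono C) auto
    finally show ?thesis by (simp add: mult_ac)
  qed
  thus ?thesis using C(1) Gamma_nonzero_Re_pos[OF z] by (intro that[of "C * norm (Gamma z)"]) auto
qed

lemma pfaff_coeff_bound:
  assumes c: "Re c > 0" and e: "e > 0"
  obtains K where "K > 0"
    "\<And>m l. norm (pfaff_coeff a a' b b' c m l) \<le>
       K * (real m + 1) powr (Re a + Re b + Re b' - Re c - 1 + e) * (real l + 1) powr (Re a' - 1 + e) *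
       (real (m + l) + 1) powr (- Re b' + 2 * e)"
proof -
  obtain A where A: "A > 0" "\<And>k. norm (pochhammer a k) \<le> A * poch_size (Re a + e) k"
    using pochhammer_bound[of a "Re a + e"] e by auto
  obtain B where B: "B > 0" "\<And>k. norm (pochhammer b k) \<le> B * poch_size (Re b + e) k"
    using pochhammer_bound[of b "Re b + e"] e by auto
  obtain A' where A': "A' > 0" "\<And>k. norm (pochhammer a' k) \<le> A' * poch_size (Re a' + e) k"
    using pochhammer_bound[of a' "Re a' + e"] e by auto
  obtain W where W: "W > 0" "\<And>m l. norm (pochhammer (c - b' + of_nat m) l) \<le> W * poch_size (Re (c - b') + e) (m + l) / poch_size (Re (c - b') + e) m"
    using pochhammer_shift_bound[of "c - b'" "Re (c - b') + e"] e by auto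
  obtain D where D: "D > 0" "\<And>n. norm (1 / pochhammer c n) \<le> D / poch_size (Re c - e) n"
    using inverse_pochhammer_bound[OF c, of "Re c - e"] e by auto
  show ?thesis
  proof (rule that[of "A * B * A' * W * D"])
    show "A * B * A' * W * D > 0" using A B A' W D by simp
    fix m l
    let ?P = "\<lambda>x n. (real n + 1) powr (x - 1)"
    have "norm (pfaff_coeff a a' b b' c m l) = norm (pochhammer a m) * norm (pochhammer b m) / fact m * (norm (pochhammer a' l) / fact l) *
             norm (pochhammer (c - b' + of_nat m) l) * norm (1 / pochhammer c (m + l))"
      by (simp add: pfaff_coeff_def norm_mult norm_divide)
    also have "\<dots> \<le> (A * poch_size (Re a + e) m) * (B * poch_size (Re b + e) m) / fact m * ((A' * poch_size (Re a' + e) l) / fact l) *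
             (W * poch_size (Re (c - b') + e) (m + l) / poch_size (Re (c - b') + e) m) * (D / poch_size (Re c - e) (m + l))"
      using A B A' W D
      by (intro mult_mono divide_right_mono A B A' W D)
         (auto intro!: mult_nonneg_nonneg divide_nonneg_nonneg less_imp_le[OF poch_size_pos] less_imp_le[OF A(1)] less_imp_le[OF B(1)]
               less_imp_le[OF A'(1)] less_imp_le[OF W(1)] less_imp_le[OF D(1)])
    also have "\<dots> = A * B * A' * W * D * (?P (Re a + e) m * ?P (Re b + e) m / ?P (Re (c - b') + e) m) * ?P (Re a' + e) l *
               (?P (Re (c - b') + e) (m + l) / ?P (Re c - e) (m + l))"
      unfolding poch_size_def by simp
    also have "?P (Re a + e) m * ?P (Re b + e) m / ?P (Re (c - b') + e) m = (real m + 1) powr (Re a + Re b + Re b' - Re c - 1 + e)"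
      unfolding powr_add[symmetric] powr_diff[symmetric] by (simp add: algebra_simps)
    also have "?P (Re (c - b') + e) (m + l) / ?P (Re c - e) (m + l) = (real (m + l) + 1) powr (- Re b' + 2 * e)"
      unfolding powr_diff[symmetric] by (simp add: algebra_simps)
    also have "?P (Re a' + e) l = (real l + 1) powr (Re a' - 1 + e)" by (simp add: algebra_simps)
    finally show "norm (pfaff_coeff a a' b b' c m l) \<le>
       A * B * A' * W * D * (real m + 1) powr (Re a + Re b + Re b' - Re c - 1 + e) * (real l + 1) powr (Re a' - 1 + e) *
       (real (m + l) + 1) powr (- Re b' + 2 * e)" .
  qed
qed

text \<open>As \<open>m + l + 1\<close> is at least \<open>m + 1\<close> and at least \<open>l + 1\<close>, the exponent \<open>E\<close> may be distributed over the two variables in non-positive parts. The part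
\<open>E2\<close> given to \<open>l\<close> is just large enough for the sum over \<open>l\<close> to converge; the hypothesis on \<open>A + B + E\<close> says that the rest suffices for \<open>m\<close>.\<close>

lemma summable_on_triple_powr:
  fixes A B E :: real
  assumes B: "B > -1" and BE: "B + E < -1" and ABE: "A + B + E < -2"
  shows "(\<lambda>(m, l). (real m + 1) powr A * (real l + 1) powr B * (real (m + l) + 1) powr E) summable_on UNIV"
proof -
  define k where "k = min (- (1 + B + E)) (- (2 + A + B + E)) / 2"
  have k: "k > 0" "k \<le> - (1 + B + E) / 2" "k \<le> - (2 + A + B + E) / 2" using assms by (auto simp: k_def min_def)
  \<comment> \<open>this makes the exponent of \<open>l + 1\<close> equal to \<open>- 1 - k\<close>\<close>
  define E2 where "E2 = - 1 - B - k"
  define E1 where "E1 = E - E2"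
  have E: "E1 \<le> 0" "E2 \<le> 0" "A + E1 < -1" "B + E2 < -1" using k B by (auto simp: E1_def E2_def)
  have "((\<lambda>l. (real l + 1) powr (B + E2)) has_sum (\<Sum>\<^sub>\<infinity>l. (real l + 1) powr (B + E2))) UNIV" (is "(_ has_sum ?S) _")
    using summable_on_nat_powr[OF E(4)] by simp
  have "(\<lambda>(m, l). (real m + 1) powr (A + E1) * (real l + 1) powr (B + E2)) summable_on Sigma UNIV (\<lambda>_. UNIV)"
  proof (rule summable_on_SigmaI)
    show "((\<lambda>l. case (m, l) of (m, l) \<Rightarrow> (real m + 1) powr (A + E1) * (real l + 1) powr (B + E2)) has_sum (real m + 1) powr (A + E1) * ?S) UNIV" for m
      using has_sum_cmult_right[OF \<open>((\<lambda>l. (real l + 1) powr (B + E2)) has_sum ?S) UNIV\<close>] by simp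
    show "(\<lambda>m. (real m + 1) powr (A + E1) * ?S) summable_on UNIV"
      by (intro summable_on_cmult_left summable_on_nat_powr E)
  qed auto
  hence sm: "(\<lambda>(m, l). (real m + 1) powr (A + E1) * (real l + 1) powr (B + E2)) summable_on UNIV" by simp
  have "(\<lambda>p. norm ((\<lambda>(m, l). (real m + 1) powr A * (real l + 1) powr B * (real (m + l) + 1) powr E) p)) summable_on UNIV"
  proof (rule Infinite_Sum.abs_summable_on_comparison_test'[OF sm])
    fix p :: "nat \<times> nat"
    obtain m l where p: "p = (m, l)" by (cases p)
    have "(real (m + l) + 1) powr E = (real (m + l) + 1) powr E1 * (real (m + l) + 1) powr E2"
      unfolding E1_def powr_add[symmetric] by simp
    also have "\<dots> \<le> (real m + 1) powr E1 * (real l + 1) powr E2"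
      using E by (intro mult_mono powr_mono2') auto
    finally have "(real m + 1) powr A * (real l + 1) powr B * (real (m + l) + 1) powr E \<le> 
        (real m + 1) powr A * (real l + 1) powr B * ((real m + 1) powr E1 * (real l + 1) powr E2)"
      by (intro mult_left_mono) auto
    also have "\<dots> = (real m + 1) powr (A + E1) * (real l + 1) powr (B + E2)"
      by (simp add: powr_add mult_ac)
    finally show "norm ((\<lambda>(m, l). (real m + 1) powr A * (real l + 1) powr B * (real (m + l) + 1) powr E) p) \<le>
        (\<lambda>(m, l). (real m + 1) powr (A + E1) * (real l + 1) powr (B + E2)) p"
      by (simp add: p)
  qed
  thus ?thesis by (simp add: case_prod_unfold)
qed

text \<open>The weight is the decay of \<open>Beta t (c + m + l)\<close>, up to the difference between \<open>t'\<close> and \<open>t\<close>, which leaves room for the loss in the bound on the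
Beta function. The two hypotheses on \<open>t\<close> are the convergence conditions of the inner and the outer Gauss sum.\<close>

lemma pfaff_coeff_weighted_summable:
  assumes c: "Re c > 0" and a': "Re a' > 0" and t: "t + Re b' - Re a' > 0" "t + Re c - Re a - Re a' - Re b > 0"
  shows "\<exists>t'<t. (\<lambda>(m, l). norm (pfaff_coeff a a' b b' c m l) * (real (m + l) + 1) powr (- t')) summable_on UNIV"
proof -
  define e where "e = min (t + Re b' - Re a') (t + Re c - Re a - Re a' - Re b) / 8"
  have e: "e > 0" "t + Re b' - Re a' \<ge> 8 * e" "t + Re c - Re a - Re a' - Re b \<ge> 8 * e" using t by (auto simp: e_def min_def)
  obtain K where K: "K > 0"
    "\<And>m l. norm (pfaff_coeff a a' b b' c m l) \<le>
       K * (real m + 1) powr (Re a + Re b + Re b' - Re c - 1 + e) * (real l + 1) powr (Re a' - 1 + e) *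
       (real (m + l) + 1) powr (- Re b' + 2 * e)"
    using pfaff_coeff_bound[OF c e(1)] by metis
  define A B E where "A = Re a + Re b + Re b' - Re c - 1 + e" and "B = Re a' - 1 + e" and "E = - Re b' + 2 * e - (t - e)"
  have "(\<lambda>(m, l). (real m + 1) powr A * (real l + 1) powr B * (real (m + l) + 1) powr E) summable_on UNIV"
    using e a' by (intro summable_on_triple_powr) (auto simp: A_def B_def E_def)
  hence sm: "(\<lambda>p. K * (\<lambda>(m, l). (real m + 1) powr A * (real l + 1) powr B * (real (m + l) + 1) powr E) p) summable_on UNIV"
    by (rule summable_on_cmult_right)
  have "(\<lambda>p. norm ((\<lambda>(m, l). norm (pfaff_coeff a a' b b' c m l) * (real (m + l) + 1) powr (- (t - e))) p)) summable_on UNIV"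
  proof (rule Infinite_Sum.abs_summable_on_comparison_test'[OF sm])
    fix p :: "nat \<times> nat"
    obtain m l where p: "p = (m, l)" by (cases p)
    have "norm (pfaff_coeff a a' b b' c m l) * (real (m + l) + 1) powr (- (t - e)) \<le>
        (K * (real m + 1) powr A * (real l + 1) powr B * (real (m + l) + 1) powr (- Re b' + 2 * e)) * (real (m + l) + 1) powr (- (t - e))"
      using K by (intro mult_right_mono) (auto simp: A_def B_def)
    also have "\<dots> = K * ((real m + 1) powr A * (real l + 1) powr B * (real (m + l) + 1) powr E)"
      unfolding E_def diff_conv_add_uminus[of _ "t - e"] powr_add by (simp only: mult_ac)
    finally show "norm ((\<lambda>(m, l). norm (pfaff_coeff a a' b b' c m l) * (real (m + l) + 1) powr (- (t - e))) p) \<le>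
       K * (\<lambda>(m, l). (real m + 1) powr A * (real l + 1) powr B * (real (m + l) + 1) powr E) p"
      by (simp add: p)
  qed
  thus ?thesis using e by (intro exI[of _ "t - e"]) (simp add: case_prod_unfold)
qed

lemma powr_mult_power_bounded:
  assumes "0 \<le> r" "r < 1"
  obtains C where "C > 0" "\<And>n. r ^ n \<le> C * (real n + 1) powr (- t)"
proof -
  define r' where "r' = max r (1/2)"
  have r': "0 < r'" "r' < 1" "r \<le> r'" using assms by (auto simp: r'_def)
  have "(\<lambda>n. (real n + 1) powr t * r' ^ n) \<longlonglongrightarrow> 0" using r'(1,2) by real_asymp
  hence "Bseq (\<lambda>n. (real n + 1) powr t * r' ^ n)" by (rule convergent_imp_Bseq[OF convergentI])
  then obtain C where C: "C > 0" "\<And>n. norm ((real n + 1) powr t * r' ^ n) \<le> C" by (auto elim!: BseqE)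
  have "r ^ n \<le> C * (real n + 1) powr (- t)" for n
  proof -
    have "(real n + 1) powr t * r' ^ n \<le> C" using C(2)[of n] r' by simp
    hence "r' ^ n \<le> C * (real n + 1) powr (- t)" by (simp add: powr_minus field_simps)
    moreover have "r ^ n \<le> r' ^ n" using assms r' by (intro power_mono) auto
    ultimately show ?thesis by linarith
  qed
  thus ?thesis using C(1) that by blast
qed

text \<open>The powers of \<open>X\<close> and \<open>Z\<close> decay faster than the weight in the previous lemma for any sufficiently large \<open>t\<close>.\<close>

lemma pfaff_series_abs_summable:
  assumes c: "Re c > 0" and a': "Re a' > 0" and XZ: "norm X < 1" "norm Z < 1"
  shows "(\<lambda>(m, l). norm (pfaff_coeff a a' b b' c m l * X ^ m * Z ^ l)) summable_on UNIV"
proof -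
  define t where "t = 1 + max (Re a' - Re b') (Re a + Re a' + Re b - Re c)"
  have t: "t + Re b' - Re a' > 0" "t + Re c - Re a - Re a' - Re b > 0" by (auto simp: t_def max_def)
  obtain t' where t': "(\<lambda>(m, l). norm (pfaff_coeff a a' b b' c m l) * (real (m + l) + 1) powr (- t')) summable_on UNIV"
    using pfaff_coeff_weighted_summable[OF c a' t] by blast
  define r where "r = max (norm X) (norm Z)"
  have r: "0 \<le> r" "r < 1" "norm X \<le> r" "norm Z \<le> r" using XZ by (auto simp: r_def max_def)
  obtain C where C: "C > 0" "\<And>n. r ^ n \<le> C * (real n + 1) powr (- t')" using powr_mult_power_bounded[OF r(1,2)] by metis
  have sm: "(\<lambda>p. C * (\<lambda>(m, l). norm (pfaff_coeff a a' b b' c m l) * (real (m + l) + 1) powr (- t')) p) summable_on UNIV"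
    using t' by (rule summable_on_cmult_right)
  have "(\<lambda>p. norm ((\<lambda>(m, l). pfaff_coeff a a' b b' c m l * X ^ m * Z ^ l) p)) summable_on UNIV"
  proof (rule Infinite_Sum.abs_summable_on_comparison_test'[OF sm])
    fix p :: "nat \<times> nat"
    obtain m l where p: "p = (m, l)" by (cases p)
    have "norm X ^ m * norm Z ^ l \<le> r ^ m * r ^ l" using r by (intro mult_mono power_mono) auto
    also have "\<dots> \<le> C * (real (m + l) + 1) powr (- t')" using C(2)[of "m + l"] by (simp add: power_add)
    finally have "norm (pfaff_coeff a a' b b' c m l) * (norm X ^ m * norm Z ^ l) \<le> 
                  norm (pfaff_coeff a a' b b' c m l) * (C * (real (m + l) + 1) powr (- t'))" by (rule mult_left_mono) auto
    thus "norm ((\<lambda>(m, l). pfaff_coeff a a' b b' c m l * X ^ m * Z ^ l) p) \<le> 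
        C * (\<lambda>(m, l). norm (pfaff_coeff a a' b b' c m l) * (real (m + l) + 1) powr (- t')) p"
      by (simp add: p norm_mult norm_power mult_ac)
  qed
  thus ?thesis by (simp add: case_prod_unfold)
qed

section \<open>Pfaff's transformation in the second variable\<close>

text \<open>The half-plane consists of the points closer to 0 than to 1.\<close>

lemma norm_pfaff_variable_less_1:
  assumes "Re Y < 1 / 2"
  shows "norm (Y / (Y - 1)) < 1"
proof -
  have "Y \<noteq> 1" using assms by auto
  have "(norm Y)\<^sup>2 < (norm (Y - 1))\<^sup>2"
    using assms by (simp add: cmod_power2) (simp add: power2_eq_square algebra_simps)
  hence "norm Y < norm (Y - 1)" by (rule power_less_imp_less_base) auto
  thus ?thesis using \<open>Y \<noteq> 1\<close> by (simp add: norm_divide)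
qed

text \<open>The slice \<open>m = 0\<close> of the double series.\<close>

lemma pfaff_2F1_summable:
  fixes a b c z :: complex
  assumes "Re a > 0" "Re c > 0" "norm z < 1"
  shows "(\<lambda>l. norm (pochhammer a l * pochhammer (c - b) l / (pochhammer c l * fact l) * z ^ l)) summable_on UNIV"
proof -
  have "(\<lambda>(m, l). norm (pfaff_coeff 0 a 0 b c m l * 0 ^ m * z ^ l)) summable_on Sigma UNIV (\<lambda>_. UNIV)"
    using pfaff_series_abs_summable[of c a 0 z 0 0 b] assms by simp
  from summable_on_SigmaD1[OF this, of 0] show ?thesis
    by (simp add: pfaff_coeff_def mult_ac)
qed

lemma fact_eq_pochhammer_neg:
  assumes "k \<le> n"
  shows "(fact n :: complex) = fact (n - k) * ((-1) ^ k * pochhammer (- of_nat n) k)"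
proof -
  have "(fact n :: complex) = pochhammer 1 (n - k + k)" using assms by (simp add: pochhammer_fact)
  also have "\<dots> = fact (n - k) * pochhammer (1 + of_nat (n - k)) k" by (simp only: pochhammer_product' pochhammer_fact)
  also have "1 + of_nat (n - k) = (of_nat n - of_nat k + 1 :: complex)" using assms by (simp add: of_nat_diff)
  finally show ?thesis by (simp only: pochhammer_minus')
qed

text \<open>After rewriting the reciprocal of \<open>(k - l)!\<close> by \<open>pochhammer (- of_nat k) l\<close> this is the Chu-Vandermonde sum.\<close>

lemma pfaff_coeff_identity:
  fixes a b c :: complex
  assumes "Re c > 0"
  shows "(\<Sum>l\<le>k. pochhammer a l * pochhammer (c - b) l / (pochhammer c l * fact l) * (-1) ^ l *
            (pochhammer (a + of_nat l) (k - l) / fact (k - l))) =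
         pochhammer a k * pochhammer b k / (pochhammer c k * fact k)"
proof -
  have nz: "\<forall>i\<in>{0..<k}. c \<noteq> - of_nat i" using assms by auto
  have "pochhammer a l * pochhammer (c - b) l / (pochhammer c l * fact l) * (-1) ^ l * (pochhammer (a + of_nat l) (k - l) / fact (k - l)) =
        pochhammer a k / fact k * (pochhammer (c - b) l * pochhammer (- of_nat k) l / (of_nat (fact l) * pochhammer c l))" if "l \<le> k" for l
  proof -
    have 1: "pochhammer a k = pochhammer a l * pochhammer (a + of_nat l) (k - l)" using that by (rule pochhammer_product)
    have 2: "fact k = fact (k - l) * ((-1) ^ l * pochhammer (- of_nat k :: complex) l)" using that by (rule fact_eq_pochhammer_neg)
    have "(fact (k - l) :: complex) \<noteq> 0" "(-1) ^ l * pochhammer (- of_nat k :: complex) l \<noteq> 0"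
      using 2 fact_nonzero[of k, where 'a = complex] by auto
    thus ?thesis unfolding 1 2 by (cases "even l") (simp_all add: field_simps)
  qed
  hence "(\<Sum>l\<le>k. pochhammer a l * pochhammer (c - b) l / (pochhammer c l * fact l) * (-1) ^ l * (pochhammer (a + of_nat l) (k - l) / fact (k - l))) =
      (\<Sum>l\<le>k. pochhammer a k / fact k * (pochhammer (c - b) l * pochhammer (- of_nat k) l / (of_nat (fact l) * pochhammer c l)))"
    by (intro sum.cong) auto
  also have "\<dots> = pochhammer a k / fact k * (pochhammer (c - (c - b)) k / pochhammer c k)"
    unfolding sum_distrib_left[symmetric] using Vandermonde_pochhammer[OF nz, of "c - b"] by (simp only: atLeast0AtMost)
  finally show ?thesis by simp
qed

lemma sums_binomial_neg_real:
  fixes b z :: real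
  assumes "\<bar>z\<bar> < 1"
  shows "(\<lambda>n. pochhammer b n / fact n * z ^ n) sums (1 - z) powr (- b)"
proof -
  have *: "((- b) gchoose n) * (- z) ^ n = pochhammer b n / fact n * z ^ n" for n
    by (simp add: gbinomial_pochhammer power_minus[of z])
  show ?thesis using gen_binomial_real[of "- z" "- b"] assms by (simp add: *)
qed

lemma pochhammer_real_nonneg: "(x :: real) \<ge> 0 \<Longrightarrow> pochhammer x n \<ge> 0"
  by (induction n) (auto simp: pochhammer_Suc)

lemma norm_pochhammer_le: "norm (pochhammer (z :: complex) n) \<le> pochhammer (norm z) n"
proof (induction n)
  case (Suc n)
  have "norm (z + of_nat n) \<le> norm z + of_nat n" using norm_triangle_ineq[of z "of_nat n"] by simp
  thus ?case using Suc by (simp add: pochhammer_Suc norm_mult mult_mono pochhammer_real_nonneg)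
qed simp

text \<open>Expand each \<open>(1 - Y) powr (- a - l)\<close> as a binomial series and collect the powers of \<open>Y\<close>. The restriction on \<open>Y\<close> ensures that
\<open>norm Y / (1 - norm Y) < 1\<close>, so that the double series converges absolutely.\<close>

lemma pfaff_2F1:
  fixes a b c Y :: complex
  assumes a: "Re a > 0" and c: "Re c > 0" and Y: "norm Y < 1 / 3"
  shows "((\<lambda>k. pochhammer a k * pochhammer b k / (pochhammer c k * fact k) * Y ^ k) has_sum
           (1 - Y) powr (- a) *
           (\<Sum>\<^sub>\<infinity>l. pochhammer a l * pochhammer (c - b) l / (pochhammer c l * fact l) * (Y / (Y - 1)) ^ l)) UNIV"
proof -
  define q where "q l = pochhammer a l * pochhammer (c - b) l / (pochhammer c l * fact l)" for l
  define Z where "Z = Y / (Y - 1)"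
  define h where "h = (\<lambda>(l, j). q l * (- Y) ^ l * (pochhammer (a + of_nat l) j / fact j * Y ^ j))"
  have Y1: "norm Y < 1" "Y \<noteq> 1" using Y by auto
  have Zn: "norm Z < 1" unfolding Z_def
    using Y complex_Re_le_cmod[of Y] by (intro norm_pfaff_variable_less_1) linarith
  have inner: "((\<lambda>j. h (l, j)) has_sum (1 - Y) powr (- a) * (q l * Z ^ l)) UNIV" for l
  proof -
    have "((\<lambda>j. pochhammer (a + of_nat l) j / fact j * Y ^ j) has_sum (1 - Y) powr (- (a + of_nat l))) UNIV"
      by (rule norm_summable_imp_has_sum[OF sums_binomial_neg(2,1)[OF Y1(1)]])
    from has_sum_cmult_right[OF this, of "q l * (- Y) ^ l"]
    have "((\<lambda>j. h (l, j)) has_sum q l * (- Y) ^ l * (1 - Y) powr (- (a + of_nat l))) UNIV"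
      by (simp add: h_def)
    also have "(1 - Y) powr (- (a + of_nat l)) = (1 - Y) powr (- a) / (1 - Y) ^ l"
      using Y1 by (simp add: powr_diff powr_nat')
    also have "q l * (- Y) ^ l * ((1 - Y) powr (- a) / (1 - Y) ^ l) = (1 - Y) powr (- a) * (q l * ((- Y) / (1 - Y)) ^ l)"
      by (simp only: power_divide times_divide_eq_right times_divide_eq_left mult_ac)
    also have "(- Y) / (1 - Y) = Z" unfolding Z_def using Y1 by (simp add: divide_simps) (simp add: algebra_simps)?
    finally show ?thesis .
  qed
  have h_sum: "h summable_on Sigma UNIV (\<lambda>_. UNIV)"
  proof (rule abs_summable_summable)
    define y where "y = norm Y"
    have y: "0 \<le> y" "y < 1 / 3" using Y by (auto simp: y_def)
    define H where "H = (\<lambda>(l, j). norm (q l) * y ^ l * (pochhammer (norm a + of_nat l) j / fact j * y ^ j))"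
    have "H summable_on Sigma UNIV (\<lambda>_. UNIV)"
    proof (rule summable_on_SigmaI)
      show H0: "H (l, j) \<ge> 0" for l j using y by (simp add: H_def pochhammer_real_nonneg add_nonneg_nonneg)
      show "((\<lambda>j. H (l, j)) has_sum norm (q l) * y ^ l * (1 - y) powr (- (norm a + of_nat l))) UNIV" for l
      proof -
        have s: "(\<lambda>j. pochhammer (norm a + of_nat l) j / fact j * y ^ j) sums (1 - y) powr (- (norm a + of_nat l))"
          using y by (intro sums_binomial_neg_real) auto
        have "((\<lambda>j. pochhammer (norm a + of_nat l) j / fact j * y ^ j) has_sum (1 - y) powr (- (norm a + of_nat l))) UNIV"
          by (rule sums_nonneg_imp_has_sum[OF s]) (use y in \<open>simp add: pochhammer_real_nonneg add_nonneg_nonneg\<close>)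
        from has_sum_cmult_right[OF this, of "norm (q l) * y ^ l"] show ?thesis by (simp add: H_def)
      qed
      have eq: "norm (q l) * y ^ l * (1 - y) powr (- (norm a + of_nat l)) = (1 - y) powr (- norm a) * norm (q l * of_real (y / (1 - y)) ^ l)" for l
      proof -
        have "(1 - y) powr (- (norm a + of_nat l)) = (1 - y) powr (- norm a) / (1 - y) ^ l"
          using y by (simp add: powr_diff powr_realpow)
        moreover have "norm (complex_of_real (y / (1 - y)) ^ l) = y ^ l / (1 - y) ^ l"
          using y by (simp add: norm_power norm_divide power_divide del: of_real_divide)
        ultimately show ?thesis by (simp add: norm_mult)
      qed
      have "norm (complex_of_real (y / (1 - y))) < 1" using y by (simp add: norm_divide divide_simps del: of_real_divide)
      from pfaff_2F1_summable[OF a c this, of b]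
      have sm: "(\<lambda>l. norm (q l * complex_of_real (y / (1 - y)) ^ l)) summable_on UNIV" by (simp only: q_def)
      show "(\<lambda>l. norm (q l) * y ^ l * (1 - y) powr (- (norm a + of_nat l))) summable_on UNIV"
        unfolding eq by (rule summable_on_cmult_right[OF sm])
    qed
    thus "(\<lambda>p. norm (h p)) summable_on Sigma UNIV (\<lambda>_. UNIV)"
    proof (rule Infinite_Sum.abs_summable_on_comparison_test')
      fix p :: "nat \<times> nat"
      obtain l j where p: "p = (l, j)" by (cases p)
      have "norm (pochhammer (a + of_nat l) j) \<le> pochhammer (norm (a + of_nat l)) j" by (rule norm_pochhammer_le)
      also have "\<dots> \<le> pochhammer (norm a + of_nat l) j"
      proof (induction j)
        case (Suc j)
        have "norm (a + of_nat l) \<le> norm a + of_nat l" using norm_triangle_ineq[of a "of_nat l"] by simp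
        thus ?case using Suc by (simp add: pochhammer_Suc mult_mono pochhammer_real_nonneg add_nonneg_nonneg)
      qed simp
      finally have "norm (q l) * y ^ l * (norm (pochhammer (a + of_nat l) j) / fact j * y ^ j) \<le> H p"
        unfolding H_def p using y by (auto intro!: mult_left_mono mult_right_mono divide_right_mono)
      thus "norm (h p) \<le> H p" by (simp add: h_def p norm_mult norm_divide norm_power y_def)
    qed
  qed
  then obtain S where S: "(h has_sum S) (Sigma UNIV (\<lambda>_. UNIV))" by (auto simp: summable_on_def)
  have "((\<lambda>l. (1 - Y) powr (- a) * (q l * Z ^ l)) has_sum S) UNIV"
    by (rule has_sum_SigmaD[OF S]) (rule inner)
  moreover have "((\<lambda>l. (1 - Y) powr (- a) * (q l * Z ^ l)) has_sum (1 - Y) powr (- a) * (\<Sum>\<^sub>\<infinity>l. q l * Z ^ l)) UNIV"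
    by (rule has_sum_cmult_right[OF has_sum_infsum[OF abs_summable_summable]])
       (use pfaff_2F1_summable[OF a c Zn, of b] in \<open>simp add: q_def\<close>)
  ultimately have S_eq: "S = (1 - Y) powr (- a) * (\<Sum>\<^sub>\<infinity>l. q l * Z ^ l)" by (rule has_sum_unique)
  have "((\<lambda>(k, l). h (l, k - l)) has_sum S) (Sigma UNIV (\<lambda>k. {..k}))"
  proof -
    have "(h has_sum S) (Sigma UNIV (\<lambda>_. UNIV)) = ((\<lambda>(k, l). h (l, k - l)) has_sum S) (Sigma UNIV (\<lambda>k. {..k}))"
      by (rule has_sum_reindex_bij_witness[where i = "\<lambda>(k, l). (l, k - l)" and j = "\<lambda>(l, j). (l + j, l)"]) auto
    thus ?thesis using S by simp
  qed
  hence "((\<lambda>k. \<Sum>l\<le>k. h (l, k - l)) has_sum S) UNIV"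
    by (rule has_sum_SigmaD) (auto intro: has_sum_finite)
  also have "(\<lambda>k. \<Sum>l\<le>k. h (l, k - l)) = (\<lambda>k. pochhammer a k * pochhammer b k / (pochhammer c k * fact k) * Y ^ k)"
  proof
    fix k
    have "(\<Sum>l\<le>k. h (l, k - l)) = (\<Sum>l\<le>k. q l * (-1) ^ l * (pochhammer (a + of_nat l) (k - l) / fact (k - l)) * Y ^ k)"
    proof (intro sum.cong refl)
      fix l assume "l \<in> {..k}"
      hence "Y ^ k = Y ^ l * Y ^ (k - l)" by (simp flip: power_add)
      thus "h (l, k - l) = q l * (-1) ^ l * (pochhammer (a + of_nat l) (k - l) / fact (k - l)) * Y ^ k"
        by (simp add: h_def power_minus[of Y])
    qed
    thus "(\<Sum>l\<le>k. h (l, k - l)) = pochhammer a k * pochhammer b k / (pochhammer c k * fact k) * Y ^ k"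
      unfolding sum_distrib_right[symmetric] q_def pfaff_coeff_identity[OF c] .
  qed
  finally show ?thesis unfolding S_eq q_def Z_def .
qed

text \<open>For each \<open>m\<close> the sum over \<open>l\<close> is a 2F1 with denominator \<open>c + m\<close>, to which Pfaff's transformation applies.\<close>

lemma F3_pfaff_small:
  assumes F: "expands (F3_coeff a a' b b' c) F" and c: "Re c > 0" and a': "Re a' > 0"
    and X: "norm X < 1" and Y: "norm Y < 1 / 3"
  shows "F (X, Y) = (1 - Y) powr (- a') * (\<Sum>\<^sub>\<infinity>(m, l). pfaff_coeff a a' b b' c m l * X ^ m * (Y / (Y - 1)) ^ l)"
proof -
  define Z where "Z = Y / (Y - 1)"
  define \<alpha> where "\<alpha> m = pochhammer a m * pochhammer b m / (pochhammer c m * fact m) * X ^ m" for m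
  define q where "q m l = pochhammer a' l * pochhammer (c + of_nat m - b') l / (pochhammer (c + of_nat m) l * fact l)" for m l
  define P where "P m = (\<Sum>\<^sub>\<infinity>l. q m l * Z ^ l)" for m
  have Zn: "norm Z < 1" unfolding Z_def
    using Y complex_Re_le_cmod[of Y] by (intro norm_pfaff_variable_less_1) linarith
  have cm: "Re (c + of_nat m) > 0" for m using c by simp
  have "((\<lambda>(m, l). F3_coeff a a' b b' c m l * X ^ m * Y ^ l) has_sum F (X, Y)) (Sigma UNIV (\<lambda>_. UNIV))"
    using expands_has_sum[OF F X] Y by simp
  hence 1: "((\<lambda>m. \<alpha> m * ((1 - Y) powr (- a') * P m)) has_sum F (X, Y)) UNIV"
  proof (rule has_sum_SigmaD)
    fix m
    have "(\<lambda>l. case (m, l) of (m, l) \<Rightarrow> F3_coeff a a' b b' c m l * X ^ m * Y ^ l) =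
          (\<lambda>l. \<alpha> m * (pochhammer a' l * pochhammer b' l / (pochhammer (c + of_nat m) l * fact l) * Y ^ l))"
      by (simp add: fun_eq_iff \<alpha>_def F3_coeff_def pochhammer_product'[of c] mult_ac)
    thus "((\<lambda>l. case (m, l) of (m, l) \<Rightarrow> F3_coeff a a' b b' c m l * X ^ m * Y ^ l) has_sum \<alpha> m * ((1 - Y) powr (- a') * P m)) UNIV"
      using has_sum_cmult_right[OF pfaff_2F1[OF a' cm[of m] Y, of b'], of "\<alpha> m"] by (simp only: P_def q_def Z_def)
  qed
  define S where "S = (\<Sum>\<^sub>\<infinity>(m, l). pfaff_coeff a a' b b' c m l * X ^ m * Z ^ l)"
  have "(\<lambda>(m, l). pfaff_coeff a a' b b' c m l * X ^ m * Z ^ l) summable_on UNIV"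
    by (rule abs_summable_summable) (use pfaff_series_abs_summable[OF c a' X Zn, of a b b'] in \<open>simp add: case_prod_unfold\<close>)
  hence "((\<lambda>(m, l). pfaff_coeff a a' b b' c m l * X ^ m * Z ^ l) has_sum S) (Sigma UNIV (\<lambda>_. UNIV))"
    unfolding S_def by simp
  hence "((\<lambda>m. \<alpha> m * P m) has_sum S) UNIV"
  proof (rule has_sum_SigmaD)
    fix m
    have eq: "(\<lambda>l. case (m, l) of (m, l) \<Rightarrow> pfaff_coeff a a' b b' c m l * X ^ m * Z ^ l) = (\<lambda>l. \<alpha> m * (q m l * Z ^ l))"
      by (simp add: fun_eq_iff \<alpha>_def q_def pfaff_coeff_def pochhammer_product'[of c] algebra_simps)
    show "((\<lambda>l. case (m, l) of (m, l) \<Rightarrow> pfaff_coeff a a' b b' c m l * X ^ m * Z ^ l) has_sum \<alpha> m * P m) UNIV"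
      unfolding eq P_def
      by (rule has_sum_cmult_right[OF has_sum_infsum[OF abs_summable_summable]])
         (use pfaff_2F1_summable[OF a' cm[of m] Zn, of b'] in \<open>simp add: q_def\<close>)
  qed
  from has_sum_cmult_right[OF this, of "(1 - Y) powr (- a')"]
  have "((\<lambda>m. \<alpha> m * ((1 - Y) powr (- a') * P m)) has_sum (1 - Y) powr (- a') * S) UNIV" by (simp add: mult_ac)
  from has_sum_unique[OF 1 this] show ?thesis by (simp add: S_def Z_def)
qed

lemma pfaff_series_holomorphic:
  assumes c: "Re c > 0" and a': "Re a' > 0" and X: "norm X < 1"
  shows "(\<lambda>Z. \<Sum>\<^sub>\<infinity>(m, l). pfaff_coeff a a' b b' c m l * X ^ m * Z ^ l) holomorphic_on ball 0 1"
proof -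
  define S where "S l = (\<Sum>\<^sub>\<infinity>m. pfaff_coeff a a' b b' c m l * X ^ m)" for l
  have swapped: "(\<lambda>(l, m). pfaff_coeff a a' b b' c m l * X ^ m * Z ^ l) summable_on Sigma UNIV (\<lambda>_. UNIV)"
    "((\<lambda>(l, m). pfaff_coeff a a' b b' c m l * X ^ m * Z ^ l) has_sum (\<Sum>\<^sub>\<infinity>(m, l). pfaff_coeff a a' b b' c m l * X ^ m * Z ^ l)) (Sigma UNIV (\<lambda>_. UNIV))"
    if Z: "norm Z < 1" for Z
  proof -
    have "(\<lambda>(m, l). pfaff_coeff a a' b b' c m l * X ^ m * Z ^ l) summable_on UNIV"
      by (rule abs_summable_summable) (use pfaff_series_abs_summable[OF c a' X Z, of a b b'] in \<open>simp add: case_prod_unfold\<close>)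
    hence "((\<lambda>(m, l). pfaff_coeff a a' b b' c m l * X ^ m * Z ^ l) has_sum (\<Sum>\<^sub>\<infinity>(m, l). pfaff_coeff a a' b b' c m l * X ^ m * Z ^ l)) UNIV"
      by simp
    also have "?this \<longleftrightarrow> ((\<lambda>(l, m). pfaff_coeff a a' b b' c m l * X ^ m * Z ^ l) has_sum (\<Sum>\<^sub>\<infinity>(m, l). pfaff_coeff a a' b b' c m l * X ^ m * Z ^ l)) (Sigma UNIV (\<lambda>_. UNIV))"
      by (rule has_sum_reindex_bij_witness[where i = prod.swap and j = prod.swap]) auto
    finally show *: "((\<lambda>(l, m). pfaff_coeff a a' b b' c m l * X ^ m * Z ^ l) has_sum (\<Sum>\<^sub>\<infinity>(m, l). pfaff_coeff a a' b b' c m l * X ^ m * Z ^ l)) (Sigma UNIV (\<lambda>_. UNIV))" .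
    show "(\<lambda>(l, m). pfaff_coeff a a' b b' c m l * X ^ m * Z ^ l) summable_on Sigma UNIV (\<lambda>_. UNIV)"
      by (rule has_sum_imp_summable[OF *])
  qed
  have Sm: "((\<lambda>m. pfaff_coeff a a' b b' c m l * X ^ m) has_sum S l) UNIV" for l
  proof -
    have "(\<lambda>m. pfaff_coeff a a' b b' c m l * X ^ m * (1 / 2) ^ l) summable_on UNIV"
      using summable_on_SigmaD1[OF swapped(1)[of "1 / 2"], of l] by (simp add: norm_divide)
    from summable_on_cmult_left[OF this, of "2 ^ l"]
    have "(\<lambda>m. pfaff_coeff a a' b b' c m l * X ^ m) summable_on UNIV"
      by (simp add: power_divide)
    thus ?thesis by (simp add: S_def)
  qed
  show ?thesis
  proof (rule power_series_holomorphic[where a = S])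
    fix Z :: complex assume "Z \<in> ball 0 1"
    hence Z: "norm Z < 1" by simp
    have "((\<lambda>l. S l * Z ^ l) has_sum (\<Sum>\<^sub>\<infinity>(m, l). pfaff_coeff a a' b b' c m l * X ^ m * Z ^ l)) UNIV"
      by (rule has_sum_SigmaD[OF swapped(2)[OF Z]]) (use has_sum_cmult_left[OF Sm] in simp)
    from has_sum_imp_sums[OF this]
    show "(\<lambda>n. S n * (Z - 0) ^ n) sums (\<Sum>\<^sub>\<infinity>(m, l). pfaff_coeff a a' b b' c m l * X ^ m * Z ^ l)" by simp
  qed
qed

text \<open>Both sides are holomorphic in \<open>Y\<close> on the half-plane, which \<open>Y / (Y - 1)\<close> maps into the unit disc, and they agree near the origin.\<close>

lemma F3_pfaff:
  assumes F: "expands (F3_coeff a a' b b' c) F" and c: "Re c > 0" and a': "Re a' > 0"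
    and X: "norm X < 1" and Y: "Re Y < 1 / 2"
  shows "F (X, Y) = (1 - Y) powr (- a') * (\<Sum>\<^sub>\<infinity>(m, l). pfaff_coeff a a' b b' c m l * X ^ m * (Y / (Y - 1)) ^ l)"
proof -
  define Q where "Q = (\<lambda>Z. \<Sum>\<^sub>\<infinity>(m, l). pfaff_coeff a a' b b' c m l * X ^ m * Z ^ l)"
  define H where "H = {Y. Re Y < 1 / 2}"
  have half: "H \<subseteq> slit_plane" by (auto simp: slit_plane_def H_def)
  have "F (X, Y) = (1 - Y) powr (- a') * Q (Y / (Y - 1))"
  proof (rule analytic_continuation_open[where f = "\<lambda>Y. F (X, Y)" and g = "\<lambda>Y. (1 - Y) powr (- a') * Q (Y / (Y - 1))"
            and s = "ball 0 (1/3)" and s' = H])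
    show "open H" unfolding H_def by (rule open_halfspace_Re_lt)
    show "connected H" unfolding H_def by (intro convex_connected convex_halfspace_Re_lt)
    show "ball 0 (1 / 3) \<subseteq> H"
    proof
      fix z :: complex assume "z \<in> ball 0 (1 / 3)"
      hence "norm z < 1 / 3" by simp
      thus "z \<in> H" using complex_Re_le_cmod[of z] by (simp add: H_def)
    qed
    show "(\<lambda>Y. F (X, Y)) holomorphic_on H"
      by (rule holomorphic_on_subset[OF holomorphic2_imp_holomorphic_snd half])
         (use F norm_less_1_slit_plane[OF X] in \<open>auto simp: expands_def intro: C1_holomorphic_imp_holomorphic2\<close>)
    have "Q holomorphic_on ball 0 1" unfolding Q_def by (rule pfaff_series_holomorphic[OF c a' X])
    moreover have "(\<lambda>Y. Y / (Y - 1)) holomorphic_on H"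
      by (intro holomorphic_intros) (auto simp: H_def)
    moreover have "(\<lambda>Y. Y / (Y - 1)) ` H \<subseteq> ball 0 1"
      using norm_pfaff_variable_less_1 by (auto simp: H_def)
    ultimately have "(Q \<circ> (\<lambda>Y. Y / (Y - 1))) holomorphic_on H"
      by (intro holomorphic_on_compose_gen)
    moreover have "(\<lambda>Y. (1 - Y) powr (- a')) holomorphic_on H"
    proof (intro holomorphic_intros)
      fix z assume "z \<in> H"
      hence "Re (1 - z) > 0" by (simp add: H_def)
      thus "1 - z \<notin> \<real>\<^sub>\<le>\<^sub>0" by (simp add: complex_nonpos_Reals_iff)
    qed
    ultimately show "(\<lambda>Y. (1 - Y) powr (- a') * Q (Y / (Y - 1))) holomorphic_on H"
      by (intro holomorphic_on_mult) (auto simp: o_def)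
    show "F (X, z) = (1 - z) powr (- a') * Q (z / (z - 1))" if "z \<in> ball 0 (1 / 3)" for z
      using F3_pfaff_small[OF F c a' X, of z] that by (simp add: Q_def)
  qed (use Y in \<open>auto simp: H_def\<close>)
  thus ?thesis by (simp add: Q_def)
qed

section \<open>The moments of the kernel\<close>

definition MSM_kernel :: "complex \<Rightarrow> complex \<Rightarrow> complex \<Rightarrow> complex \<Rightarrow> complex \<Rightarrow> complex \<Rightarrow> real \<Rightarrow> complex" where
  "MSM_kernel s a a' b b' c u =
     of_real u powr (s - 1) * of_real (1 - u) powr (c - 1) *
     appell_F3 a a' b b' c (1 - of_real u) (1 - of_real (1 / u))"

definition MSM_kernel_value :: "complex \<Rightarrow> complex \<Rightarrow> complex \<Rightarrow> complex \<Rightarrow> complex \<Rightarrow> complex \<Rightarrow> complex" where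
  "MSM_kernel_value s a a' b b' c =
     Gamma c * Gamma (s + a') * Gamma (s + b') * Gamma (s + c - a - b) *
     rGamma (s + a' + b') * rGamma (s + c - a) * rGamma (s + c - b)"

lemma kernel_arguments_slit_plane:
  assumes "0 < u" "u < 1"
  shows "1 - complex_of_real u \<in> slit_plane" "1 - complex_of_real (1 / u) \<in> slit_plane"
proof -
  have "complex_of_real r \<in> slit_plane" if "r < 1" for r using that by (auto simp: slit_plane_def)
  from this[of "1 - u"] this[of "1 - 1 / u"] assms
  show "1 - complex_of_real u \<in> slit_plane" "1 - complex_of_real (1 / u) \<in> slit_plane" by auto
qed

text \<open>Here \<open>Y = 1 - 1/u\<close>, so that \<open>1 - Y = 1/u\<close> and \<open>Y / (Y - 1) = 1 - u\<close>.\<close>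

lemma MSM_kernel_pfaff:
  assumes c: "Re c > 0" and a': "Re a' > 0" and u: "0 < u" "u < 1"
  shows "((\<lambda>(m, l). pfaff_coeff a a' b b' c m l * (of_real u powr (s + a' - 1) * of_real (1 - u) powr (c + of_nat (m + l) - 1)))
            has_sum MSM_kernel s a a' b b' c u) UNIV"
proof -
  obtain F where F: "expands (F3_coeff a a' b b' c) F"
    "\<And>X Y. X \<in> slit_plane \<Longrightarrow> Y \<in> slit_plane \<Longrightarrow> appell_F3 a a' b b' c X Y = F (X, Y)"
    using expands_appell_F3[OF c] by metis
  define w where "w = complex_of_real (1 - u)"
  have w: "norm w < 1" "w \<noteq> 0" using u by (auto simp: w_def simp del: of_real_diff)
  define Q where "Q = (\<Sum>\<^sub>\<infinity>(m, l). pfaff_coeff a a' b b' c m l * w ^ m * w ^ l)"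
  have "(\<lambda>(m, l). pfaff_coeff a a' b b' c m l * w ^ m * w ^ l) summable_on UNIV"
    by (rule abs_summable_summable) (use pfaff_series_abs_summable[OF c a' w(1) w(1), of a b b'] in \<open>simp add: case_prod_unfold\<close>)
  hence Q: "((\<lambda>(m, l). pfaff_coeff a a' b b' c m l * w ^ m * w ^ l) has_sum Q) UNIV" unfolding Q_def by simp
  have Y: "Re (1 - complex_of_real (1 / u)) < 1 / 2"
  proof -
    have "1 / u > 1" using u by simp
    thus ?thesis by (simp del: of_real_divide)
  qed
  have "appell_F3 a a' b b' c (1 - of_real u) (1 - of_real (1 / u)) = F (w, 1 - of_real (1 / u))"
    using kernel_arguments_slit_plane[OF u] by (simp add: F(2) w_def)
  also have "\<dots> = (1 - (1 - complex_of_real (1 / u))) powr (- a') * 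
        (\<Sum>\<^sub>\<infinity>(m, l). pfaff_coeff a a' b b' c m l * w ^ m * ((1 - of_real (1 / u)) / (1 - of_real (1 / u) - 1)) ^ l)"
    by (rule F3_pfaff[OF F(1) c a' w(1) Y])
  also have "(1 - complex_of_real (1 / u)) / (1 - of_real (1 / u) - 1) = w"
    using u by (simp add: w_def field_simps)
  also have "(1 - (1 - complex_of_real (1 / u))) powr (- a') = of_real u powr a'"
  proof -
    have "Ln (complex_of_real (1 / u)) = - Ln (complex_of_real u)"
      using u by (simp only: Ln_of_real zero_less_divide_1_iff) (simp add: ln_div)
    thus ?thesis using u by (simp add: powr_def)
  qed
  finally have F3: "appell_F3 a a' b b' c (1 - of_real u) (1 - of_real (1 / u)) = of_real u powr a' * Q"
    by (simp only: Q_def)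
  have K: "MSM_kernel s a a' b b' c u = (of_real u powr (s + a' - 1) * w powr (c - 1)) * Q"
  proof -
    have "complex_of_real u powr (s + a' - 1) = of_real u powr (s - 1) * of_real u powr a'"
      by (simp flip: powr_add add: algebra_simps)
    thus ?thesis unfolding MSM_kernel_def F3 w_def by (simp only: mult_ac)
  qed
  have eq: "(\<lambda>(m, l). pfaff_coeff a a' b b' c m l * (of_real u powr (s + a' - 1) * of_real (1 - u) powr (c + of_nat (m + l) - 1))) =
        (\<lambda>p. (of_real u powr (s + a' - 1) * w powr (c - 1)) * (\<lambda>(m, l). pfaff_coeff a a' b b' c m l * w ^ m * w ^ l) p)"
  proof (rule ext, safe)
    fix m l
    have "w powr (c + of_nat (m + l) - 1) = w powr (c - 1 + of_nat (m + l))" by (simp add: algebra_simps)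
    also have "\<dots> = w powr (c - 1) * w powr (of_nat (m + l))" by (rule powr_add)
    also have "w powr (of_nat (m + l)) = w ^ m * w ^ l" using w by (simp only: powr_nat' power_add simp_thms)
    finally show "pfaff_coeff a a' b b' c m l * (of_real u powr (s + a' - 1) * of_real (1 - u) powr (c + of_nat (m + l) - 1)) =
        of_real u powr (s + a' - 1) * w powr (c - 1) * (pfaff_coeff a a' b b' c m l * w ^ m * w ^ l)"
      by (simp only: w_def[symmetric] mult_ac)
  qed
  show ?thesis unfolding eq K by (rule has_sum_cmult_right[OF Q])
qed

text \<open>As a function of \<open>N\<close>, \<open>Beta t (e + N)\<close> is a constant times \<open>pochhammer e N / pochhammer (t + e) N\<close>.\<close>

lemma Beta_real_bound:
  assumes t: "t > 0" and e: "e > 0" and t': "t' < t"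
  obtains K where "K > 0" "\<And>N. Beta t (e + real N) \<le> K * (real N + 1) powr (- t')"
proof -
  define \<eta> where "\<eta> = (t - t') / 2"
  have \<eta>: "\<eta> > 0" using t' by (simp add: \<eta>_def)
  obtain A where A: "A > 0" "\<And>k. norm (pochhammer (complex_of_real e) k) \<le> A * poch_size (e + \<eta>) k"
    using pochhammer_bound[of "complex_of_real e" "e + \<eta>"] \<eta> by auto
  obtain B where B: "B > 0" "\<And>k. norm (1 / pochhammer (complex_of_real (t + e)) k) \<le> B / poch_size (t + e - \<eta>) k"
    using inverse_pochhammer_bound[of "complex_of_real (t + e)" "t + e - \<eta>"] t e \<eta> by auto
  define C where "C = norm (Beta (complex_of_real t) (complex_of_real e))"
  have "Beta t (e + real N) \<le> (C + 1) * A * B * (real N + 1) powr (- t')" for N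
  proof -
    have "Beta (complex_of_real t) (complex_of_real e + of_nat N) = of_real (Beta t (e + real N))"
      using Beta_complex_of_real[of t "e + real N"] by simp
    hence "Beta t (e + real N) \<le> norm (Beta (complex_of_real t + of_nat 0) (complex_of_real e + of_nat N))" by simp
    also have "\<dots> = C * (norm (pochhammer (complex_of_real e) N) * norm (1 / pochhammer (complex_of_real (t + e)) N))"
      using t e by (subst Beta_shift) (auto simp: C_def norm_mult norm_divide)
    also have "\<dots> \<le> (C + 1) * ((A * poch_size (e + \<eta>) N) * (B / poch_size (t + e - \<eta>) N))"
      using A B by (intro mult_mono A B) (auto simp: C_def intro!: mult_nonneg_nonneg less_imp_le[OF A(1)] less_imp_le[OF poch_size_pos])
    also have "\<dots> = (C + 1) * A * B * ((real N + 1) powr (e + \<eta> - 1) / (real N + 1) powr (t + e - \<eta> - 1))"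
      by (simp add: poch_size_def)
    also have "(real N + 1) powr (e + \<eta> - 1) / (real N + 1) powr (t + e - \<eta> - 1) = (real N + 1) powr (- t')"
    proof -
      have "e + \<eta> - 1 - (t + e - \<eta> - 1) = - t'" by (simp add: \<eta>_def field_simps)
      thus ?thesis unfolding powr_diff[symmetric] by simp
    qed
    finally show ?thesis .
  qed
  moreover have "(C + 1) * A * B > 0" using A B by (auto simp: C_def intro!: mult_pos_pos add_nonneg_pos)
  ultimately show ?thesis using that by blast
qed

lemma set_integral_Beta_real:
  assumes "t > 0" "e > (0::real)"
  shows "set_integrable lborel {0<..<1} (\<lambda>u. u powr (t - 1) * (1 - u) powr (e - 1))"
    "(LINT u:{0<..<1}|lborel. u powr (t - 1) * (1 - u) powr (e - 1)) = Beta t e"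
proof -
  show I: "set_integrable lborel {0<..<1} (\<lambda>u. u powr (t - 1) * (1 - u) powr (e - 1))"
    by (rule set_integrable_subset[OF integrable_Beta]) (use assms in auto)
  have "((\<lambda>u. u powr (t - 1) * (1 - u) powr (e - 1)) has_integral Beta t e) {0<..<1}"
    using has_integral_Beta_real[of t e] assms by (simp add: has_integral_Icc_iff_Ioo)
  thus "(LINT u:{0<..<1}|lborel. u powr (t - 1) * (1 - u) powr (e - 1)) = Beta t e"
    using set_borel_integral_eq_integral(2)[OF I] by (simp add: integral_unique)
qed

text \<open>Term by term integration of the transformed series, followed by Gauss's theorem first in \<open>l\<close> and then in \<open>m\<close>. The absolute values of the terms are
integrals of the same kind, with real exponents, so the power bounds justify the interchange.\<close>

lemma MSM_kernel_integral_base: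
  assumes c: "Re c > 0" and a': "Re a' > 0"
    and s: "Re (s + a') > 0" "Re (s + b') > 0" "Re (s + c - a - b) > 0"
  shows "set_integrable lborel {0<..<1} (MSM_kernel s a a' b b' c)"
    and "(LINT u:{0<..<1}|lborel. MSM_kernel s a a' b b' c u) = MSM_kernel_value s a a' b b' c"
proof -
  define \<tau> where "\<tau> = s + a'"
  define T where "T = (\<lambda>(m, l). pfaff_coeff a a' b b' c m l)"
  define d where "d = (\<lambda>(m, l). m + l :: nat)"
  have \<tau>: "Re \<tau> > 0" using s by (simp add: \<tau>_def)
  have cd: "Re (c + of_nat N) > 0" for N using c by simp
  obtain t' where t': "t' < Re \<tau>"
    "(\<lambda>(m, l). norm (pfaff_coeff a a' b b' c m l) * (real (m + l) + 1) powr (- t')) summable_on UNIV"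
    using pfaff_coeff_weighted_summable[OF c a', of "Re \<tau>" b' a b] s by (auto simp: \<tau>_def)
  obtain K where K: "K > 0" "\<And>N. Beta (Re \<tau>) (Re c + real N) \<le> K * (real N + 1) powr (- t')"
    using Beta_real_bound[OF \<tau> c t'(1)] by metis
  define f where "f = (\<lambda>p u. indicat_real {0<..<1} u *\<^sub>R (T p * (of_real u powr (\<tau> - 1) * of_real (1 - u) powr (c + of_nat (d p) - 1))))"
  have f_int: "integrable lborel (f p)" for p
    using set_integrable_mult_right[OF set_integrable_Beta_complex[OF \<tau> cd[of "d p"]], of "T p"]
    by (simp add: f_def set_integrable_def)
  have f_val: "(LINT u|lborel. f p u) = T p * Beta \<tau> (c + of_nat (d p))" for p
  proof -
    have "(LINT u|lborel. f p u) = (LINT u:{0<..<1}|lborel. T p * (of_real u powr (\<tau> - 1) * of_real (1 - u) powr (c + of_nat (d p) - 1)))"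
      unfolding f_def set_lebesgue_integral_def ..
    also have "\<dots> = T p * Beta \<tau> (c + of_nat (d p))"
      using set_integral_Beta_complex[OF \<tau> cd[of "d p"]] by (simp only: set_integral_mult_right)
    finally show ?thesis .
  qed
  have f_norm: "norm (f p u) = norm (T p) * (indicat_real {0<..<1} u *\<^sub>R (u powr (Re \<tau> - 1) * (1 - u) powr (Re c + real (d p) - 1)))" for p u
    by (cases "u \<in> {0<..<1}") (auto simp: f_def norm_mult norm_powr_real_powr simp del: of_real_diff)
  have f_norm_int: "(LINT u|lborel. norm (f p u)) = norm (T p) * Beta (Re \<tau>) (Re c + real (d p))" for p
    using set_integral_Beta_real(2)[of "Re \<tau>" "Re c + real (d p)"] \<tau> c
    unfolding f_norm set_lebesgue_integral_def by simp
  have "(\<lambda>p. norm (T p) * (real (d p) + 1) powr (- t')) summable_on UNIV"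
    using t'(2) by (simp add: T_def d_def case_prod_unfold)
  hence sm: "(\<lambda>p. K * (norm (T p) * (real (d p) + 1) powr (- t'))) summable_on UNIV" by (rule summable_on_cmult_right)
  have sm_int: "(\<lambda>p. norm (LINT u|lborel. norm (f p u))) summable_on UNIV"
  proof (rule Infinite_Sum.abs_summable_on_comparison_test'[OF sm])
    fix p
    have "0 \<le> (LINT u|lborel. norm (f p u))" by simp
    hence "norm (LINT u|lborel. norm (f p u)) = norm (T p) * Beta (Re \<tau>) (Re c + real (d p))" using f_norm_int[of p] by simp
    also have "\<dots> \<le> norm (T p) * (K * (real (d p) + 1) powr (- t'))" by (intro mult_left_mono K) auto
    finally show "norm (LINT u|lborel. norm (f p u)) \<le> K * (norm (T p) * (real (d p) + 1) powr (- t'))" by (simp add: mult_ac)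
  qed
  have kernel: "((\<lambda>p. f p u) has_sum indicat_real {0<..<1} u *\<^sub>R MSM_kernel s a a' b b' c u) UNIV" for u
  proof (cases "u \<in> {0<..<1}")
    case True
    thus ?thesis using MSM_kernel_pfaff[OF c a', of u a b b' s]
      by (simp add: f_def T_def d_def \<tau>_def case_prod_unfold)
  qed (simp add: f_def)
  \<comment> \<open>the double series is enumerated as a sequence in order to integrate it term by term\<close>
  define g where "g i = f (prod_decode i)" for i
  have reindex: "((\<lambda>i. h (prod_decode i)) has_sum S) UNIV \<longleftrightarrow> (h has_sum S) UNIV" for h :: "nat \<times> nat \<Rightarrow> complex" and S
    using has_sum_reindex_bij_betw[OF bij_prod_decode, of h S] .
  have g_sums: "(\<lambda>i. g i u) sums (indicat_real {0<..<1} u *\<^sub>R MSM_kernel s a a' b b' c u)" for u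
    using kernel[of u] unfolding g_def by (intro has_sum_imp_sums) (subst reindex)
  have g_summable: "summable (\<lambda>i. norm (g i u))" for u
  proof -
    have "(\<lambda>i. g i u) summable_on UNIV" unfolding g_def
      using kernel[of u] reindex[of "\<lambda>p. f p u"] by (auto simp: summable_on_def)
    thus ?thesis unfolding summable_on_iff_abs_summable_on_complex by (rule summable_on_imp_summable)
  qed
  have g_int_summable: "summable (\<lambda>i. LINT u|lborel. norm (g i u))"
  proof -
    have "(\<lambda>i. norm (LINT u|lborel. norm (f (prod_decode i) u))) summable_on UNIV"
      using sm_int summable_on_reindex_bij_betw[OF bij_prod_decode, of "\<lambda>p. norm (LINT u|lborel. norm (f p u))"] by simp
    hence "(\<lambda>i. LINT u|lborel. norm (g i u)) summable_on UNIV"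
      unfolding g_def by (subst summable_on_iff_abs_summable_on_real)
    thus ?thesis by (rule summable_on_imp_summable)
  qed
  have suminf_g: "(\<Sum>i. g i u) = indicat_real {0<..<1} u *\<^sub>R MSM_kernel s a a' b b' c u" for u
    using g_sums by (rule sums_unique[symmetric])
  have g_int: "integrable lborel (g i)" for i unfolding g_def by (rule f_int)
  show "set_integrable lborel {0<..<1} (MSM_kernel s a a' b b' c)"
    using integrable_suminf[OF g_int AE_I2[OF g_summable] g_int_summable] by (simp add: set_integrable_def suminf_g)
  have I: "(\<lambda>i. LINT u|lborel. g i u) sums (LINT u:{0<..<1}|lborel. MSM_kernel s a a' b b' c u)"
    using sums_integral[OF g_int AE_I2[OF g_summable] g_int_summable] by (simp add: set_lebesgue_integral_def suminf_g)
  define G where "G = (\<lambda>(m, l). pfaff_coeff a a' b b' c m l * Beta \<tau> (c + of_nat (m + l)))"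
  have gG: "(LINT u|lborel. g i u) = G (prod_decode i)" for i
    unfolding g_def f_val by (simp add: G_def T_def d_def case_prod_unfold)
  have "summable (\<lambda>i. norm (G (prod_decode i)))"
    unfolding gG[symmetric] by (rule summable_comparison_test'[OF g_int_summable, of 0]) simp
  hence "((\<lambda>i. G (prod_decode i)) has_sum (LINT u:{0<..<1}|lborel. MSM_kernel s a a' b b' c u)) UNIV"
    by (rule norm_summable_imp_has_sum[OF _ I[unfolded gG]])
  hence G: "(G has_sum (LINT u:{0<..<1}|lborel. MSM_kernel s a a' b b' c u)) (Sigma UNIV (\<lambda>_. UNIV))"
    by (subst (asm) reindex) simp
  define C where "C = Gamma \<tau> * Gamma c * (Gamma (s + b') * rGamma (s + a' + b'))"
  have "((\<lambda>m. C * gauss_term a b (s + c) m) has_sum (LINT u:{0<..<1}|lborel. MSM_kernel s a a' b b' c u)) UNIV"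
  proof (rule has_sum_SigmaD[OF G])
    fix m
    define k where "k = Gamma \<tau> * Gamma c * (pochhammer a m * pochhammer b m / fact m)"
    have eq: "(\<lambda>l. G (m, l)) = (\<lambda>l. k * gauss_term a' (c - b' + of_nat m) (\<tau> + c + of_nat m) l)"
    proof
      fix l
      have nz: "pochhammer c (m + l) \<noteq> 0" using Re_pos_not_nonpos_Int[OF c] by (auto simp: pochhammer_eq_0_iff)
      have "Gamma (c + of_nat (m + l)) = pochhammer c (m + l) * Gamma c"
        using pochhammer_Gamma[OF Re_pos_not_nonpos_Int[OF c], of "m + l"] Gamma_nonzero_Re_pos[OF c] by simp
      hence "Beta \<tau> (c + of_nat (m + l)) = Gamma \<tau> * (pochhammer c (m + l) * Gamma c) * rGamma (\<tau> + c + of_nat m + of_nat l)"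
        unfolding Beta_altdef by (simp add: add_ac)
      thus "G (m, l) = k * gauss_term a' (c - b' + of_nat m) (\<tau> + c + of_nat m) l"
        using nz by (simp add: G_def pfaff_coeff_def k_def gauss_term_def)
    qed
    have gs: "Re (\<tau> + c + of_nat m - a' - (c - b' + of_nat m)) > 0" using s by (simp add: \<tau>_def)
    have "((\<lambda>l. G (m, l)) has_sum k * (Gamma (\<tau> + c + of_nat m - a' - (c - b' + of_nat m)) * 
              rGamma (\<tau> + c + of_nat m - a') * rGamma (\<tau> + c + of_nat m - (c - b' + of_nat m)))) UNIV"
      unfolding eq by (rule has_sum_cmult_right[OF gauss_sum[OF gs]])
    also have "\<tau> + c + of_nat m - a' - (c - b' + of_nat m) = s + b'" by (simp add: \<tau>_def)
    also have "\<tau> + c + of_nat m - a' = s + c + of_nat m" by (simp add: \<tau>_def)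
    also have "\<tau> + c + of_nat m - (c - b' + of_nat m) = s + a' + b'" by (simp add: \<tau>_def)
    also have "k * (Gamma (s + b') * rGamma (s + c + of_nat m) * rGamma (s + a' + b')) = C * gauss_term a b (s + c) m"
      by (simp add: k_def C_def gauss_term_def mult_ac)
    finally show "((\<lambda>l. G (m, l)) has_sum C * gauss_term a b (s + c) m) UNIV" .
  qed
  moreover have "((\<lambda>m. C * gauss_term a b (s + c) m) has_sum C * (Gamma (s + c - a - b) * rGamma (s + c - a) * rGamma (s + c - b))) UNIV"
    by (rule has_sum_cmult_right[OF gauss_sum[OF s(3)]])
  ultimately have "(LINT u:{0<..<1}|lborel. MSM_kernel s a a' b b' c u) = C * (Gamma (s + c - a - b) * rGamma (s + c - a) * rGamma (s + c - b))"
    by (rule has_sum_unique)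
  thus "(LINT u:{0<..<1}|lborel. MSM_kernel s a a' b b' c u) = MSM_kernel_value s a a' b b' c"
    by (simp add: C_def MSM_kernel_value_def \<tau>_def mult_ac)
qed

text \<open>Since \<open>1 - 1/u = - (1 - u) / u\<close>, the factor \<open>Y\<close> in the contiguous relation of Appell's function lowers \<open>s\<close> and raises the exponent of \<open>1 - u\<close>.\<close>

lemma MSM_kernel_contiguous:
  assumes c: "Re c > 0" and u: "0 < u" "u < 1"
  shows "MSM_kernel s a a' b b' c u =
           MSM_kernel s a (a' + 1) b b' c u + b' / c * MSM_kernel (s - 1) a (a' + 1) b (b' + 1) (c + 1) u"
proof -
  let ?X = "1 - complex_of_real u" and ?Y = "1 - complex_of_real (1 / u)"
  have 1: "of_real u powr (s - 1) = of_real u powr (s - 1 - 1) * (of_real u :: complex)"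
    using u powr_add[of "complex_of_real u" "s - 1 - 1" 1] by simp
  have 2: "of_real (1 - u) powr (c + 1 - 1) = of_real (1 - u) powr (c - 1) * complex_of_real (1 - u)"
    using u powr_add[of "complex_of_real (1 - u)" "c - 1" 1] by simp
  have 3: "complex_of_real (1 - u) = - (of_real u * ?Y)"
    using u by (simp add: field_simps)
  have alg: "A * U * B * (F - k * Y * G) = A * U * B * F + k * (A * (B * (- (U * Y))) * G)"
    for A U B F k Y G :: complex by (simp add: algebra_simps)
  show ?thesis
    unfolding MSM_kernel_def appell_F3_contiguous_snd[OF c kernel_arguments_slit_plane[OF u], of a a' b b'] 2
    unfolding 1 alg 3[symmetric] ..
qed

lemma MSM_kernel_value_contiguous:
  assumes c: "Re c > 0" and s: "Re (s + a') > 0"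
  shows "MSM_kernel_value s a a' b b' c =
           MSM_kernel_value s a (a' + 1) b b' c + b' / c * MSM_kernel_value (s - 1) a (a' + 1) b (b' + 1) (c + 1)"
proof -
  define R where "R = Gamma c * Gamma (s + a') * Gamma (s + b') * Gamma (s + c - a - b) * rGamma (s + c - a) * rGamma (s + c - b)"
  have G: "Gamma (s + a' + 1) = (s + a') * Gamma (s + a')" "Gamma (c + 1) = c * Gamma c"
    using Re_pos_not_nonpos_Int[OF s] Re_pos_not_nonpos_Int[OF c] by (auto intro!: Gamma_plus1)
  have rG: "rGamma (s + a' + b') = (s + a' + b') * rGamma (s + a' + b' + 1)"
    using rGamma_plus1[of "s + a' + b'"] by simp
  have "c \<noteq> 0" using c by auto
  have 1: "MSM_kernel_value s a (a' + 1) b b' c = R * ((s + a') * rGamma (s + a' + b' + 1))"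
    by (simp add: MSM_kernel_value_def R_def G add.assoc[symmetric]) (simp add: add_ac mult_ac)
  have 2: "b' / c * MSM_kernel_value (s - 1) a (a' + 1) b (b' + 1) (c + 1) = R * (b' * rGamma (s + a' + b' + 1))"
  proof -
    have e: "s - 1 + (a' + 1) = s + a'" "s - 1 + (b' + 1) = s + b'" "s - 1 + (c + 1) = s + c" 
      "s + a' + (b' + 1) = s + a' + b' + 1" by simp_all
    show ?thesis unfolding MSM_kernel_value_def e G R_def using \<open>c \<noteq> 0\<close> by simp
  qed
  have "MSM_kernel_value s a a' b b' c = R * ((s + a' + b') * rGamma (s + a' + b' + 1))"
    unfolding rG[symmetric] by (simp only: MSM_kernel_value_def R_def mult_ac)
  thus ?thesis unfolding 1 2 distrib_left[symmetric] distrib_right[symmetric] .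
qed

text \<open>Induction on \<open>N\<close>: the contiguous relation raises \<open>a'\<close>, and in its second term, where \<open>s\<close> drops by 1, the quantities \<open>s + a'\<close>, \<open>s + b'\<close> and
\<open>s + c - a - b\<close> keep their values.\<close>

lemma MSM_kernel_integral_Re_gt:
  assumes c: "Re c > 0" and s: "Re (s + a') > 0" "Re (s + b') > 0" "Re (s + c - a - b) > 0" and N: "Re a' > - real N"
  shows "set_integrable lborel {0<..<1} (MSM_kernel s a a' b b' c) \<and>
         (LINT u:{0<..<1}|lborel. MSM_kernel s a a' b b' c u) = MSM_kernel_value s a a' b b' c"
  using assms
proof (induction N arbitrary: s a' b' c)
  case 0
  thus ?case using MSM_kernel_integral_base[of c a' s b' a b] by simp
next
  case (Suc N)
  have 1: "set_integrable lborel {0<..<1} (MSM_kernel s a (a' + 1) b b' c) \<and>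
         (LINT u:{0<..<1}|lborel. MSM_kernel s a (a' + 1) b b' c u) = MSM_kernel_value s a (a' + 1) b b' c"
    by (rule Suc.IH) (use Suc.prems in auto)
  have 2: "set_integrable lborel {0<..<1} (MSM_kernel (s - 1) a (a' + 1) b (b' + 1) (c + 1)) \<and>
         (LINT u:{0<..<1}|lborel. MSM_kernel (s - 1) a (a' + 1) b (b' + 1) (c + 1) u) = MSM_kernel_value (s - 1) a (a' + 1) b (b' + 1) (c + 1)"
    by (rule Suc.IH) (use Suc.prems in auto)
  let ?rhs = "\<lambda>u. MSM_kernel s a (a' + 1) b b' c u + b' / c * MSM_kernel (s - 1) a (a' + 1) b (b' + 1) (c + 1) u"
  have eq: "MSM_kernel s a a' b b' c u = ?rhs u" if "u \<in> {0<..<1}" for u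
    by (rule MSM_kernel_contiguous[OF Suc.prems(1)]) (use that in auto)
  have int2: "set_integrable lborel {0<..<1} (\<lambda>u. b' / c * MSM_kernel (s - 1) a (a' + 1) b (b' + 1) (c + 1) u)"
    by (rule set_integrable_mult_right) (use 2 in blast)
  note int1 = conjunct1[OF 1]
  have "set_integrable lborel {0<..<1} ?rhs" by (rule set_integral_add(1)[OF int1 int2])
  moreover have "set_integrable lborel {0<..<1} (MSM_kernel s a a' b b' c) = set_integrable lborel {0<..<1} ?rhs"
    by (rule set_integrable_cong[OF refl refl eq]) auto
  ultimately have "set_integrable lborel {0<..<1} (MSM_kernel s a a' b b' c)" by blast
  moreover have "(LINT u:{0<..<1}|lborel. MSM_kernel s a a' b b' c u) = (LINT u:{0<..<1}|lborel. ?rhs u)"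
  proof (rule set_lebesgue_integral_cong)
    show "\<forall>u. u \<in> {0<..<1} \<longrightarrow> MSM_kernel s a a' b b' c u = ?rhs u" by (intro allI impI eq)
  qed simp
  moreover have "(LINT u:{0<..<1}|lborel. ?rhs u) = MSM_kernel_value s a (a' + 1) b b' c + b' / c * MSM_kernel_value (s - 1) a (a' + 1) b (b' + 1) (c + 1)"
    unfolding set_integral_add(2)[OF int1 int2] set_integral_mult_right conjunct2[OF 1] conjunct2[OF 2] ..
  ultimately show ?case unfolding MSM_kernel_value_contiguous[OF Suc.prems(1,2), of a b b'] by metis
qed

theorem MSM_kernel_integral:
  assumes c: "Re c > 0" and s: "Re (s + a') > 0" "Re (s + b') > 0" "Re (s + c - a - b) > 0"
  shows "set_integrable lborel {0<..<1} (MSM_kernel s a a' b b' c)"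
    and "(LINT u:{0<..<1}|lborel. MSM_kernel s a a' b b' c u) = MSM_kernel_value s a a' b b' c"
proof -
  obtain N :: nat where "real N > - Re a'" using reals_Archimedean2 by blast
  thus "set_integrable lborel {0<..<1} (MSM_kernel s a a' b b' c)"
    "(LINT u:{0<..<1}|lborel. MSM_kernel s a a' b b' c u) = MSM_kernel_value s a a' b b' c"
    using MSM_kernel_integral_Re_gt[OF assms, of N] by auto
qed

section \<open>Jacobi type polynomials under the integral operator\<close>

lemma jacobi_M_eq_pochhammer_sum:
  assumes q: "q + 1 \<notin> \<int>\<^sub>\<le>\<^sub>0"
  shows "jacobi_M n p q z =
     (-1) ^ n * (Gamma (q + of_nat n + 1) / Gamma (q + 1)) *
     (\<Sum>k\<le>n. pochhammer (1 + of_nat n - p) k * pochhammer (- of_nat n) k / (pochhammer (1 + q) k * fact k) * (- z) ^ k)"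
proof -
  have G: "Gamma (q + of_nat n + 1) / Gamma (q + 1) = pochhammer (1 + q) n"
    using pochhammer_Gamma[OF q, of n] by (simp add: add_ac)
  have "fact n * (((p - of_nat n - 1) gchoose k) * ((q + of_nat n) gchoose (n - k))) =
        pochhammer (1 + q) n * (pochhammer (1 + of_nat n - p) k * pochhammer (- of_nat n) k / (pochhammer (1 + q) k * fact k))"
    if k: "k \<le> n" for k
  proof -
    have nz: "pochhammer (1 + q) k \<noteq> 0" using q by (auto simp: pochhammer_eq_0_iff add.commute)
    have 1: "(p - of_nat n - 1) gchoose k = (-1) ^ k * pochhammer (1 + of_nat n - p) k / fact k"
      by (simp add: gbinomial_pochhammer algebra_simps)
    have e: "q + of_nat n - of_nat (n - k) + 1 = 1 + q + of_nat k" using k by (simp add: of_nat_diff)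
    have 2: "(q + of_nat n) gchoose (n - k) = pochhammer (1 + q + of_nat k) (n - k) / fact (n - k)"
      unfolding gbinomial_pochhammer' e ..
    have 3: "pochhammer (1 + q) n = pochhammer (1 + q) k * pochhammer (1 + q + of_nat k) (n - k)"
      using k by (rule pochhammer_product)
    have s: "((-1) ^ k * (-1) ^ k :: complex) = 1" by (simp flip: power_mult_distrib)
    have "fact n * (((p - of_nat n - 1) gchoose k) * ((q + of_nat n) gchoose (n - k))) =
       ((-1) ^ k * (-1) ^ k) * (pochhammer (- of_nat n) k * (pochhammer (1 + of_nat n - p) k / fact k * pochhammer (1 + q + of_nat k) (n - k)))"
      unfolding 1 2 fact_eq_pochhammer_neg[OF k] by simp
    thus ?thesis unfolding s 3 using nz by simp
  qed
  hence *: "(\<Sum>k\<le>n. fact n * (((p - of_nat n - 1) gchoose k) * ((q + of_nat n) gchoose (n - k))) * (- z) ^ k) =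
     (\<Sum>k\<le>n. pochhammer (1 + q) n * (pochhammer (1 + of_nat n - p) k * pochhammer (- of_nat n) k / (pochhammer (1 + q) k * fact k)) * (- z) ^ k)"
    by (intro sum.cong) auto
  have "jacobi_M n p q z = (-1) ^ n * (\<Sum>k\<le>n. fact n * (((p - of_nat n - 1) gchoose k) * ((q + of_nat n) gchoose (n - k))) * (- z) ^ k)"
    unfolding jacobi_M_def by (simp only: sum_distrib_left mult.assoc)
  thus ?thesis unfolding * G by (simp only: sum_distrib_left mult.assoc)
qed

lemma hypergeom_terminating:
  fixes z :: complex
  shows "hypergeom [a, - of_nat n, b1, b2, b3] [d, e1, e2, e3] z =
     (\<Sum>k\<le>n. pochhammer a k * pochhammer (- of_nat n) k * pochhammer b1 k * pochhammer b2 k * pochhammer b3 k /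
        (pochhammer d k * pochhammer e1 k * pochhammer e2 k * pochhammer e3 k * fact k) * z ^ k)"
proof -
  have "hypergeom [a, - of_nat n, b1, b2, b3] [d, e1, e2, e3] z =
     (\<Sum>k. pochhammer a k * pochhammer (- of_nat n) k * pochhammer b1 k * pochhammer b2 k * pochhammer b3 k /
        (pochhammer d k * pochhammer e1 k * pochhammer e2 k * pochhammer e3 k * fact k) * z ^ k)"
    unfolding hypergeom_def eval_fps_def by simp
  also have "\<dots> = (\<Sum>k\<le>n. pochhammer a k * pochhammer (- of_nat n) k * pochhammer b1 k * pochhammer b2 k * pochhammer b3 k /
        (pochhammer d k * pochhammer e1 k * pochhammer e2 k * pochhammer e3 k * fact k) * z ^ k)"
    by (rule suminf_finite) (auto simp: pochhammer_of_nat_eq_0_lemma)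
  finally show ?thesis .
qed

lemma MSM_integrand_power:
  assumes x: "x > 0" and u: "0 < u" "u < 1"
  shows "of_real (x - x * u) powr (\<epsilon> - 1) * of_real (x * u) powr (- \<delta>') *
           appell_F3 \<delta> \<delta>' \<mu> \<mu>' \<epsilon> (1 - of_real (x * u / x)) (1 - of_real (x / (x * u))) *
           (of_real (x * u) powr (\<tau> - 1) * of_real (x * u) ^ k) =
         of_real x powr (\<tau> + of_nat k - \<delta>' + \<epsilon> - 2) * MSM_kernel (\<tau> + of_nat k - \<delta>') \<delta> \<delta>' \<mu> \<mu>' \<epsilon> u"
proof -
  have 1: "of_real (x - x * u) powr (\<epsilon> - 1) = of_real x powr (\<epsilon> - 1) * complex_of_real (1 - u) powr (\<epsilon> - 1)"
  proof -
    have "x - x * u = x * (1 - u)" by (simp add: algebra_simps)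
    thus ?thesis using x u by (simp only: of_real_mult) (intro powr_times_real; simp)
  qed
  have 2: "of_real (x * u) powr (- \<delta>') * (of_real (x * u) powr (\<tau> - 1) * of_real (x * u) ^ k) =
           of_real x powr (\<tau> + of_nat k - \<delta>' - 1) * complex_of_real u powr (\<tau> + of_nat k - \<delta>' - 1)"
  proof -
    have "complex_of_real (x * u) ^ k = of_real (x * u) powr (of_nat k)"
      by (rule powr_nat'[symmetric]) (use x u in simp)
    hence "of_real (x * u) powr (- \<delta>') * (of_real (x * u) powr (\<tau> - 1) * of_real (x * u) ^ k) =
       complex_of_real (x * u) powr (- \<delta>' + (\<tau> - 1 + of_nat k))"
      by (simp only: powr_add)
    also have "- \<delta>' + (\<tau> - 1 + of_nat k) = \<tau> + of_nat k - \<delta>' - 1" by simp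
    also have "complex_of_real (x * u) powr (\<tau> + of_nat k - \<delta>' - 1) =
        of_real x powr (\<tau> + of_nat k - \<delta>' - 1) * complex_of_real u powr (\<tau> + of_nat k - \<delta>' - 1)"
      using x u by (simp only: of_real_mult) (intro powr_times_real; simp)
    finally show ?thesis .
  qed
  have 3: "of_real x powr (\<tau> + of_nat k - \<delta>' + \<epsilon> - 2) = complex_of_real x powr (\<epsilon> - 1) * of_real x powr (\<tau> + of_nat k - \<delta>' - 1)"
    unfolding powr_add[symmetric] by (simp add: algebra_simps)
  have 4: "x * u / x = u" "x / (x * u) = 1 / u" using x u by auto
  have "of_real (x - x * u) powr (\<epsilon> - 1) * of_real (x * u) powr (- \<delta>') *
           appell_F3 \<delta> \<delta>' \<mu> \<mu>' \<epsilon> (1 - of_real (x * u / x)) (1 - of_real (x / (x * u))) *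
           (of_real (x * u) powr (\<tau> - 1) * of_real (x * u) ^ k) =
        of_real (x - x * u) powr (\<epsilon> - 1) * (of_real (x * u) powr (- \<delta>') * (of_real (x * u) powr (\<tau> - 1) * of_real (x * u) ^ k)) *
        appell_F3 \<delta> \<delta>' \<mu> \<mu>' \<epsilon> (1 - of_real u) (1 - of_real (1 / u))"
    unfolding 4 by (simp only: mult_ac)
  also have "\<dots> = of_real x powr (\<tau> + of_nat k - \<delta>' + \<epsilon> - 2) * MSM_kernel (\<tau> + of_nat k - \<delta>') \<delta> \<delta>' \<mu> \<mu>' \<epsilon> u"
    unfolding 1 2 3 MSM_kernel_def by (simp only: mult_ac)
  finally show ?thesis .
qed

lemma set_integral_dilation:
  fixes g :: "real \<Rightarrow> complex"
  assumes x: "x > 0" and int: "set_integrable lborel {0<..<1} (\<lambda>u. g (x * u))"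
  shows "set_integrable lborel {0<..<x} g"
    and "(LINT t:{0<..<x}|lborel. g t) = of_real x * (LINT u:{0<..<1}|lborel. g (x * u))"
proof -
  have eq: "indicat_real {0<..<x} (0 + x * u) *\<^sub>R g (0 + x * u) = indicat_real {0<..<1} u *\<^sub>R g (x * u)" for u
    using x by (auto simp: indicator_def zero_less_mult_iff)
  show "set_integrable lborel {0<..<x} g"
    using int lborel_integrable_real_affine_iff[of x "\<lambda>t. indicat_real {0<..<x} t *\<^sub>R g t" 0] x
    unfolding set_integrable_def eq by simp
  show "(LINT t:{0<..<x}|lborel. g t) = of_real x * (LINT u:{0<..<1}|lborel. g (x * u))"
    using lborel_integral_real_affine[of x "\<lambda>t. indicat_real {0<..<x} t *\<^sub>R g t" 0] x
    unfolding set_lebesgue_integral_def eq by (simp add: scaleR_conv_of_real)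
qed

lemma MSM_kernel_value_shift:
  assumes \<tau>: "Re \<tau> > 0" "Re (\<tau> + \<epsilon> - \<delta> - \<delta>' - \<mu>) > 0" "Re (\<tau> + \<mu>' - \<delta>') > 0"
    and np: "\<tau> + \<mu>' \<notin> \<int>\<^sub>\<le>\<^sub>0" "\<tau> + \<epsilon> - \<delta> - \<delta>' \<notin> \<int>\<^sub>\<le>\<^sub>0" "\<tau> + \<epsilon> - \<delta>' - \<mu> \<notin> \<int>\<^sub>\<le>\<^sub>0"
  shows "MSM_kernel_value (\<tau> + of_nat k - \<delta>') \<delta> \<delta>' \<mu> \<mu>' \<epsilon> =
     Gamma \<epsilon> * (Gamma \<tau> * Gamma (\<tau> + \<epsilon> - \<delta> - \<delta>' - \<mu>) * Gamma (\<tau> + \<mu>' - \<delta>') /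
       (Gamma (\<tau> + \<mu>') * Gamma (\<tau> + \<epsilon> - \<delta> - \<delta>') * Gamma (\<tau> + \<epsilon> - \<delta>' - \<mu>))) *
     (pochhammer \<tau> k * pochhammer (\<tau> + \<epsilon> - \<delta> - \<delta>' - \<mu>) k * pochhammer (\<tau> + \<mu>' - \<delta>') k /
       (pochhammer (\<tau> + \<mu>') k * pochhammer (\<tau> + \<epsilon> - \<delta> - \<delta>') k * pochhammer (\<tau> + \<epsilon> - \<delta>' - \<mu>) k))"
proof -
  have G: "Gamma (z + of_nat k) = Gamma z * pochhammer z k" if "Re z > 0" for z :: complex
    using pochhammer_Gamma[OF Re_pos_not_nonpos_Int[OF that], of k] Gamma_nonzero_Re_pos[OF that] by simp
  have rG: "rGamma (z + of_nat k) = 1 / (Gamma z * pochhammer z k)" if "z \<notin> \<int>\<^sub>\<le>\<^sub>0" for z :: complex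
  proof -
    have "pochhammer z k \<noteq> 0" using that by (auto simp: pochhammer_eq_0_iff)
    hence "rGamma (z + of_nat k) = rGamma z / pochhammer z k" using pochhammer_rGamma[of z k] by simp
    thus ?thesis by (simp add: rGamma_inverse_Gamma divide_inverse)
  qed
  have e: "\<tau> + of_nat k - \<delta>' + \<delta>' = \<tau> + of_nat k" "\<tau> + of_nat k - \<delta>' + \<mu>' = \<tau> + \<mu>' - \<delta>' + of_nat k"
    "\<tau> + of_nat k - \<delta>' + \<epsilon> - \<delta> - \<mu> = \<tau> + \<epsilon> - \<delta> - \<delta>' - \<mu> + of_nat k"
    "\<tau> + \<epsilon> - \<delta> - \<delta>' + of_nat k - \<mu> = \<tau> + \<epsilon> - \<delta> - \<delta>' - \<mu> + of_nat k"
    "\<tau> + of_nat k + \<mu>' = \<tau> + \<mu>' + of_nat k"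
    "\<tau> + of_nat k - \<delta>' + \<epsilon> - \<delta> = \<tau> + \<epsilon> - \<delta> - \<delta>' + of_nat k"
    "\<tau> + of_nat k - \<delta>' + \<epsilon> - \<mu> = \<tau> + \<epsilon> - \<delta>' - \<mu> + of_nat k" by simp_all
  show ?thesis
    unfolding MSM_kernel_value_def e G[OF \<tau>(1)] G[OF \<tau>(2)] G[OF \<tau>(3)] rG[OF np(1)] rG[OF np(2)] rG[OF np(3)]
    by (simp add: mult_ac)
qed

theorem theorem1:
  fixes n :: nat and p q \<delta> \<delta>' \<mu> \<mu>' \<epsilon> \<tau> :: complex and x :: real
  assumes "\<forall>k::nat. k \<ge> 1 \<longrightarrow> q \<noteq> - of_nat k"
    and "Re \<epsilon> > 0"
    and "Re \<tau> > Max {0, Re (\<delta> + \<delta>' + \<mu> - \<epsilon>), Re (\<delta>' - \<mu>')}"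
    and "\<tau> + \<mu>' \<notin> \<int>\<^sub>\<le>\<^sub>0"
    and "\<tau> + \<epsilon> - \<delta> - \<delta>' \<notin> \<int>\<^sub>\<le>\<^sub>0"
    and "\<tau> + \<epsilon> - \<delta>' - \<mu> \<notin> \<int>\<^sub>\<le>\<^sub>0"
    and "x > 0"
  shows "set_integrable lborel {0<..<x}
           (MSM_integrand \<delta> \<delta>' \<mu> \<mu>' \<epsilon>
              (\<lambda>t. of_real t powr (\<tau> - 1) * jacobi_M n p q (of_real t)) x) \<and>
         MSM_integral \<delta> \<delta>' \<mu> \<mu>' \<epsilon>
           (\<lambda>t. of_real t powr (\<tau> - 1) * jacobi_M n p q (of_real t)) x =
         of_real x powr (\<tau> - \<delta> - \<delta>' + \<epsilon> - 1) *
         ((-1) ^ n * Gamma (q + of_nat n + 1) * Gamma \<tau> *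
            Gamma (\<tau> + \<epsilon> - \<delta> - \<delta>' - \<mu>) * Gamma (\<tau> + \<mu>' - \<delta>') /
          (Gamma (q + 1) * Gamma (\<tau> + \<mu>') * Gamma (\<tau> + \<epsilon> - \<delta> - \<delta>') *
            Gamma (\<tau> + \<epsilon> - \<delta>' - \<mu>))) *
         hypergeom
           [1 + of_nat n - p, - of_nat n, \<tau>, \<tau> + \<epsilon> - \<delta> - \<delta>' - \<mu>, \<tau> + \<mu>' - \<delta>']
           [1 + q, \<tau> + \<mu>', \<tau> + \<epsilon> - \<delta> - \<delta>', \<tau> + \<epsilon> - \<delta>' - \<mu>]
           (- of_real x)"
proof -
  have q: "q + 1 \<notin> \<int>\<^sub>\<le>\<^sub>0"
  proof
    assume "q + 1 \<in> \<int>\<^sub>\<le>\<^sub>0"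
    then obtain j where "q + 1 = - of_nat j" by (auto elim!: nonpos_Ints_cases')
    hence "q = - of_nat j - 1" by (simp only: eq_diff_eq)
    hence "q = - of_nat (Suc j)" by simp
    thus False using assms(1) by auto
  qed
  have \<tau>: "Re \<tau> > 0" "Re (\<tau> + \<epsilon> - \<delta> - \<delta>' - \<mu>) > 0" "Re (\<tau> + \<mu>' - \<delta>') > 0"
    using assms(3) by auto
  have x: "x > 0" by fact
  let ?f = "\<lambda>t. complex_of_real t powr (\<tau> - 1) * jacobi_M n p q (of_real t)"
  let ?K = "\<lambda>k. MSM_kernel (\<tau> + of_nat k - \<delta>') \<delta> \<delta>' \<mu> \<mu>' \<epsilon>"
  let ?V = "\<lambda>k. MSM_kernel_value (\<tau> + of_nat k - \<delta>') \<delta> \<delta>' \<mu> \<mu>' \<epsilon>"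
  define C where "C = (-1) ^ n * (Gamma (q + of_nat n + 1) / Gamma (q + 1))"
  define j where "j k = pochhammer (1 + of_nat n - p) k * pochhammer (- of_nat n) k / (pochhammer (1 + q) k * fact k)" for k
  define D where "D k = C * j k * (-1) ^ k * of_real x powr (\<tau> + of_nat k - \<delta>' + \<epsilon> - 2)" for k
  have jac: "jacobi_M n p q z = (\<Sum>k\<le>n. C * j k * (-1) ^ k * z ^ k)" for z
    unfolding jacobi_M_eq_pochhammer_sum[OF q] C_def[symmetric] j_def[symmetric] sum_distrib_left
    by (intro sum.cong refl) (simp add: power_minus[of z])
  have K: "set_integrable lborel {0<..<1} (?K k)" "(LINT u:{0<..<1}|lborel. ?K k u) = ?V k" for k
  proof -
    have "Re (\<tau> + of_nat k - \<delta>' + \<delta>') > 0" "Re (\<tau> + of_nat k - \<delta>' + \<mu>') > 0" "Re (\<tau> + of_nat k - \<delta>' + \<epsilon> - \<delta> - \<mu>) > 0"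
      using \<tau> by auto
    from MSM_kernel_integral[OF assms(2) this]
    show "set_integrable lborel {0<..<1} (?K k)" "(LINT u:{0<..<1}|lborel. ?K k u) = ?V k" .
  qed
  have DK: "set_integrable lborel {0<..<1} (\<lambda>u. D k * ?K k u)" for k
    by (rule set_integrable_mult_right) (rule K)
  have integrand: "MSM_integrand \<delta> \<delta>' \<mu> \<mu>' \<epsilon> ?f x (x * u) = (\<Sum>k\<le>n. D k * ?K k u)" if u: "u \<in> {0<..<1}" for u
  proof -
    have "MSM_integrand \<delta> \<delta>' \<mu> \<mu>' \<epsilon> ?f x (x * u) =
       (\<Sum>k\<le>n. C * j k * (-1) ^ k * (of_real (x - x * u) powr (\<epsilon> - 1) * of_real (x * u) powr (- \<delta>') *
           appell_F3 \<delta> \<delta>' \<mu> \<mu>' \<epsilon> (1 - of_real (x * u / x)) (1 - of_real (x / (x * u))) *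
           (of_real (x * u) powr (\<tau> - 1) * of_real (x * u) ^ k)))"
      unfolding MSM_integrand_def jac sum_distrib_left by (intro sum.cong refl) (simp only: mult_ac)
    also have "\<dots> = (\<Sum>k\<le>n. D k * ?K k u)"
      unfolding MSM_integrand_power[OF x conjunct1[OF u[unfolded greaterThanLessThan_iff]] conjunct2[OF u[unfolded greaterThanLessThan_iff]]]
      by (simp only: D_def mult.assoc)
    finally show ?thesis .
  qed
  have int1: "set_integrable lborel {0<..<1} (\<lambda>u. \<Sum>k\<le>n. D k * ?K k u)"
    using DK unfolding set_integrable_def scaleR_sum_right by (intro Bochner_Integration.integrable_sum)
  have int2: "set_integrable lborel {0<..<1} (\<lambda>u. MSM_integrand \<delta> \<delta>' \<mu> \<mu>' \<epsilon> ?f x (x * u))"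
  proof -
    have "set_integrable lborel {0<..<1} (\<lambda>u. MSM_integrand \<delta> \<delta>' \<mu> \<mu>' \<epsilon> ?f x (x * u)) = 
        set_integrable lborel {0<..<1} (\<lambda>u. \<Sum>k\<le>n. D k * ?K k u)"
      by (rule set_integrable_cong[OF refl refl integrand])
    thus ?thesis using int1 by (rule iffD2)
  qed
  have "(LINT u:{0<..<1}|lborel. MSM_integrand \<delta> \<delta>' \<mu> \<mu>' \<epsilon> ?f x (x * u)) = (LINT u:{0<..<1}|lborel. \<Sum>k\<le>n. D k * ?K k u)"
  proof (rule set_lebesgue_integral_cong)
    show "\<forall>u. u \<in> {0<..<1} \<longrightarrow> MSM_integrand \<delta> \<delta>' \<mu> \<mu>' \<epsilon> ?f x (x * u) = (\<Sum>k\<le>n. D k * ?K k u)"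
      by (intro allI impI integrand)
  qed simp
  also have "\<dots> = (\<Sum>k\<le>n. LINT u:{0<..<1}|lborel. D k * ?K k u)"
    using DK unfolding set_integrable_def set_lebesgue_integral_def scaleR_sum_right
    by (intro Bochner_Integration.integral_sum)
  also have "\<dots> = (\<Sum>k\<le>n. D k * ?V k)" by (simp only: set_integral_mult_right K(2))
  finally have val: "(LINT u:{0<..<1}|lborel. MSM_integrand \<delta> \<delta>' \<mu> \<mu>' \<epsilon> ?f x (x * u)) = (\<Sum>k\<le>n. D k * ?V k)" .
  note dil = set_integral_dilation[OF x int2]
  define R where "R = Gamma \<tau> * Gamma (\<tau> + \<epsilon> - \<delta> - \<delta>' - \<mu>) * Gamma (\<tau> + \<mu>' - \<delta>') /
       (Gamma (\<tau> + \<mu>') * Gamma (\<tau> + \<epsilon> - \<delta> - \<delta>') * Gamma (\<tau> + \<epsilon> - \<delta>' - \<mu>))"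
  define h where "h k = pochhammer \<tau> k * pochhammer (\<tau> + \<epsilon> - \<delta> - \<delta>' - \<mu>) k * pochhammer (\<tau> + \<mu>' - \<delta>') k /
       (pochhammer (\<tau> + \<mu>') k * pochhammer (\<tau> + \<epsilon> - \<delta> - \<delta>') k * pochhammer (\<tau> + \<epsilon> - \<delta>' - \<mu>) k)" for k
  have V: "?V k = Gamma \<epsilon> * R * h k" for k
    unfolding R_def h_def by (rule MSM_kernel_value_shift[OF \<tau> assms(4-6)])
  have "MSM_integral \<delta> \<delta>' \<mu> \<mu>' \<epsilon> ?f x = of_real x powr (- \<delta>) / Gamma \<epsilon> * (of_real x * (\<Sum>k\<le>n. D k * ?V k))"
    unfolding MSM_integral_def dil(2) val ..
  also have "\<dots> = (\<Sum>k\<le>n. of_real x powr (\<tau> - \<delta> - \<delta>' + \<epsilon> - 1) * (C * R) * (j k * h k * (- of_real x) ^ k))"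
    unfolding sum_distrib_left
  proof (intro sum.cong refl)
    fix k
    have pw: "of_real x powr (- \<delta>) * of_real x * of_real x powr (\<tau> + of_nat k - \<delta>' + \<epsilon> - 2) =
          complex_of_real x powr (\<tau> - \<delta> - \<delta>' + \<epsilon> - 1) * of_real x ^ k"
    proof -
      have "of_real x powr (- \<delta>) * of_real x * of_real x powr (\<tau> + of_nat k - \<delta>' + \<epsilon> - 2) =
          complex_of_real x powr (- \<delta> + 1 + (\<tau> + of_nat k - \<delta>' + \<epsilon> - 2))"
        unfolding powr_add using x by simp
      also have "- \<delta> + 1 + (\<tau> + of_nat k - \<delta>' + \<epsilon> - 2) = \<tau> - \<delta> - \<delta>' + \<epsilon> - 1 + of_nat k" by simp
      also have "complex_of_real x powr (\<tau> - \<delta> - \<delta>' + \<epsilon> - 1 + of_nat k) = complex_of_real x powr (\<tau> - \<delta> - \<delta>' + \<epsilon> - 1) * of_real x ^ k"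
        unfolding powr_add[of _ _ "of_nat k"] using x by (simp add: powr_nat')
      finally show ?thesis .
    qed
    have "of_real x powr (- \<delta>) / Gamma \<epsilon> * (of_real x * (D k * ?V k)) =
       (of_real x powr (- \<delta>) * of_real x * of_real x powr (\<tau> + of_nat k - \<delta>' + \<epsilon> - 2)) * (C * R * (j k * h k * (-1) ^ k))"
      unfolding V D_def using Gamma_nonzero_Re_pos[OF assms(2)] by simp
    thus "of_real x powr (- \<delta>) / Gamma \<epsilon> * (of_real x * (D k * ?V k)) =
       of_real x powr (\<tau> - \<delta> - \<delta>' + \<epsilon> - 1) * (C * R) * (j k * h k * (- of_real x) ^ k)"
      unfolding pw power_minus[of "complex_of_real x"] by (simp only: mult_ac)
  qed
  also have "\<dots> = of_real x powr (\<tau> - \<delta> - \<delta>' + \<epsilon> - 1) * (C * R) *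
       hypergeom [1 + of_nat n - p, - of_nat n, \<tau>, \<tau> + \<epsilon> - \<delta> - \<delta>' - \<mu>, \<tau> + \<mu>' - \<delta>']
           [1 + q, \<tau> + \<mu>', \<tau> + \<epsilon> - \<delta> - \<delta>', \<tau> + \<epsilon> - \<delta>' - \<mu>] (- of_real x)"
    unfolding hypergeom_terminating sum_distrib_left[symmetric] by (simp add: j_def h_def mult_ac)
  finally have "MSM_integral \<delta> \<delta>' \<mu> \<mu>' \<epsilon> ?f x = of_real x powr (\<tau> - \<delta> - \<delta>' + \<epsilon> - 1) * (C * R) *
       hypergeom [1 + of_nat n - p, - of_nat n, \<tau>, \<tau> + \<epsilon> - \<delta> - \<delta>' - \<mu>, \<tau> + \<mu>' - \<delta>']
           [1 + q, \<tau> + \<mu>', \<tau> + \<epsilon> - \<delta> - \<delta>', \<tau> + \<epsilon> - \<delta>' - \<mu>] (- of_real x)" .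
  moreover have "C * R = (-1) ^ n * Gamma (q + of_nat n + 1) * Gamma \<tau> *
            Gamma (\<tau> + \<epsilon> - \<delta> - \<delta>' - \<mu>) * Gamma (\<tau> + \<mu>' - \<delta>') /
          (Gamma (q + 1) * Gamma (\<tau> + \<mu>') * Gamma (\<tau> + \<epsilon> - \<delta> - \<delta>') *
            Gamma (\<tau> + \<epsilon> - \<delta>' - \<mu>))"
    by (simp add: C_def R_def mult_ac)
  ultimately show ?thesis using dil(1) by simp
qed

end
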